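(* Let $1\le p,q<\infty$ and $1\le p_i,q_i<\infty$ for $i=1,\dots,m$ with $\sum_{i=1}^m\frac1{p_i}=\frac1p$ and $\sum_{i=1}^m\frac1{q_i}=\frac1q$. Let $1\le q^*,\xi,\eta<\infty$, and $\alpha_i<0$, $\lambda_i\ge0$ for all $i=1,\dots,m$. Let $\omega\in A_\xi(\mathbb{R}^n)$ and $v\in A_\eta(\mathbb{R}^n)$ have finite critical indices $r_\omega,r_v$ for the reverse Hölder condition, and suppose $\omega(B_k)\lesssim v(B_k)$ for every $k\in\mathbb{Z}$ (with a constant independent of $k$). Assume $q>\max\{mq^*,\,q^*\xi r'_\omega\}$, $\delta_1\in(1,r_\omega)$, $\delta_2\in(1,r_v)$, and that $\alpha^*,\lambda^*$ are two real numbers such that $$\lambda^*=\lambda_1+\cdots+\lambda_m\quad\text{and}\quad\frac1m\Big(\frac{\alpha^*}{n}+\frac1{q^*}\Big)=\frac{\alpha_i}{n}+\frac1{q_i},\quad i=1,\dots,m.$$ Suppose that either (a) $\frac{\alpha^*}{n}+\frac1{q^*}\le0$ and $$\mathcal{C}_{5.1}=\prod_{i=1}^m\Big(\int_{\mathbb{R}^n}\frac{|\Phi(y)|}{|y|^n}|\det A_i^{-1}(y)|^{\frac{m\xi}{q_i}}\|A_i(y)\|^{\frac{m\xi n}{q_i}}\mathcal{B}_{1i}(y)\,dy\Big)^{\frac1m}<\infty,$$ where $$\begin{aligned}\mathcal{B}_{1i}(y)=&\ \|A_i(y)\|^{-\left(\left(\frac{n}{q^*}+\alpha^*\right)\frac{\delta_1-1}{\delta_1}+(\alpha^*-m\lambda_i)\frac{\delta_2-1}{\delta_2}-\xi\alpha^*\right)}\chi_{\{y\in\mathbb{R}^n:\|A_i(y)\|<1\}}\\&+\|A_i(y)\|^{-\left(\left(\frac{n}{q^*}+\alpha^*\right)\xi+\eta(\alpha^*-m\lambda_i)-\alpha^*\frac{\delta_1-1}{\delta_1}\right)}\chi_{\{y\in\mathbb{R}^n:\|A_i(y)\|\ge1\}},\end{aligned}$$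 or (b) $\frac{\alpha^*}{n}+\frac1{q^*}>0$ and $$\mathcal{C}_{5.2}=\prod_{i=1}^m\Big(\int_{\mathbb{R}^n}\frac{|\Phi(y)|}{|y|^n}|\det A_i^{-1}(y)|^{\frac{m\xi}{q_i}}\|A_i(y)\|^{\frac{m\xi n}{q_i}}\mathcal{B}_{2i}(y)\,dy\Big)^{\frac1m}<\infty,$$ where $$\begin{aligned}\mathcal{B}_{2i}(y)=&\ \|A_i(y)\|^{-\left(\frac{\xi n}{q^*}+(\alpha^*-m\lambda_i)\frac{\delta_2-1}{\delta_2}\right)}\chi_{\{y\in\mathbb{R}^n:\|A_i(y)\|<1\}}\\&+\|A_i(y)\|^{-\left(\frac{n}{q^*}\frac{\delta_1-1}{\delta_1}+\eta(\alpha^*-m\lambda_i)\right)}\chi_{\{y\in\mathbb{R}^n:\|A_i(y)\|\ge1\}}.\end{aligned}$$ Then $\mathcal{H}_{\Phi,\vec{A}}$ is bounded from $\prod_{i=1}^m M\dot{K}^{\alpha_i,\lambda_i,p_i,q_i}_{v,\omega}(\mathbb{R}^n)$ to $M\dot{K}^{\alpha^*,\lambda^*,p,q^*}_{v,\omega}(\mathbb{R}^n)$.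
   Context: $n,m\ge 1$ are integers. $\Phi$ is a locally integrable function on $\mathbb{R}^n$; $A_1,\dots,A_m$ are measurable functions on $\mathbb{R}^n$ with values in the $n\times n$ real matrices, with $\det A_i(y)\ne0$ for almost every $y$ in the support of $\Phi$ (integrands are read as $0$ where $\Phi(y)=0$). For a matrix $A=(a_{ij})$, $\|A\|=\big(\sum_{i,j=1}^n|a_{ij}|^2\big)^{1/2}$; $A_i^{-1}(y)$ is the inverse of $A_i(y)$; $\chi_E$ is the characteristic function of $E$. The multilinear Hausdorff operator is, for $\vec f=(f_1,\dots,f_m)$ with $f_i$ complex-valued measurable functions on $\mathbb{R}^n$, $$\mathcal{H}_{\Phi,\vec{A}}(\vec{f})(x)=\int_{\mathbb{R}^n}\frac{\Phi(y)}{|y|^n}\prod_{i=1}^m f_i(A_i(y)x)\,dy,\qquad x\in\mathbb{R}^n.$$ A weight is a nonnegative locally integrable function on $\mathbb{R}^n$; $v(E)=\int_Ev(x)\,dx$. Muckenhoupt classes: for $1<\xi<\infty$, $\omega\in A_\xi(\mathbb{R}^n)$ if there is $C>0$ with $\big(\frac1{|B|}\int_B\omega\,dx\big)\big(\frac1{|B|}\int_B\omega^{-\frac1{\xi-1}}dx\big)^{\xi-1}\le C$ for all balls $B$; $\omega\in A_1(\mathbb{R}^n)$ if there is $C>0$ with $\frac1{|B|}\int_B\omega\,dx\le C\operatorname{ess\,inf}_{x\in B}\omega(x)$ for all balls $B$. Reverse Hölder: for $r>1$, $\omega\in RH_r$ if there is $C$ with $\big(\frac1{|B|}\int_B\omega^r\,dx\big)^{1/r}\le\frac{C}{|B|}\int_B\omega\,dx$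 for all balls $B$; the critical index is $r_\omega=\sup\{r>1:\omega\in RH_r\}$. $r'_\omega$ is the conjugate exponent: $\frac1{r_\omega}+\frac1{r'_\omega}=1$. For $k\in\mathbb{Z}$ let $B_k=\{x\in\mathbb{R}^n:|x|\le 2^k\}$, $C_k=B_k\setminus B_{k-1}$, $\chi_k=\chi_{C_k}$, and $\|f\|_{L^q_\omega(\mathbb{R}^n)}=\big(\int_{\mathbb{R}^n}|f|^q\omega\,dx\big)^{1/q}$. Two weighted Morrey-Herz space: for weights $v,\omega$, $\alpha\in\mathbb{R}$, $0<p<\infty$, $1\le q<\infty$, $\lambda\ge0$, $M\dot{K}^{\alpha,\lambda,p,q}_{v,\omega}(\mathbb{R}^n)$ is the set of measurable $f$ with $\int_K|f|^q\omega\,dx<\infty$ for all compact $K\subset\mathbb{R}^n\setminus\{0\}$ and $$\|f\|_{M\dot{K}^{\alpha,\lambda,p,q}_{v,\omega}(\mathbb{R}^n)}=\sup_{k_0\in\mathbb{Z}}\Big(v(B_{k_0})^{-\frac{\lambda}{n}}\Big(\sum_{k=-\infty}^{k_0}v(B_k)^{\frac{\alpha p}{n}}\|f\chi_k\|^p_{L^q_\omega(\mathbb{R}^n)}\Big)^{1/p}\Big)<\infty .$$ Boundedness of an $m$-linear operator $T$ from $\prod X_i$ to $Y$ means that there is a constant $C$ with $\|T(\vec f)\|_Y\le C\prod_i\|f_i\|_{X_i}$ for all $f_i\in X_i$, $T(\vec f)$ being well defined almost everywhere. $a\lesssim b$ means $a\le Cb$ for a constant $C>0$. *)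

theory Defs
  imports "HOL-Analysis.Analysis"
begin

text \<open>
  Measurability and integrals refer to Lebesgue measure on \<open>real ^ 'n\<close>, with \<open>n = CARD('n)\<close>.
  The norms, averages and weighted measures are formed in \<open>ennreal\<close>, so that they are always
  defined and their finiteness is a statement about them.
\<close>

text \<open>
  Real powers on \<open>[0, \<infinity>]\<close> with \<open>0\<^sup>a = \<infinity>\<close> and \<open>\<infinity>\<^sup>a = 0\<close> for \<open>a < 0\<close>.  On the reals,
  \<open>0 powr a = 0\<close> for every \<open>a\<close>, which would be wrong for \<open>\<omega>\<close> raised to the power
  \<open>-1/(\<xi>-1)\<close> at the zeros of \<open>\<omega>\<close>.
\<close>

definition ennpowr :: "ennreal \<Rightarrow> real \<Rightarrow> ennreal" where
  "ennpowr x a =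
     (if a = 0 then 1
      else if x = 0 then (if a > 0 then 0 else \<infinity>)
      else if x = \<infinity> then (if a > 0 then \<infinity> else 0)
      else ennreal (enn2real x powr a))"

text \<open>The library norm of a matrix is the Frobenius (Hilbert--Schmidt) norm.\<close>

lemma norm_matrix_eq:
  fixes M :: "real ^ 'n ^ 'k"
  shows "norm M = sqrt (\<Sum>i\<in>UNIV. \<Sum>j\<in>UNIV. \<bar>M $ i $ j\<bar>\<^sup>2)"
  by (simp add: norm_vec_def L2_set_def sum_nonneg)

definition locally_integrable :: "(real ^ 'n \<Rightarrow> 'b :: {banach, second_countable_topology}) \<Rightarrow> bool" where
  "locally_integrable f \<longleftrightarrow> (\<forall>K. compact K \<longrightarrow> set_integrable lebesgue K f)"

definition weight :: "(real ^ 'n \<Rightarrow> real) \<Rightarrow> bool" where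
  "weight w \<longleftrightarrow> (\<forall>x. 0 \<le> w x) \<and> locally_integrable w"

definition wmeasure :: "(real ^ 'n \<Rightarrow> real) \<Rightarrow> (real ^ 'n) set \<Rightarrow> ennreal" where
  "wmeasure w E = (\<integral>\<^sup>+x\<in>E. ennreal (w x) \<partial>lebesgue)"


subsection \<open>Muckenhoupt and reverse Hoelder classes\<close>

definition average :: "(real ^ 'n) set \<Rightarrow> (real ^ 'n \<Rightarrow> ennreal) \<Rightarrow> ennreal" where
  "average B g = (\<integral>\<^sup>+x\<in>B. g x \<partial>lebesgue) / emeasure lebesgue B"

definition essinf_on :: "(real ^ 'n) set \<Rightarrow> (real ^ 'n \<Rightarrow> ennreal) \<Rightarrow> ennreal" where
  "essinf_on B g = Sup {c. AE x in lebesgue. x \<in> B \<longrightarrow> c \<le> g x}"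

text \<open>
  For \<open>1 < \<xi>\<close> the product can take the form \<open>0 * \<infinity> = 0\<close> only on balls where \<open>w = 0\<close> almost
  everywhere.  So the zero weight is the only one that the convention of \<open>ennreal\<close> adds to the
  class: any other weight vanishing on a set of positive measure fails the bound on large balls.  The
  zero weight has infinite critical index.
\<close>

definition muckenhoupt :: "real \<Rightarrow> (real ^ 'n \<Rightarrow> real) set" where
  "muckenhoupt \<xi> = {w. weight w \<and>
     (1 < \<xi> \<and> (\<exists>C::real. \<forall>z r. 0 < r \<longrightarrow>
         average (ball z r) (\<lambda>x. ennreal (w x)) *
         ennpowr (average (ball z r) (\<lambda>x. ennpowr (ennreal (w x)) (- 1 / (\<xi> - 1)))) (\<xi> - 1)
           \<le> ennreal C)
    \<or> \<xi> = 1 \<and> (\<exists>C::real. \<forall>z r. 0 < r \<longrightarrow>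
         average (ball z r) (\<lambda>x. ennreal (w x))
           \<le> ennreal C * essinf_on (ball z r) (\<lambda>x. ennreal (w x))))}"

definition reverse_hoelder :: "real \<Rightarrow> (real ^ 'n \<Rightarrow> real) set" where
  "reverse_hoelder r = {w. weight w \<and> (\<exists>C::real. \<forall>z \<rho>. 0 < \<rho> \<longrightarrow>
     ennpowr (average (ball z \<rho>) (\<lambda>x. ennreal (w x powr r))) (1 / r)
       \<le> ennreal C * average (ball z \<rho>) (\<lambda>x. ennreal (w x)))}"

definition critical_index :: "(real ^ 'n \<Rightarrow> real) \<Rightarrow> ereal" where
  "critical_index w = Sup {ereal r | r. 1 < r \<and> w \<in> reverse_hoelder r}"


subsection \<open>Two weighted Morrey--Herz spaces\<close>

definition dyadic_ball :: "int \<Rightarrow> (real ^ 'n) set" where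
  "dyadic_ball k = {x. norm x \<le> 2 powi k}"

definition dyadic_annulus :: "int \<Rightarrow> (real ^ 'n) set" where
  "dyadic_annulus k = dyadic_ball k - dyadic_ball (k - 1)"

definition wLq_norm :: "(real ^ 'n \<Rightarrow> real) \<Rightarrow> real \<Rightarrow> (real ^ 'n \<Rightarrow> complex) \<Rightarrow> ennreal" where
  "wLq_norm w q f = ennpowr (\<integral>\<^sup>+x. ennreal (norm (f x) powr q * w x) \<partial>lebesgue) (1 / q)"

definition morrey_herz_norm ::
  "(real ^ 'n \<Rightarrow> real) \<Rightarrow> (real ^ 'n \<Rightarrow> real) \<Rightarrow> real \<Rightarrow> real \<Rightarrow> real \<Rightarrow> real
    \<Rightarrow> (real ^ 'n \<Rightarrow> complex) \<Rightarrow> ennreal" where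
  "morrey_herz_norm v w \<alpha> lam p q f =
     (SUP k0::int.
        ennpowr (wmeasure v (dyadic_ball k0)) (- lam / real CARD('n)) *
        ennpowr
          (\<Sum>\<^sub>\<infinity>k\<in>{..k0}.
             ennpowr (wmeasure v (dyadic_ball k)) (\<alpha> * p / real CARD('n)) *
             ennpowr (wLq_norm w q (\<lambda>x. f x * indicator (dyadic_annulus k) x)) p)
          (1 / p))"

definition morrey_herz ::
  "(real ^ 'n \<Rightarrow> real) \<Rightarrow> (real ^ 'n \<Rightarrow> real) \<Rightarrow> real \<Rightarrow> real \<Rightarrow> real \<Rightarrow> real
    \<Rightarrow> (real ^ 'n \<Rightarrow> complex) set" where
  "morrey_herz v w \<alpha> lam p q =
     {f. f \<in> borel_measurable lebesgue \<and>
         (\<forall>K. compact K \<and> 0 \<notin> K \<longrightarrow>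
            (\<integral>\<^sup>+x\<in>K. ennreal (norm (f x) powr q * w x) \<partial>lebesgue) < \<infinity>) \<and>
         morrey_herz_norm v w \<alpha> lam p q f < \<infinity>}"


subsection \<open>The multilinear Hausdorff operator\<close>

definition hausdorff_integrand ::
  "nat \<Rightarrow> (real ^ 'n \<Rightarrow> complex) \<Rightarrow> (nat \<Rightarrow> real ^ 'n \<Rightarrow> real ^ 'n ^ 'n)
    \<Rightarrow> (nat \<Rightarrow> real ^ 'n \<Rightarrow> complex) \<Rightarrow> real ^ 'n \<Rightarrow> real ^ 'n \<Rightarrow> complex" where
  "hausdorff_integrand m \<Phi> A f x y =
     \<Phi> y / of_real (norm y ^ CARD('n)) * (\<Prod>i=1..m. f i (A i y *v x))"

definition hausdorff_op ::
  "nat \<Rightarrow> (real ^ 'n \<Rightarrow> complex) \<Rightarrow> (nat \<Rightarrow> real ^ 'n \<Rightarrow> real ^ 'n ^ 'n)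
    \<Rightarrow> (nat \<Rightarrow> real ^ 'n \<Rightarrow> complex) \<Rightarrow> real ^ 'n \<Rightarrow> complex" where
  "hausdorff_op m \<Phi> A f x = (\<integral>y. hausdorff_integrand m \<Phi> A f x y \<partial>lebesgue)"

text \<open>
  The factors \<open>\<B>\<^sub>1\<^sub>i\<close> and \<open>\<B>\<^sub>2\<^sub>i\<close> for one matrix-valued function \<open>A = A\<^sub>i\<close> and one
  \<open>lam = \<lambda>\<^sub>i\<close>; \<open>qs\<close> and \<open>\<alpha>s\<close> stand for \<open>q\<^sup>*\<close> and \<open>\<alpha>\<^sup>*\<close>.
\<close>

definition B1_factor ::
  "nat \<Rightarrow> real \<Rightarrow> real \<Rightarrow> real \<Rightarrow> real \<Rightarrow> real \<Rightarrow> real \<Rightarrow> real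
    \<Rightarrow> (real ^ 'n \<Rightarrow> real ^ 'n ^ 'n) \<Rightarrow> real ^ 'n \<Rightarrow> real" where
  "B1_factor m qs \<alpha>s \<xi> \<eta> \<delta>1 \<delta>2 lam A y =
     norm (A y) powr
       (- ((real CARD('n) / qs + \<alpha>s) * ((\<delta>1 - 1) / \<delta>1)
           + (\<alpha>s - real m * lam) * ((\<delta>2 - 1) / \<delta>2) - \<xi> * \<alpha>s))
       * indicator {y. norm (A y) < 1} y
   + norm (A y) powr
       (- ((real CARD('n) / qs + \<alpha>s) * \<xi>
           + \<eta> * (\<alpha>s - real m * lam) - \<alpha>s * ((\<delta>1 - 1) / \<delta>1)))
       * indicator {y. norm (A y) \<ge> 1} y"

definition B2_factor ::
  "nat \<Rightarrow> real \<Rightarrow> real \<Rightarrow> real \<Rightarrow> real \<Rightarrow> real \<Rightarrow> real \<Rightarrow> real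
    \<Rightarrow> (real ^ 'n \<Rightarrow> real ^ 'n ^ 'n) \<Rightarrow> real ^ 'n \<Rightarrow> real" where
  "B2_factor m qs \<alpha>s \<xi> \<eta> \<delta>1 \<delta>2 lam A y =
     norm (A y) powr
       (- (\<xi> * real CARD('n) / qs + (\<alpha>s - real m * lam) * ((\<delta>2 - 1) / \<delta>2)))
       * indicator {y. norm (A y) < 1} y
   + norm (A y) powr
       (- (real CARD('n) / qs * ((\<delta>1 - 1) / \<delta>1) + \<eta> * (\<alpha>s - real m * lam)))
       * indicator {y. norm (A y) \<ge> 1} y"

text \<open>
  The common shape of the constants \<open>\<C>\<^sub>5\<^sub>.\<^sub>1\<close> and \<open>\<C>\<^sub>5\<^sub>.\<^sub>2\<close>.  When \<open>det (A i y) \<noteq> 0\<close> for almost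
  every \<open>y\<close> with \<open>\<Phi> y \<noteq> 0\<close> and the factors \<open>B i\<close> are positive there, one of the integrals
  vanishes only if \<open>\<Phi> = 0\<close> almost everywhere, hence only if all of them vanish; the convention
  \<open>0 * \<infinity> = 0\<close> of \<open>ennreal\<close> therefore plays no role in the product.
\<close>

definition hausdorff_const ::
  "nat \<Rightarrow> (real ^ 'n \<Rightarrow> complex) \<Rightarrow> (nat \<Rightarrow> real ^ 'n \<Rightarrow> real ^ 'n ^ 'n) \<Rightarrow> real
    \<Rightarrow> (nat \<Rightarrow> real) \<Rightarrow> (nat \<Rightarrow> real ^ 'n \<Rightarrow> real) \<Rightarrow> ennreal" where
  "hausdorff_const m \<Phi> A \<xi> q B =
     (\<Prod>i=1..m. ennpowr
        (\<integral>\<^sup>+y. ennreal (norm (\<Phi> y) / norm y ^ CARD('n)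
            * \<bar>det (matrix_inv (A i y))\<bar> powr (real m * \<xi> / q i)
            * norm (A i y) powr (real m * \<xi> * real CARD('n) / q i)
            * B i y) \<partial>lebesgue)
        (1 / real m))"

end

theory Submission
  imports Defs
begin

text \<open>
  For fixed \<open>y\<close>, the reverse Hoelder inequality for \<open>\<omega>\<close> removes the weight from
  \<open>\<integral>\<^bsub>B\<^sub>k\<^esub> \<Prod>\<^sub>i \<bar>f\<^sub>i(A\<^sub>i(y)x)\<bar>\<^bsup>q*\<^esup> \<omega>(x) dx\<close> (this is where \<open>q > q* \<xi> r'\<^sub>\<omega>\<close> is used), Hoelder's inequality
  separates the factors, the substitution \<open>z = A\<^sub>i(y)x\<close> maps \<open>B\<^sub>k\<close> into \<open>B\<^bsub>k+l\<^esub>\<close> with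
  \<open>2\<^bsup>l-1\<^esup> < \<parallel>A\<^sub>i(y)\<parallel> \<le> 2\<^sup>l\<close>, and the \<open>A\<^sub>\<xi>\<close> condition puts the weight back.  The resulting powers of
  \<open>\<omega>(B\<^sub>k)\<close>, \<open>v(B\<^sub>k)\<close> and \<open>\<omega>(B\<^bsub>k+l\<^esub>)\<close> turn into \<open>v(B\<^bsub>k+l\<^esub>)\<close> to the power \<open>\<alpha>\<^sub>i/n\<close>, times a power of
  \<open>\<parallel>A\<^sub>i(y)\<parallel>\<close>, by the growth of the masses of dyadic balls and by \<open>\<omega>(B) \<lesssim> v(B)\<close>, which enters with
  the exponent \<open>1/(m q*) - 1/q\<^sub>i\<close>; this exponent is nonnegative because \<open>q > m q*\<close>.  Since \<open>\<alpha>\<^sub>i < 0\<close>, a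
  discrete Hardy inequality replaces balls by annuli.  Two applications of Minkowski's integral
  inequality and Hoelder's inequality in \<open>y\<close> finish the estimate.  It yields the factors of case (b)
  whatever the sign of \<open>\<alpha>*/n + 1/q*\<close>, and in case (a) these are dominated by the factors given there.
\<close>

subsection \<open>Powers and integral inequalities on \<open>[0, \<infinity>]\<close>\<close>

text \<open>The number behind the first step is \<tau> = qs \<xi> / q: the bound q > qs \<xi>
  r'_\<omega> says exactly \<tau> < 1 - 1/r_\<omega>, which leaves room for a reverse Hoelder order
  r with \<tau> <= 1 - 1/r. Removing the weight turns the power qs of the product into qs/\<tau> =
  q/\<xi>, Hoelder with weights q/q_i leaves \<open>f i\<close> to the power q_i/\<xi>, and A_\<xi>
  restores q_i. The volumes of B_k cancel because \<tau>/qs is the sum of the \<xi>/q_i. The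
  obstacle is geometric: a bound on \<open>norm (A i y)\<close> alone confines the image of an
  annulus to a ball and not to finitely many annuli, so the estimates have to be made on balls. They
  are made in \<open>ennreal\<close> for the integral of the absolute value of the integrand.
  Convergence of the operator is then a consequence of the bound, because \<omega> > 0 almost
  everywhere; this positivity rests on the finite critical index. Measurability on the product space
  asks for Borel functions, so the \<open>f i\<close> are replaced by Borel representatives;
  invertible matrices pull null sets back to null sets, hence the operator does not notice.\<close>

lemma ennreal_pos_cases:
  fixes x :: ennreal
  obtains (zero) "x = 0" | (top) "x = top" | (pos) r where "0 < r" "x = ennreal r"
  by (cases x) (metis ennreal_0 less_eq_real_def)+

lemma ennpowr_0_right [simp]: "ennpowr x 0 = 1"
  by (simp add: ennpowr_def)

lemma ennpowr_0_left [simp]: "0 < a \<Longrightarrow> ennpowr 0 a = 0"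
  by (simp add: ennpowr_def)

lemma ennpowr_0_left_neg: "a < 0 \<Longrightarrow> ennpowr 0 a = top"
  by (simp add: ennpowr_def)

lemma ennpowr_top_left [simp]: "0 < a \<Longrightarrow> ennpowr top a = top"
  by (simp add: ennpowr_def)

lemma ennpowr_ennreal: "0 < x \<Longrightarrow> ennpowr (ennreal x) a = ennreal (x powr a)"
  by (simp add: ennpowr_def ennreal_eq_0_iff)

lemma ennpowr_ennreal_nonneg: "0 \<le> x \<Longrightarrow> 0 < a \<Longrightarrow> ennpowr (ennreal x) a = ennreal (x powr a)"
  by (cases "x = 0") (simp_all add: ennpowr_ennreal)

lemma ennpowr_1_right [simp]: "ennpowr x 1 = x"
  by (cases x rule: ennreal_pos_cases) (auto simp: ennpowr_ennreal)

lemma ennpowr_1_left [simp]: "ennpowr 1 a = 1"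
  using ennpowr_ennreal[of 1 a] by simp

text \<open>Negative exponents swap 0 and \<open>top\<close>, so the conventions at these two points
  compose for exponents of either sign.\<close>

lemma ennpowr_ennpowr: "ennpowr (ennpowr x a) b = ennpowr x (a * b)"
  by (cases x rule: ennreal_pos_cases)
     (auto simp: ennpowr_def ennreal_eq_0_iff powr_powr mult_less_0_iff zero_less_mult_iff)

text \<open>Negative \<open>a\<close> is excluded by \<open>x = 0\<close>, \<open>y = top\<close>:
  there the left side would be \<open>top\<close> and the right side
  \<open>top * 0 = 0\<close>.\<close>

lemma ennpowr_mult: "0 \<le> a \<Longrightarrow> ennpowr (x * y) a = ennpowr x a * ennpowr y a"
  by (cases x rule: ennreal_pos_cases; cases y rule: ennreal_pos_cases; cases "a = 0")
     (auto simp: ennpowr_ennreal powr_mult ennreal_mult_top ennreal_top_mult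
        simp flip: ennreal_mult)

lemma ennpowr_add: "0 \<le> a \<Longrightarrow> 0 \<le> b \<Longrightarrow> ennpowr x (a + b) = ennpowr x a * ennpowr x b"
  by (cases x rule: ennreal_pos_cases; cases "a = 0"; cases "b = 0")
     (auto simp: ennpowr_ennreal powr_add ennreal_top_mult simp flip: ennreal_mult)

lemma ennpowr_mono: "0 \<le> a \<Longrightarrow> x \<le> y \<Longrightarrow> ennpowr x a \<le> ennpowr y a"
  by (cases x rule: ennreal_pos_cases; cases y rule: ennreal_pos_cases; cases "a = 0")
     (auto simp: ennpowr_ennreal intro!: ennreal_leI powr_mono2 simp: top_unique)

lemma ennpowr_eq_0_iff: "0 < a \<Longrightarrow> ennpowr x a = 0 \<longleftrightarrow> x = 0"
  by (cases x rule: ennreal_pos_cases) (auto simp: ennpowr_ennreal)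

lemma ennpowr_eq_top_iff: "0 < a \<Longrightarrow> ennpowr x a = top \<longleftrightarrow> x = top"
  by (cases x rule: ennreal_pos_cases) (auto simp: ennpowr_ennreal)

lemma ennpowr_prod:
  "0 \<le> a \<Longrightarrow> ennpowr (\<Prod>i\<in>I. x i) a = (\<Prod>i\<in>I. ennpowr (x i) a)"
  by (induction I rule: infinite_finite_induct) (simp_all add: ennpowr_mult)

lemma borel_measurable_ennpowr [measurable (raw)]:
  assumes [measurable]: "f \<in> borel_measurable M"
  shows "(\<lambda>x. ennpowr (f x) a) \<in> borel_measurable M"
  unfolding ennpowr_def by measurable

lemma prod_ennreal_eq_top:
  fixes x :: "'a \<Rightarrow> ennreal"
  assumes "finite I" "i \<in> I" "x i = top" "\<And>j. j \<in> I \<Longrightarrow> x j \<noteq> 0"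
  shows "(\<Prod>j\<in>I. x j) = top"
proof -
  have "(\<Prod>j\<in>I - {i}. x j) \<noteq> 0"
    using assms by simp
  then show ?thesis
    using assms by (simp add: prod.remove[of I i] ennreal_top_mult)
qed

section \<open>Inequalities of Hoelder, Jensen and Minkowski in \<open>ennreal\<close>\<close>

lemma weighted_am_gm_ennreal:
  fixes x :: "'a \<Rightarrow> ennreal"
  assumes I: "finite I" and \<theta>: "\<And>i. i \<in> I \<Longrightarrow> 0 < \<theta> i" "sum \<theta> I = 1"
  shows "(\<Prod>i\<in>I. ennpowr (x i) (\<theta> i)) \<le> (\<Sum>i\<in>I. ennreal (\<theta> i) * x i)"
proof (cases "\<exists>i\<in>I. x i = 0 \<or> x i = top")
  case True
  \<comment> \<open>A zero factor annihilates the left side even next to \<open>top\<close>, and an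
    infinite summand makes the right side \<open>top\<close>.\<close>
  then consider (zero) i where "i \<in> I" "x i = 0" | (top) i where "i \<in> I" "x i = top"
    by blast
  then show ?thesis
  proof cases
    case zero
    then have "(\<Prod>i\<in>I. ennpowr (x i) (\<theta> i)) = 0"
      using \<theta> I by (auto intro!: prod_zero bexI[of _ i])
    then show ?thesis by (simp only: zero_le)
  next
    case top
    then have "ennreal (\<theta> i) * x i = top"
      using \<theta>(1)[of i] by (simp add: ennreal_mult_top)
    then have "top \<le> (\<Sum>i\<in>I. ennreal (\<theta> i) * x i)"
      using top I member_le_sum[of i I "\<lambda>i. ennreal (\<theta> i) * x i"] by simp
    then show ?thesis by (simp add: top_unique)
  qed
next
  case False
  then have "\<forall>i\<in>I. \<exists>r>0. x i = ennreal r"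
    by (metis ennreal_pos_cases)
  then obtain r where r: "\<And>i. i \<in> I \<Longrightarrow> 0 < r i" "\<And>i. i \<in> I \<Longrightarrow> x i = ennreal (r i)"
    by metis
  have ne: "I \<noteq> {}" using \<theta>(2) by auto
  have "(\<Prod>i\<in>I. r i powr \<theta> i) = exp (\<Sum>i\<in>I. \<theta> i *\<^sub>R ln (r i))"
    using r(1) I by (simp add: exp_sum powr_def) (intro prod.cong, auto simp: less_imp_neq[THEN not_sym])
  also have "\<dots> \<le> (\<Sum>i\<in>I. \<theta> i * exp (ln (r i)))"
    using \<theta> I ne by (intro convex_on_sum[OF _ _ exp_convex]) (auto intro: less_imp_le)
  also have "\<dots> = (\<Sum>i\<in>I. \<theta> i * r i)"
    using r(1) by (intro sum.cong) auto
  finally have "ennreal (\<Prod>i\<in>I. r i powr \<theta> i) \<le> ennreal (\<Sum>i\<in>I. \<theta> i * r i)"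
    by (rule ennreal_leI)
  moreover have "(\<Prod>i\<in>I. ennpowr (x i) (\<theta> i)) = ennreal (\<Prod>i\<in>I. r i powr \<theta> i)"
    using r by (subst prod_ennreal[symmetric]) (auto intro!: prod.cong simp: ennpowr_ennreal)
  moreover have "(\<Sum>i\<in>I. ennreal (\<theta> i) * x i) = ennreal (\<Sum>i\<in>I. \<theta> i * r i)"
    using r \<theta>(1) by (subst sum_ennreal[symmetric])
      (auto intro!: sum.cong mult_nonneg_nonneg simp: ennreal_mult less_imp_le)
  ultimately show ?thesis by simp
qed

text \<open>Dividing every \<open>g i\<close> by its integral reduces Hoelder's inequality to the
  pointwise weighted AM-GM inequality, whose right side integrates to
  \<open>sum \<theta> I = 1\<close>.\<close>

lemma nn_integral_prod_ennpowr_le_pos: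
  assumes I: "finite I" and \<theta>: "\<And>i. i \<in> I \<Longrightarrow> 0 < \<theta> i" "sum \<theta> I = 1"
    and g [measurable]: "\<And>i. i \<in> I \<Longrightarrow> g i \<in> borel_measurable M"
  shows "(\<integral>\<^sup>+x. (\<Prod>i\<in>I. ennpowr (g i x) (\<theta> i)) \<partial>M) \<le> (\<Prod>i\<in>I. ennpowr (\<integral>\<^sup>+x. g i x \<partial>M) (\<theta> i))"
proof -
  define S where "S i = (\<integral>\<^sup>+x. g i x \<partial>M)" for i
  \<comment> \<open>Vanishing integrals are split off first: as \<open>0 * top = 0\<close>, an
    infinite integral makes the right side \<open>top\<close> only when no other one is
    zero.\<close>
  consider (zero) i where "i \<in> I" "S i = 0"
    | (top) i where "i \<in> I" "S i = top" "\<forall>j\<in>I. S j \<noteq> 0"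
    | (pos) "\<forall>i\<in>I. S i \<noteq> 0 \<and> S i \<noteq> top"
    by blast
  then show ?thesis
  proof cases
    case zero
    then have "AE x in M. g i x = 0"
      by (simp add: S_def nn_integral_0_iff_AE)
    then have "AE x in M. (\<Prod>i\<in>I. ennpowr (g i x) (\<theta> i)) = 0"
      by eventually_elim (use zero \<theta> I in \<open>auto intro!: prod_zero bexI[of _ i]\<close>)
    then have "(\<integral>\<^sup>+x. (\<Prod>i\<in>I. ennpowr (g i x) (\<theta> i)) \<partial>M) = (\<integral>\<^sup>+x. 0 \<partial>M)"
      by (rule nn_integral_cong_AE)
    then show ?thesis by simp
  next
    case top
    have "(\<Prod>i\<in>I. ennpowr (S i) (\<theta> i)) = top"
      using top I \<theta> by (intro prod_ennreal_eq_top[of _ i]) (auto simp: ennpowr_eq_0_iff)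
    then show ?thesis by (simp add: S_def)
  next
    case pos
    have "(\<Prod>i\<in>I. ennpowr (g i x) (\<theta> i))
        \<le> (\<Prod>i\<in>I. ennpowr (S i) (\<theta> i)) * (\<Sum>i\<in>I. ennreal (\<theta> i) * (g i x / S i))" for x
    proof -
      have "(\<Prod>i\<in>I. ennpowr (g i x) (\<theta> i))
          = (\<Prod>i\<in>I. ennpowr (S i) (\<theta> i) * ennpowr (g i x / S i) (\<theta> i))"
      proof (intro prod.cong refl)
        fix i assume i: "i \<in> I"
        have "g i x = S i * (g i x / S i)"
          using pos i by (metis ennreal_times_divide mult_divide_eq_ennreal mult.commute)
        then show "ennpowr (g i x) (\<theta> i) = ennpowr (S i) (\<theta> i) * ennpowr (g i x / S i) (\<theta> i)"
          using \<theta>(1)[OF i] by (metis ennpowr_mult less_imp_le)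
      qed
      also have "\<dots> = (\<Prod>i\<in>I. ennpowr (S i) (\<theta> i)) * (\<Prod>i\<in>I. ennpowr (g i x / S i) (\<theta> i))"
        by (rule prod.distrib)
      also have "\<dots> \<le> (\<Prod>i\<in>I. ennpowr (S i) (\<theta> i)) * (\<Sum>i\<in>I. ennreal (\<theta> i) * (g i x / S i))"
        using assms by (intro mult_left_mono weighted_am_gm_ennreal) auto
      finally show ?thesis .
    qed
    then have "(\<integral>\<^sup>+x. (\<Prod>i\<in>I. ennpowr (g i x) (\<theta> i)) \<partial>M)
        \<le> (\<integral>\<^sup>+x. (\<Prod>i\<in>I. ennpowr (S i) (\<theta> i)) * (\<Sum>i\<in>I. ennreal (\<theta> i) * (g i x / S i)) \<partial>M)"
      by (intro nn_integral_mono)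
    also have "\<dots> = (\<Prod>i\<in>I. ennpowr (S i) (\<theta> i)) * (\<Sum>i\<in>I. ennreal (\<theta> i) * (S i / S i))"
      by (simp add: nn_integral_cmult nn_integral_sum nn_integral_divide S_def)
    also have "(\<Sum>i\<in>I. ennreal (\<theta> i) * (S i / S i)) = (\<Sum>i\<in>I. ennreal (\<theta> i))"
      using pos by (intro sum.cong) (auto simp: ennreal_divide_self top.not_eq_extremum)
    also have "\<dots> = 1"
      using \<theta> by (subst sum_ennreal) (auto intro: less_imp_le)
    finally show ?thesis by (simp add: S_def)
  qed
qed

text \<open>Vanishing exponents do occur: \<open>1 - 1 / p\<close> at \<open>p = 1\<close>, and
  \<open>1 - \<tau> - 1 / r\<close> for reverse Hoelder weights at the endpoint. Their factors are 1
  on both sides, whatever the base.\<close>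

lemma nn_integral_prod_ennpowr_le:
  assumes I: "finite I" and \<theta>: "\<And>i. i \<in> I \<Longrightarrow> 0 \<le> \<theta> i" "sum \<theta> I = 1"
    and g: "\<And>i. i \<in> I \<Longrightarrow> g i \<in> borel_measurable M"
  shows "(\<integral>\<^sup>+x. (\<Prod>i\<in>I. ennpowr (g i x) (\<theta> i)) \<partial>M) \<le> (\<Prod>i\<in>I. ennpowr (\<integral>\<^sup>+x. g i x \<partial>M) (\<theta> i))"
proof -
  define J where "J = {i\<in>I. 0 < \<theta> i}"
  have J: "finite J" "J \<subseteq> I" "\<forall>i\<in>I - J. \<theta> i = 0"
    using I \<theta>(1) unfolding J_def by (auto simp: order.order_iff_strict)
  have *: "(\<Prod>i\<in>I. ennpowr (h i) (\<theta> i)) = (\<Prod>i\<in>J. ennpowr (h i) (\<theta> i))" for h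
    using J I by (intro prod.mono_neutral_right) auto
  have "sum \<theta> J = 1"
    using sum.mono_neutral_right[OF I J(2,3)] \<theta>(2) by metis
  moreover have "0 < \<theta> i" "g i \<in> borel_measurable M" if "i \<in> J" for i
    using that g by (simp_all add: J_def)
  ultimately have "(\<integral>\<^sup>+x. (\<Prod>i\<in>J. ennpowr (g i x) (\<theta> i)) \<partial>M)
      \<le> (\<Prod>i\<in>J. ennpowr (\<integral>\<^sup>+x. g i x \<partial>M) (\<theta> i))"
    using J(1) by (intro nn_integral_prod_ennpowr_le_pos)
  then show ?thesis
    by (simp only: *)
qed

text \<open>Hoelder for u c = (u^p c)^(1/p) c^(1 - 1/p). The measure with density \<open>c\<close>
  is not normalised, which accounts for the power \<open>p - 1\<close> of its mass.\<close>

lemma nn_integral_jensen_ennpowr: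
  assumes p: "1 \<le> p" and [measurable]: "u \<in> borel_measurable M" "c \<in> borel_measurable M"
  shows "ennpowr (\<integral>\<^sup>+x. u x * c x \<partial>M) p
    \<le> (\<integral>\<^sup>+x. ennpowr (u x) p * c x \<partial>M) * ennpowr (\<integral>\<^sup>+x. c x \<partial>M) (p - 1)"
proof -
  define g where "g b = (if b then (\<lambda>x. ennpowr (u x) p * c x) else c)" for b
  define \<theta> where "\<theta> b = (if b then 1 / p else 1 - 1 / p)" for b
  have eq: "(\<Prod>b\<in>UNIV. ennpowr (g b x) (\<theta> b)) = u x * c x" for x
  proof -
    have "(\<Prod>b\<in>UNIV. ennpowr (g b x) (\<theta> b))
        = ennpowr (ennpowr (u x) p * c x) (1 / p) * ennpowr (c x) (1 - 1 / p)"
      by (simp add: UNIV_bool g_def \<theta>_def mult.commute)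
    also have "\<dots> = u x * (ennpowr (c x) (1 / p) * ennpowr (c x) (1 - 1 / p))"
      using p by (simp add: ennpowr_mult ennpowr_ennpowr mult.assoc)
    also have "\<dots> = u x * c x"
      using p by (subst ennpowr_add[symmetric]) auto
    finally show ?thesis .
  qed
  have "(\<integral>\<^sup>+x. u x * c x \<partial>M) \<le> (\<Prod>b\<in>UNIV. ennpowr (\<integral>\<^sup>+x. g b x \<partial>M) (\<theta> b))"
    unfolding eq[symmetric] using p
    by (intro nn_integral_prod_ennpowr_le) (auto simp: g_def \<theta>_def UNIV_bool)
  also have "\<dots> = ennpowr (\<integral>\<^sup>+x. ennpowr (u x) p * c x \<partial>M) (1 / p) * ennpowr (\<integral>\<^sup>+x. c x \<partial>M) (1 - 1 / p)"
    by (simp add: UNIV_bool g_def \<theta>_def mult.commute)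
  finally have "ennpowr (\<integral>\<^sup>+x. u x * c x \<partial>M) p \<le> ennpowr \<dots> p"
    using p by (intro ennpowr_mono) auto
  also have "\<dots> = (\<integral>\<^sup>+x. ennpowr (u x) p * c x \<partial>M) * ennpowr (\<integral>\<^sup>+x. c x \<partial>M) (p - 1)"
    using p by (simp add: ennpowr_mult ennpowr_ennpowr left_diff_distrib)
  finally show ?thesis .
qed

text \<open>
  Writing \<open>F = (F / c) c\<close> with \<open>c y\<close> the \<open>L\<^sup>p\<close> norm of \<open>F (\<cdot>, y)\<close> and applying Jensen's
  inequality with respect to \<open>c y dy\<close> avoids the usual truncation needed by the duality proof.
\<close>

lemma (in pair_sigma_finite) nn_integral_minkowski:
  assumes p: "1 \<le> p" and F [measurable]: "(\<lambda>(x, y). F x y) \<in> borel_measurable (M1 \<Otimes>\<^sub>M M2)"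
  shows "(\<integral>\<^sup>+x. ennpowr (\<integral>\<^sup>+y. F x y \<partial>M2) p \<partial>M1)
    \<le> ennpowr (\<integral>\<^sup>+y. ennpowr (\<integral>\<^sup>+x. ennpowr (F x y) p \<partial>M1) (1 / p) \<partial>M2) p"
proof -
  interpret Q: pair_sigma_finite M2 M1 ..
  define c where "c y = ennpowr (\<integral>\<^sup>+x. ennpowr (F x y) p \<partial>M1) (1 / p)" for y
  define K where "K = (\<integral>\<^sup>+y. c y \<partial>M2)"
  have F' [measurable]: "(\<lambda>(y, x). F x y) \<in> borel_measurable (M2 \<Otimes>\<^sub>M M1)"
    using F by (subst (asm) measurable_pair_swap_iff) (simp add: case_prod_unfold)
  have [measurable]: "c \<in> borel_measurable M2"
    unfolding c_def by measurable
  show ?thesis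
  proof (cases "K = top")
    case True
    then show ?thesis using p by (simp add: K_def c_def)
  next
    case False
    then have fin: "AE y in M2. c y \<noteq> top"
      using nn_integral_PInf_AE[of c M2] by (simp add: K_def)
    define u where "u x y = F x y / c y" for x y
    have [measurable]: "(\<lambda>(x, y). u x y) \<in> borel_measurable (M1 \<Otimes>\<^sub>M M2)"
      unfolding u_def by measurable
    have u': "(\<lambda>(y, x). u x y) \<in> borel_measurable (M2 \<Otimes>\<^sub>M M1)"
      unfolding u_def by measurable
    have [measurable]: "x \<in> space M1 \<Longrightarrow> F x \<in> borel_measurable M2" for x
      by measurable
    have [measurable]: "y \<in> space M2 \<Longrightarrow> (\<lambda>x. F x y) \<in> borel_measurable M1" for y
      by measurable
    have cp: "ennpowr (c y) p = (\<integral>\<^sup>+x. ennpowr (F x y) p \<partial>M1)" for y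
      using p by (simp add: c_def ennpowr_ennpowr)
    \<comment> \<open>Where \<open>c y = 0\<close>, the slice of \<open>F\<close> vanishes almost
      everywhere, so the quotient by zero does no harm; \<open>c y = top\<close> would destroy the
      identity and is excluded by the finiteness of \<open>K\<close>.\<close>
    have "AE y in M2. AE x in M1. F x y = u x y * c y"
      using fin AE_space
    proof eventually_elim
      case (elim y)
      note [measurable] = \<open>y \<in> space M2\<close>
      show ?case
      proof (cases "c y = 0")
        case True
        then have "(\<integral>\<^sup>+x. ennpowr (F x y) p \<partial>M1) = 0"
          using cp[of y] p by simp
        then have "AE x in M1. ennpowr (F x y) p = 0"
          by (subst (asm) nn_integral_0_iff_AE) measurable
        then show ?thesis
          by eventually_elim (use p True in \<open>simp add: ennpowr_eq_0_iff\<close>)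
      next
        case False
        with elim show ?thesis
          by (simp add: u_def ennreal_divide_times ennreal_divide_self less_top)
      qed
    qed
    then have ae: "AE x in M1. AE y in M2. F x y = u x y * c y"
      by (subst AE_commute) measurable
    \<comment> \<open>The slices of \<open>u\<close> have norm 1 where \<open>c y\<close> is
      positive; at \<open>c y = 0\<close> the factor \<open>c y\<close> makes both sides
      zero.\<close>
    have u1: "AE y in M2. (\<integral>\<^sup>+x. ennpowr (u x y) p \<partial>M1) * c y \<le> c y"
      using fin AE_space
    proof eventually_elim
      case (elim y)
      note [measurable] = \<open>y \<in> space M2\<close>
      show ?case
      proof (cases "c y = 0")
        case False
        obtain r where r: "0 < r" "c y = ennreal r"
          using elim False by (cases "c y" rule: ennreal_pos_cases) auto
        have "(\<integral>\<^sup>+x. ennpowr (u x y) p \<partial>M1)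
            = (\<integral>\<^sup>+x. ennpowr (F x y) p * ennpowr (inverse (c y)) p \<partial>M1)"
          using p by (simp add: u_def divide_ennreal_def ennpowr_mult)
        also have "\<dots> = ennpowr (c y) p * ennpowr (inverse (c y)) p"
          by (subst nn_integral_multc) (simp_all add: cp)
        also have "\<dots> = 1"
          using p r by (simp add: ennpowr_mult[symmetric] inverse_ennreal flip: ennreal_mult)
        finally show ?thesis by simp
      qed simp
    qed
    have "(\<integral>\<^sup>+x. ennpowr (\<integral>\<^sup>+y. F x y \<partial>M2) p \<partial>M1) = (\<integral>\<^sup>+x. ennpowr (\<integral>\<^sup>+y. u x y * c y \<partial>M2) p \<partial>M1)"
    proof (rule nn_integral_cong_AE)
      show "AE x in M1. ennpowr (\<integral>\<^sup>+y. F x y \<partial>M2) p = ennpowr (\<integral>\<^sup>+y. u x y * c y \<partial>M2) p"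
        using ae by eventually_elim (auto intro!: arg_cong[of _ _ "\<lambda>t. ennpowr t p"] nn_integral_cong_AE)
    qed
    also have "\<dots> \<le> (\<integral>\<^sup>+x. (\<integral>\<^sup>+y. ennpowr (u x y) p * c y \<partial>M2) * ennpowr K (p - 1) \<partial>M1)"
      unfolding K_def using p
      by (intro nn_integral_mono nn_integral_jensen_ennpowr) measurable
    also have "\<dots> = (\<integral>\<^sup>+x. (\<integral>\<^sup>+y. ennpowr (u x y) p * c y \<partial>M2) \<partial>M1) * ennpowr K (p - 1)"
      by (rule nn_integral_multc) measurable
    also have "(\<integral>\<^sup>+x. (\<integral>\<^sup>+y. ennpowr (u x y) p * c y \<partial>M2) \<partial>M1)
        = (\<integral>\<^sup>+y. (\<integral>\<^sup>+x. ennpowr (u x y) p * c y \<partial>M1) \<partial>M2)"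
      by (rule Fubini'[symmetric]) measurable
    also have "\<dots> = (\<integral>\<^sup>+y. (\<integral>\<^sup>+x. ennpowr (u x y) p \<partial>M1) * c y \<partial>M2)"
      by (intro nn_integral_cong nn_integral_multc) measurable
    also have "\<dots> \<le> K"
      unfolding K_def using u1 by (rule nn_integral_mono_AE)
    finally have "(\<integral>\<^sup>+x. ennpowr (\<integral>\<^sup>+y. F x y \<partial>M2) p \<partial>M1) \<le> K * ennpowr K (p - 1)"
      by (simp add: mult_right_mono)
    also have "\<dots> = ennpowr K p"
      using p ennpowr_add[of 1 "p - 1" K] by simp
    finally show ?thesis by (simp add: K_def c_def)
  qed
qed

subsection \<open>Linear changes of variables\<close>

text \<open>\<open>lborel_eqI\<close> compares measures on boxes, but the preimage of a box under a
  shear is a parallelepiped. So volume preservation on boxes is first extended to bounded measurable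
  sets by \<open>measure_linear_sufficient\<close>.\<close>

lemma nn_integral_lborel_shear:
  fixes m n :: "'n::finite" and h :: "real ^ 'n \<Rightarrow> ennreal"
  defines "f \<equiv> \<lambda>x::real ^ 'n. \<chi> i. if i = m then x $ m + x $ n else x $ i"
  assumes "m \<noteq> n" and h: "h \<in> borel_measurable borel"
  shows "(\<integral>\<^sup>+x. h (f x) \<partial>lborel) = (\<integral>\<^sup>+x. h x \<partial>lborel)"
proof -
  define g where "g = (\<lambda>x::real ^ 'n. \<chi> i. if i = m then x $ m - x $ n else x $ i)"
  have lin: "linear f" "linear g"
    unfolding f_def g_def
    by (rule linearI; simp add: plus_vec_def scaleR_vec_def vec_eq_iff algebra_simps)+
  have gf: "g (f x) = x" and fg: "f (g x) = x" for x
    using \<open>m \<noteq> n\<close> by (simp_all add: f_def g_def vec_eq_iff)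
  have [measurable]: "f \<in> borel_measurable borel"
    using lin(1) by (intro borel_measurable_continuous_onI linear_continuous_on) (simp add: linear_linear)
  have box: "measure lebesgue (f ` cbox a b) = 1 * measure lebesgue (cbox a b)" for a b
  proof (cases "cbox a b = {}")
    case False
    \<comment> \<open>Volumes are translation invariant, so the lower corner may be moved to 0,
      where \<open>measure_shear_interval\<close> applies.\<close>
    have eq: "cbox a b = (+) a ` cbox 0 (b - a)"
      using cbox_translation[of a 0 "b - a"] by simp
    then have ne: "cbox 0 (b - a) \<noteq> {}"
      using False by auto
    have "f ` cbox a b = (+) (f a) ` f ` cbox 0 (b - a)"
      unfolding eq image_image using lin(1) by (simp add: linear_add)
    then have "measure lebesgue (f ` cbox a b) = measure lebesgue (f ` cbox 0 (b - a))"
      by (simp only: measure_translation)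
    also have "\<dots> = measure lebesgue (cbox 0 (b - a))"
      unfolding f_def by (rule measure_shear_interval) (use \<open>m \<noteq> n\<close> ne in auto)
    also have "\<dots> = measure lebesgue (cbox a b)"
      by (simp only: eq measure_translation)
    finally show ?thesis by simp
  qed simp
  have "lborel = distr lborel borel f"
  proof (rule lborel_eqI)
    fix l u :: "real ^ 'n" assume le: "\<And>b. b \<in> Basis \<Longrightarrow> l \<bullet> b \<le> u \<bullet> b"
    define S where "S = f -` box l u"
    have S: "S = g ` box l u" "f ` S = box l u"
      using gf fg unfolding S_def by (auto simp: image_iff) metis+
    have "bounded S"
      unfolding S using lin(2) by (intro bounded_linear_image) (simp_all add: linear_linear)
    moreover have "S \<in> sets borel"
      using measurable_sets[of f borel borel "box l u"] by (simp add: S_def)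
    ultimately have lm: "S \<in> lmeasurable" "emeasure lborel S < \<infinity>"
      using emeasure_bounded_finite[of S] by (auto intro: bounded_set_imp_lmeasurable)
    then have "measure lebesgue S = measure lebesgue (box l u)"
      using measure_linear_sufficient[OF lin(1) lm(1) box] S(2) by simp
    then have "emeasure lborel S = emeasure lborel (box l u)"
      using \<open>S \<in> sets borel\<close> lm(2) emeasure_lborel_box_finite[of l u]
      by (simp add: emeasure_eq_ennreal_measure less_top)
    then show "emeasure (distr lborel borel f) (box l u) = (\<Prod>b\<in>Basis. (u - l) \<bullet> b)"
      using le by (simp add: emeasure_distr S_def)
  qed simp
  then have "(\<integral>\<^sup>+x. h x \<partial>lborel) = (\<integral>\<^sup>+x. h x \<partial>distr lborel borel f)"
    by simp
  also have "\<dots> = (\<integral>\<^sup>+x. h (f x) \<partial>lborel)"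
    using h by (intro nn_integral_distr) auto
  finally show ?thesis ..
qed

lemma nn_integral_lborel_transpose:
  fixes m n :: "'n::finite" and h :: "real ^ 'n \<Rightarrow> ennreal"
  defines "f \<equiv> \<lambda>x::real ^ 'n. \<chi> i. x $ Transposition.transpose m n i"
  assumes h: "h \<in> borel_measurable borel"
  shows "(\<integral>\<^sup>+x. h (f x) \<partial>lborel) = (\<integral>\<^sup>+x. h x \<partial>lborel)"
proof -
  have lin: "linear f"
    unfolding f_def by (rule linearI; simp add: plus_vec_def scaleR_vec_def vec_eq_iff)
  have [measurable]: "f \<in> borel_measurable borel"
    using lin by (intro borel_measurable_continuous_onI linear_continuous_on) (simp add: linear_linear)
  have Basis_prod: "(\<Prod>b\<in>Basis. g (x \<bullet> b)) = (\<Prod>i\<in>UNIV. g (x $ i))" for g :: "real \<Rightarrow> real" and x :: "real ^ 'n"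
  proof -
    have Basis: "Basis = range (\<lambda>i. axis i (1::real) :: real ^ 'n)"
      by (auto simp: Basis_vec_def)
    show ?thesis
      unfolding Basis by (simp add: prod.reindex inj_on_def axis_eq_axis inner_axis)
  qed
  have "lborel = distr lborel borel f"
  proof (rule lborel_eqI)
    fix l u :: "real ^ 'n" assume le: "\<And>b. b \<in> Basis \<Longrightarrow> l \<bullet> b \<le> u \<bullet> b"
    then have le': "l $ i \<le> u $ i" for i
      by (metis axis_in_Basis_iff inner_axis inner_real_def mult.right_neutral Basis_real_def singletonI)
    have "f -` box l u = box (f l) (f u)"
      unfolding f_def by (auto simp: mem_box_cart) (metis transpose_involutory)+
    moreover have "f l \<bullet> b \<le> f u \<bullet> b" if "b \<in> Basis" for b
      using that le' by (auto simp: f_def Basis_vec_def inner_axis)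
    ultimately have "emeasure (distr lborel borel f) (box l u) = ennreal (\<Prod>b\<in>Basis. (f u - f l) \<bullet> b)"
      by (simp add: emeasure_distr)
    also have "(\<Prod>b\<in>Basis. (f u - f l) \<bullet> b) = (\<Prod>i\<in>UNIV. (u - l) $ Transposition.transpose m n i)"
      using Basis_prod[of "\<lambda>x. x" "f u - f l"] by (simp add: f_def)
    also have "\<dots> = (\<Prod>i\<in>UNIV. (u - l) $ i)"
      using prod.permute[OF permutes_swap_id, of m UNIV n "\<lambda>i. (u - l) $ i"] by (simp add: o_def)
    also have "\<dots> = (\<Prod>b\<in>Basis. (u - l) \<bullet> b)"
      using Basis_prod[of "\<lambda>x. x" "u - l"] by simp
    finally show "emeasure (distr lborel borel f) (box l u) = (\<Prod>b\<in>Basis. (u - l) \<bullet> b)" .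
  qed simp
  then have "(\<integral>\<^sup>+x. h x \<partial>lborel) = (\<integral>\<^sup>+x. h x \<partial>distr lborel borel f)"
    by simp
  also have "\<dots> = (\<integral>\<^sup>+x. h (f x) \<partial>lborel)"
    using h by (intro nn_integral_distr) auto
  finally show ?thesis ..
qed

lemma nn_integral_lborel_diagonal:
  fixes c :: "'n::finite \<Rightarrow> real" and h :: "real ^ 'n \<Rightarrow> ennreal"
  defines "f \<equiv> \<lambda>x::real ^ 'n. \<chi> i. c i * x $ i"
  assumes c: "\<And>i. c i \<noteq> 0" and h: "h \<in> borel_measurable borel"
  shows "ennreal \<bar>prod c UNIV\<bar> * (\<integral>\<^sup>+x. h (f x) \<partial>lborel) = (\<integral>\<^sup>+x. h x \<partial>lborel)"
proof -
  have lin: "linear f"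
    unfolding f_def by (rule linearI; simp add: plus_vec_def scaleR_vec_def vec_eq_iff algebra_simps)
  have [measurable]: "f \<in> borel_measurable borel"
    using lin by (intro borel_measurable_continuous_onI linear_continuous_on) (simp add: linear_linear)
  \<comment> \<open>\<open>lborel_affine_euclidean\<close> expects scaling factors indexed by basis
    vectors, not by coordinates.\<close>
  define d where "d b = c (THE i. b = axis i 1)" for b :: "real ^ 'n"
  have d: "d (axis i 1) = c i" for i
    unfolding d_def by (simp add: axis_eq_axis)
  have Basis: "Basis = range (\<lambda>i. axis i (1::real) :: real ^ 'n)"
    by (auto simp: Basis_vec_def)
  have f: "f x = 0 + (\<Sum>j\<in>Basis. (d j * (x \<bullet> j)) *\<^sub>R j)" for x
  proof -
    have "f x \<bullet> j = d j * (x \<bullet> j)" if "j \<in> Basis" for j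
      using that d by (auto simp: Basis f_def inner_axis)
    then show ?thesis
      using euclidean_representation[of "f x"] by simp
  qed
  have "(\<Prod>j\<in>Basis. \<bar>d j\<bar>) = \<bar>prod c UNIV\<bar>"
    unfolding Basis by (simp add: prod.reindex inj_on_def axis_eq_axis d abs_prod)
  moreover have dnz: "d j \<noteq> 0" if "j \<in> Basis" for j
    using that c d by (auto simp: Basis)
  ultimately have "lborel = density (distr lborel borel f) (\<lambda>_. ennreal \<bar>prod c UNIV\<bar>)"
    using lborel_affine_euclidean[of d 0] dnz unfolding f[symmetric] by simp
  then have "(\<integral>\<^sup>+x. h x \<partial>lborel) = (\<integral>\<^sup>+x. h x \<partial>density (distr lborel borel f) (\<lambda>_. ennreal \<bar>prod c UNIV\<bar>))"
    by simp
  also have "\<dots> = ennreal \<bar>prod c UNIV\<bar> * (\<integral>\<^sup>+x. h (f x) \<partial>lborel)"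
    using h by (simp add: nn_integral_density nn_integral_distr nn_integral_cmult)
  finally show ?thesis ..
qed

text \<open>
  The library proves the linear change of variables only for well-ordered index types.
\<close>

lemma nn_integral_lborel_linear:
  fixes f :: "real ^ 'n \<Rightarrow> real ^ 'n" and h :: "real ^ 'n \<Rightarrow> ennreal"
  assumes "linear f" "det (matrix f) \<noteq> 0" "h \<in> borel_measurable borel"
  shows "ennreal \<bar>det (matrix f)\<bar> * (\<integral>\<^sup>+x. h (f x) \<partial>lborel) = (\<integral>\<^sup>+x. h x \<partial>lborel)"
proof -
  \<comment> \<open>\<open>h\<close> is quantified inside the induction, because a composition
    applies the hypothesis for \<open>g\<close> to the function \<open>h (f x)\<close>.\<close>
  have "\<forall>h\<in>borel_measurable borel. det (matrix f) \<noteq> 0 \<longrightarrow>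
      ennreal \<bar>det (matrix f)\<bar> * (\<integral>\<^sup>+x. h (f x) \<partial>lborel) = (\<integral>\<^sup>+x. h x \<partial>lborel)"
    using \<open>linear f\<close>
  proof (rule induct_linear_elementary; intro ballI impI)
    fix f g :: "real ^ 'n \<Rightarrow> real ^ 'n" and h :: "real ^ 'n \<Rightarrow> ennreal"
    assume lin: "linear f" "linear g" and [measurable]: "h \<in> borel_measurable borel"
      and f: "\<forall>h\<in>borel_measurable borel. det (matrix f) \<noteq> 0 \<longrightarrow>
        ennreal \<bar>det (matrix f)\<bar> * (\<integral>\<^sup>+x. h (f x) \<partial>lborel) = (\<integral>\<^sup>+x. h x \<partial>lborel)"
      and g: "\<forall>h\<in>borel_measurable borel. det (matrix g) \<noteq> 0 \<longrightarrow>
        ennreal \<bar>det (matrix g)\<bar> * (\<integral>\<^sup>+x. h (g x) \<partial>lborel) = (\<integral>\<^sup>+x. h x \<partial>lborel)"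
      and "det (matrix (f \<circ> g)) \<noteq> 0"
    then have det: "det (matrix (f \<circ> g)) = det (matrix f) * det (matrix g)"
        "det (matrix f) \<noteq> 0" "det (matrix g) \<noteq> 0"
      using matrix_compose[OF lin(2,1)] by (auto simp: det_mul)
    have [measurable]: "f \<in> borel_measurable borel"
      using lin(1) by (intro borel_measurable_continuous_onI linear_continuous_on) (simp add: linear_linear)
    have hf: "(\<lambda>x. h (f x)) \<in> borel_measurable borel"
      by measurable
    have "ennreal \<bar>det (matrix (f \<circ> g))\<bar> * (\<integral>\<^sup>+x. h ((f \<circ> g) x) \<partial>lborel)
        = ennreal \<bar>det (matrix f)\<bar> * (ennreal \<bar>det (matrix g)\<bar> * (\<integral>\<^sup>+x. h (f (g x)) \<partial>lborel))"
      by (simp add: det(1) abs_mult ennreal_mult mult.assoc)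
    also have "\<dots> = ennreal \<bar>det (matrix f)\<bar> * (\<integral>\<^sup>+x. h (f x) \<partial>lborel)"
      using g[rule_format, OF hf det(3)] by simp
    also have "\<dots> = (\<integral>\<^sup>+x. h x \<partial>lborel)"
      using f det(2) by simp
    finally show "ennreal \<bar>det (matrix (f \<circ> g))\<bar> * (\<integral>\<^sup>+x. h ((f \<circ> g) x) \<partial>lborel) = (\<integral>\<^sup>+x. h x \<partial>lborel)" .
  next
    fix f :: "real ^ 'n \<Rightarrow> real ^ 'n" and i h
    assume lin: "linear f" and 0: "\<And>x. f x $ i = 0" and "det (matrix f) \<noteq> 0"
    \<comment> \<open>A nonzero determinant gives surjectivity, which a constantly zero coordinate
      contradicts; this case is vacuous.\<close>
    then have "surj f"
      using det_nz_iff_inj linear_injective_imp_surjective by blast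
    then show "ennreal \<bar>det (matrix f)\<bar> * (\<integral>\<^sup>+x. h (f x) \<partial>lborel) = (\<integral>\<^sup>+x. h x \<partial>lborel)"
      using 0 by (metis one_neq_zero surjE vec_component)
  next
    fix c :: "'n \<Rightarrow> real" and h :: "real ^ 'n \<Rightarrow> ennreal"
    let ?f = "\<lambda>x::real ^ 'n. \<chi> i. c i * x $ i"
    assume h: "h \<in> borel_measurable borel" and nz: "det (matrix ?f) \<noteq> 0"
    have det: "det (matrix ?f) = prod c UNIV"
      by (simp add: axis_def matrix_def det_diagonal)
    with nz have "c i \<noteq> 0" for i
      by auto
    then show "ennreal \<bar>det (matrix ?f)\<bar> * (\<integral>\<^sup>+x. h (?f x) \<partial>lborel) = (\<integral>\<^sup>+x. h x \<partial>lborel)"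
      unfolding det using h by (rule nn_integral_lborel_diagonal)
  next
    fix m n :: 'n and h :: "real ^ 'n \<Rightarrow> ennreal"
    let ?f = "\<lambda>x::real ^ 'n. \<chi> i. x $ Transposition.transpose m n i"
    assume h: "h \<in> borel_measurable borel"
    have "matrix ?f = transpose (\<chi> i j. mat 1 $ i $ Transposition.transpose m n j)"
      by (auto simp: transpose_def axis_def mat_def matrix_def vec_eq_iff)
    then have "\<bar>det (matrix ?f)\<bar> = 1"
      by (simp add: det_permute_columns permutes_swap_id sign_swap_id abs_mult)
    then show "ennreal \<bar>det (matrix ?f)\<bar> * (\<integral>\<^sup>+x. h (?f x) \<partial>lborel) = (\<integral>\<^sup>+x. h x \<partial>lborel)"
      using nn_integral_lborel_transpose[OF h, of m n] by simp
  next
    fix m n :: 'n and h :: "real ^ 'n \<Rightarrow> ennreal"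
    let ?f = "\<lambda>x::real ^ 'n. \<chi> i. if i = m then x $ m + x $ n else x $ i"
    assume h: "h \<in> borel_measurable borel" and "m \<noteq> n"
    have "matrix ?f = (\<chi> k. if k = m then row m (mat 1) + 1 *s row n (mat 1) else row k (mat 1))"
      by (auto simp: axis_def mat_def matrix_def row_def vec_eq_iff)
    then have "det (matrix ?f) = 1"
      using det_row_operation[OF \<open>m \<noteq> n\<close>, of "mat 1" 1] by (simp only: det_I)
    then show "ennreal \<bar>det (matrix ?f)\<bar> * (\<integral>\<^sup>+x. h (?f x) \<partial>lborel) = (\<integral>\<^sup>+x. h x \<partial>lborel)"
      using nn_integral_lborel_shear[OF \<open>m \<noteq> n\<close> h] by simp
  qed
  with assms show ?thesis by blast
qed

lemma nn_integral_lborel_matrix: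
  fixes A :: "real ^ 'n ^ 'n" and h :: "real ^ 'n \<Rightarrow> ennreal"
  assumes A: "det A \<noteq> 0" and h: "h \<in> borel_measurable borel"
  shows "(\<integral>\<^sup>+x. h (A *v x) \<partial>lborel) = ennreal \<bar>det (matrix_inv A)\<bar> * (\<integral>\<^sup>+x. h x \<partial>lborel)"
proof -
  have inv: "invertible A"
    using A by (simp add: invertible_det_nz)
  have "det (matrix_inv A) * det A = 1"
    proof -
    have "matrix_inv A ** A = mat 1"
      unfolding matrix_inv_def using someI_ex[OF inv[unfolded invertible_def]] by blast
    then show ?thesis by (metis det_I det_mul)
  qed
  then have 1: "\<bar>det (matrix_inv A)\<bar> * \<bar>det A\<bar> = 1"
    by (metis abs_mult abs_one)
  have "(\<integral>\<^sup>+x. h x \<partial>lborel) = ennreal \<bar>det A\<bar> * (\<integral>\<^sup>+x. h (A *v x) \<partial>lborel)"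
    using nn_integral_lborel_linear[OF matrix_vector_mul_linear _ h, of A] A
    by (simp add: matrix_of_matrix_vector_mul)
  then have "ennreal \<bar>det (matrix_inv A)\<bar> * (\<integral>\<^sup>+x. h x \<partial>lborel)
      = ennreal (\<bar>det (matrix_inv A)\<bar> * \<bar>det A\<bar>) * (\<integral>\<^sup>+x. h (A *v x) \<partial>lborel)"
    by (simp add: ennreal_mult mult.assoc)
  then show ?thesis by (simp add: 1)
qed

lemma norm_matrix_vector_mult_le:
  fixes A :: "real ^ 'n ^ 'm" and x :: "real ^ 'n"
  shows "norm (A *v x) \<le> norm A * norm x"
proof -
  have "norm (A *v x) = L2_set (\<lambda>i. \<bar>A $ i \<bullet> x\<bar>) UNIV"
    by (simp add: norm_vec_def matrix_vector_mul_component)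
  also have "\<dots> \<le> L2_set (\<lambda>i. norm (A $ i) * norm x) UNIV"
    by (intro L2_set_mono Cauchy_Schwarz_ineq2) auto
  also have "\<dots> = norm A * norm x"
    by (simp add: norm_vec_def L2_set_left_distrib)
  finally show ?thesis .
qed

subsection \<open>Muckenhoupt and reverse Hoelder weights\<close>

lemma ball_sets_lebesgue [measurable]: "ball z r \<in> sets lebesgue"
  by (rule fmeasurableD[OF lmeasurable_ball])

lemma cball_sets_lebesgue [measurable]: "cball z r \<in> sets lebesgue"
  by (rule fmeasurableD[OF lmeasurable_cball])

text \<open>The restrictions to balls of integer radius are measurable and, at each point,
  eventually equal to \<open>f\<close>.\<close>

lemma locally_integrable_measurable:
  fixes f :: "real ^ 'n \<Rightarrow> 'b :: {banach, second_countable_topology}"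
  assumes "locally_integrable f"
  shows "f \<in> borel_measurable lebesgue"
proof (rule borel_measurable_LIMSEQ_metric)
  show "(\<lambda>x. indicator (cball 0 (real i)) x *\<^sub>R f x) \<in> borel_measurable lebesgue" for i
    using assms unfolding locally_integrable_def set_integrable_def
    by (intro borel_measurable_integrable) auto
  show "(\<lambda>i. indicator (cball 0 (real i)) x *\<^sub>R f x) \<longlonglongrightarrow> f x" for x
  proof (rule tendsto_eventually)
    obtain N :: nat where "norm x \<le> real N"
      using real_arch_simple by blast
    then show "\<forall>\<^sub>F i in sequentially. indicator (cball 0 (real i)) x *\<^sub>R f x = f x"
      by (intro eventually_sequentiallyI[of N]) (auto simp: indicator_def)
  qed
qed

lemma weight_measurable: "weight w \<Longrightarrow> w \<in> borel_measurable lebesgue"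
  by (simp add: weight_def locally_integrable_measurable)

lemma weight_nonneg: "weight w \<Longrightarrow> 0 \<le> w x"
  by (simp add: weight_def)

lemma wmeasure_compact_finite:
  assumes "weight w" "compact K"
  shows "wmeasure w K < top"
proof -
  have "integrable lebesgue (\<lambda>x. indicator K x *\<^sub>R w x)"
    using assms by (simp add: weight_def locally_integrable_def set_integrable_def)
  then have "(\<integral>\<^sup>+x. ennreal (norm (indicator K x *\<^sub>R w x)) \<partial>lebesgue) < top"
    by (simp add: integrable_iff_bounded)
  moreover have "ennreal (norm (indicator K x *\<^sub>R w x)) = ennreal (w x) * indicator K x" for x
    using assms(1) by (simp add: weight_def indicator_def)
  ultimately show ?thesis
    unfolding wmeasure_def by simp
qed

lemma emeasure_lebesgue_ball_pos:
  fixes z :: "real ^ 'n"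
  assumes "0 < r"
  obtains b where "0 < b" "emeasure lebesgue (ball z r) = ennreal b"
proof
  show "0 < measure lebesgue (ball z r)"
    using assms by (simp add: content_ball_pos)
  show "emeasure lebesgue (ball z r) = ennreal (measure lebesgue (ball z r))"
    by (simp add: emeasure_eq_measure2)
qed

lemma ennreal_divide_cancel_left:
  assumes "0 < b"
  shows "ennreal b * (x / ennreal b) = x"
  using assms by (metis ennreal_eq_0_iff ennreal_neq_top ennreal_times_divide linorder_not_le
      mult.commute mult_divide_eq_ennreal)

text \<open>The A_\<xi> condition tested on functions: the mean of \<open>h\<close> over
  \<open>B\<close>, to the power \<xi>, is at most \<open>C\<close> times the mean of
  \<open>h\<close> to the power \<xi> with respect to \<open>w\<close>. Multiplied out, it contains
  no quotients and covers \<xi> = 1.\<close>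

abbreviation muckenhoupt_ineq ::
  "(real ^ 'n \<Rightarrow> real) \<Rightarrow> real \<Rightarrow> real \<Rightarrow> (real ^ 'n) set \<Rightarrow> (real ^ 'n \<Rightarrow> ennreal) \<Rightarrow> bool"
  where "muckenhoupt_ineq w \<xi> C B h \<equiv>
    ennpowr (\<integral>\<^sup>+x\<in>B. h x \<partial>lebesgue) \<xi> * wmeasure w B
      \<le> ennreal C * ennpowr (emeasure lebesgue B) \<xi> * (\<integral>\<^sup>+x\<in>B. ennpowr (h x) \<xi> * ennreal (w x) \<partial>lebesgue)"

text \<open>The dual form of the reverse Hoelder condition: the mean of \<open>g\<close> with
  respect to \<open>w\<close> is at most \<open>C\<close> times its unweighted mean of order
  1/\<tau>.\<close>

abbreviation reverse_hoelder_ineq ::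
  "(real ^ 'n \<Rightarrow> real) \<Rightarrow> real \<Rightarrow> real \<Rightarrow> (real ^ 'n) set \<Rightarrow> (real ^ 'n \<Rightarrow> ennreal) \<Rightarrow> bool"
  where "reverse_hoelder_ineq w \<tau> C B g \<equiv>
    ennpowr (emeasure lebesgue B) \<tau> * (\<integral>\<^sup>+x\<in>B. g x * ennreal (w x) \<partial>lebesgue)
      \<le> ennreal C * ennpowr (\<integral>\<^sup>+x\<in>B. ennpowr (g x) (1 / \<tau>) \<partial>lebesgue) \<tau> * wmeasure w B"

text \<open>Jensen's inequality against the dual weight \<sigma> = w^(-1/(\<xi> - 1)): writing h = u
  \<sigma>, one has u^\<xi> \<sigma> = h^\<xi> w, and the remaining power of the mass of \<sigma> is
  what the A_\<xi> product controls.\<close>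

lemma muckenhoupt_ball_gt_1:
  fixes w :: "real ^ 'n \<Rightarrow> real"
  assumes \<xi>: "1 < \<xi>" and [measurable]: "w \<in> borel_measurable lebesgue" "h \<in> borel_measurable lebesgue"
    and w0: "\<And>x. 0 \<le> w x" and "0 < r"
    and C: "average (ball z r) (\<lambda>x. ennreal (w x)) *
         ennpowr (average (ball z r) (\<lambda>x. ennpowr (ennreal (w x)) (- 1 / (\<xi> - 1)))) (\<xi> - 1)
           \<le> ennreal C"
  shows "muckenhoupt_ineq w \<xi> C (ball z r) h"
proof (cases "wmeasure w (ball z r) = 0")
  case False
  let ?B = "ball z r"
  obtain b where b: "0 < b" "emeasure lebesgue ?B = ennreal b"
    using emeasure_lebesgue_ball_pos[OF \<open>0 < r\<close>] .
  define \<sigma> where "\<sigma> x = ennpowr (ennreal (w x)) (- 1 / (\<xi> - 1))" for x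
  have [measurable]: "\<sigma> \<in> borel_measurable lebesgue"
    unfolding \<sigma>_def by measurable
  define S where "S = (\<integral>\<^sup>+x\<in>?B. \<sigma> x \<partial>lebesgue)"
  define W where "W = wmeasure w ?B"
  have "W * ennpowr S (\<xi> - 1) = ennreal b * (W / ennreal b)
      * (ennpowr (ennreal b) (\<xi> - 1) * ennpowr (S / ennreal b) (\<xi> - 1))"
    using \<xi> b(1) by (simp add: ennreal_divide_cancel_left flip: ennpowr_mult)
  also have "\<dots> = (ennreal b * ennpowr (ennreal b) (\<xi> - 1))
      * ((W / ennreal b) * ennpowr (S / ennreal b) (\<xi> - 1))"
    by (simp only: mult_ac)
  also have "\<dots> \<le> (ennreal b * ennpowr (ennreal b) (\<xi> - 1)) * ennreal C"
    using C by (intro mult_left_mono) (simp_all add: average_def W_def S_def \<sigma>_def b(2) wmeasure_def)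
  also have "ennreal b * ennpowr (ennreal b) (\<xi> - 1) = ennpowr (ennreal b) \<xi>"
    using ennpowr_add[of 1 "\<xi> - 1" "ennreal b"] \<xi> by simp
  finally have WS: "W * ennpowr S (\<xi> - 1) \<le> ennpowr (ennreal b) \<xi> * ennreal C" .
  \<comment> \<open>Here the positive mass of the ball enters: it bounds the \<sigma>-mass, which
    forces \<open>w > 0\<close> almost everywhere on the ball and thereby justifies h = u
    \<sigma>.\<close>
  have "S \<noteq> top"
  proof
    assume "S = top"
    then have "W * ennpowr S (\<xi> - 1) = top"
      using \<xi> False by (simp add: W_def ennreal_mult_top)
    then show False
      using WS \<xi> b(1) by (auto simp: top_unique ennpowr_ennreal ennreal_mult_eq_top_iff)
  qed
  then have "AE x in lebesgue. \<sigma> x * indicator ?B x \<noteq> top"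
    unfolding S_def using nn_integral_PInf_AE[of "\<lambda>x. \<sigma> x * indicator ?B x" lebesgue] by simp
  then have pos: "AE x in lebesgue. x \<in> ?B \<longrightarrow> 0 < w x"
  proof eventually_elim
    case (elim x)
    show ?case
    proof
      assume "x \<in> ?B"
      with elim have "\<sigma> x \<noteq> top" by simp
      then have "w x \<noteq> 0"
        using \<xi> by (auto simp: \<sigma>_def ennpowr_0_left_neg)
      with w0[of x] show "0 < w x" by simp
    qed
  qed
  define u where "u x = h x * ennpowr (ennreal (w x)) (1 / (\<xi> - 1))" for x
  have [measurable]: "u \<in> borel_measurable lebesgue"
    unfolding u_def by measurable
  have eq: "AE x in lebesgue. u x * (\<sigma> x * indicator ?B x) = h x * indicator ?B x
      \<and> ennpowr (u x) \<xi> * (\<sigma> x * indicator ?B x) = ennpowr (h x) \<xi> * ennreal (w x) * indicator ?B x"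
    using pos
  proof eventually_elim
    case (elim x)
    show ?case
    proof (cases "x \<in> ?B")
      case True
      then have wx: "0 < w x" using elim by simp
      then have "w x powr (1 / (\<xi> - 1)) * w x powr (- 1 / (\<xi> - 1)) = 1"
        by (simp flip: powr_add)
      then have 1: "u x * \<sigma> x = h x"
        using wx by (simp add: u_def \<sigma>_def ennpowr_ennreal mult.assoc flip: ennreal_mult)
      have "(w x powr (1 / (\<xi> - 1))) powr \<xi> * w x powr (- 1 / (\<xi> - 1)) = w x powr 1"
        using \<xi> by (simp add: powr_powr diff_divide_distrib[symmetric] flip: powr_add)
      then have "ennpowr (u x) \<xi> * \<sigma> x = ennpowr (h x) \<xi> * ennreal (w x)"
        using wx \<xi> by (simp add: u_def \<sigma>_def ennpowr_ennreal ennpowr_mult mult.assoc flip: ennreal_mult)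
      with 1 True show ?thesis by simp
    qed simp
  qed
  have "ennpowr (\<integral>\<^sup>+x\<in>?B. h x \<partial>lebesgue) \<xi> = ennpowr (\<integral>\<^sup>+x. u x * (\<sigma> x * indicator ?B x) \<partial>lebesgue) \<xi>"
    using eq by (intro arg_cong[of _ _ "\<lambda>t. ennpowr t \<xi>"] nn_integral_cong_AE) (auto elim: eventually_mono)
  also have "\<dots> \<le> (\<integral>\<^sup>+x. ennpowr (u x) \<xi> * (\<sigma> x * indicator ?B x) \<partial>lebesgue) * ennpowr S (\<xi> - 1)"
    unfolding S_def using \<xi> by (intro nn_integral_jensen_ennpowr) auto
  also have "(\<integral>\<^sup>+x. ennpowr (u x) \<xi> * (\<sigma> x * indicator ?B x) \<partial>lebesgue)
      = (\<integral>\<^sup>+x\<in>?B. ennpowr (h x) \<xi> * ennreal (w x) \<partial>lebesgue)" (is "_ = ?I")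
    using eq by (intro nn_integral_cong_AE) (auto elim: eventually_mono)
  finally have "ennpowr (\<integral>\<^sup>+x\<in>?B. h x \<partial>lebesgue) \<xi> * W \<le> ?I * ennpowr S (\<xi> - 1) * W"
    by (intro mult_right_mono) auto
  also have "\<dots> = ?I * (W * ennpowr S (\<xi> - 1))"
    by (simp only: mult_ac)
  also have "\<dots> \<le> ?I * (ennpowr (ennreal b) \<xi> * ennreal C)"
    using WS by (intro mult_left_mono) auto
  finally show ?thesis
    unfolding W_def b(2) by (simp only: mult_ac)
qed simp

lemma muckenhoupt_ball_1:
  fixes w :: "real ^ 'n \<Rightarrow> real"
  assumes [measurable]: "w \<in> borel_measurable lebesgue" "h \<in> borel_measurable lebesgue" and "0 < r"
    and C: "average (ball z r) (\<lambda>x. ennreal (w x))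
      \<le> ennreal C * essinf_on (ball z r) (\<lambda>x. ennreal (w x))"
  shows "(\<integral>\<^sup>+x\<in>ball z r. h x \<partial>lebesgue) * wmeasure w (ball z r)
      \<le> ennreal C * emeasure lebesgue (ball z r) * (\<integral>\<^sup>+x\<in>ball z r. h x * ennreal (w x) \<partial>lebesgue)"
proof -
  let ?B = "ball z r"
  obtain b where b: "0 < b" "emeasure lebesgue ?B = ennreal b"
    using emeasure_lebesgue_ball_pos[OF \<open>0 < r\<close>] .
  let ?I = "\<integral>\<^sup>+x\<in>?B. h x \<partial>lebesgue"
  \<comment> \<open>The essential infimum is defined as a supremum of lower bounds, so each lower
    bound is multiplied into the integral and the supremum is taken last.\<close>
  have "essinf_on ?B (\<lambda>x. ennreal (w x)) * ?I
      = (SUP c\<in>{c. AE x in lebesgue. x \<in> ?B \<longrightarrow> c \<le> ennreal (w x)}. c * ?I)"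
    unfolding essinf_on_def by (simp add: SUP_mult_right_ennreal[symmetric])
  also have "\<dots> \<le> (\<integral>\<^sup>+x\<in>?B. h x * ennreal (w x) \<partial>lebesgue)"
  proof (rule SUP_least, clarify)
    fix c assume c: "AE x in lebesgue. x \<in> ?B \<longrightarrow> c \<le> ennreal (w x)"
    have "c * ?I = (\<integral>\<^sup>+x. c * (h x * indicator ?B x) \<partial>lebesgue)"
      by (rule nn_integral_cmult[symmetric]) measurable
    also have "\<dots> \<le> (\<integral>\<^sup>+x\<in>?B. h x * ennreal (w x) \<partial>lebesgue)"
    proof (rule nn_integral_mono_AE)
      show "AE x in lebesgue. c * (h x * indicator ?B x) \<le> h x * ennreal (w x) * indicator ?B x"
        using c by eventually_elim (auto simp: indicator_def mult.commute[of c] intro!: mult_left_mono)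
    qed
    finally show "c * ?I \<le> (\<integral>\<^sup>+x\<in>?B. h x * ennreal (w x) \<partial>lebesgue)" .
  qed
  finally have *: "essinf_on ?B (\<lambda>x. ennreal (w x)) * ?I \<le> (\<integral>\<^sup>+x\<in>?B. h x * ennreal (w x) \<partial>lebesgue)" .
  have "?I * wmeasure w ?B = ?I * (ennreal b * (wmeasure w ?B / ennreal b))"
    using b by (simp add: ennreal_divide_cancel_left)
  also have "wmeasure w ?B / ennreal b = average ?B (\<lambda>x. ennreal (w x))"
    by (simp add: average_def wmeasure_def b(2))
  also have "?I * (ennreal b * \<dots>) \<le> ?I * (ennreal b * (ennreal C * essinf_on ?B (\<lambda>x. ennreal (w x))))"
    using C by (intro mult_left_mono) auto
  also have "\<dots> = ennreal C * ennreal b * (essinf_on ?B (\<lambda>x. ennreal (w x)) * ?I)"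
    by (simp only: mult_ac)
  also have "\<dots> \<le> ennreal C * ennreal b * (\<integral>\<^sup>+x\<in>?B. h x * ennreal (w x) \<partial>lebesgue)"
    using * by (intro mult_left_mono) auto
  finally show ?thesis unfolding b(2) .
qed

lemma muckenhoupt_weight: "w \<in> muckenhoupt \<xi> \<Longrightarrow> weight w"
  by (simp add: muckenhoupt_def)

lemma muckenhoupt_ball:
  fixes w :: "real ^ 'n \<Rightarrow> real"
  assumes w: "w \<in> muckenhoupt \<xi>"
  obtains C where "0 < C" "\<And>z (r::real) h. 0 < r \<Longrightarrow> h \<in> borel_measurable lebesgue \<Longrightarrow>
    muckenhoupt_ineq w \<xi> C (ball z r) h"
proof -
  have ww: "weight w" and wm: "w \<in> borel_measurable lebesgue"
    using w by (auto intro: muckenhoupt_weight weight_measurable)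
  have "\<exists>C. \<forall>z (r::real) h. 0 < r \<longrightarrow> h \<in> borel_measurable lebesgue \<longrightarrow>
    muckenhoupt_ineq w \<xi> C (ball z r) h"
    using w unfolding muckenhoupt_def
  proof (clarify, elim disjE conjE exE)
    fix C assume "1 < \<xi>" "\<forall>z r. 0 < r \<longrightarrow>
         average (ball z r) (\<lambda>x. ennreal (w x)) *
         ennpowr (average (ball z r) (\<lambda>x. ennpowr (ennreal (w x)) (- 1 / (\<xi> - 1)))) (\<xi> - 1)
           \<le> ennreal C"
    then show ?thesis
      using wm weight_nonneg[OF ww] by (intro exI[of _ C] allI impI muckenhoupt_ball_gt_1) auto
  next
    fix C assume "\<xi> = 1" "\<forall>z r. 0 < r \<longrightarrow>
         average (ball z r) (\<lambda>x. ennreal (w x)) \<le> ennreal C * essinf_on (ball z r) (\<lambda>x. ennreal (w x))"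
    then show ?thesis
      using muckenhoupt_ball_1[OF wm] by (intro exI[of _ C] allI impI) simp
  qed
  then obtain C where C: "\<And>z (r::real) h. 0 < r \<Longrightarrow> h \<in> borel_measurable lebesgue \<Longrightarrow>
    muckenhoupt_ineq w \<xi> C (ball z r) h"
    by blast
  show ?thesis
  \<comment> \<open>The definition of the class fixes no sign of \<open>C\<close>; the maximum makes
    it positive.\<close>
  proof (rule that[of "max C 1"])
    fix z :: "real ^ 'n" and r :: real and h :: "real ^ 'n \<Rightarrow> ennreal" assume *: "0 < r" "h \<in> borel_measurable lebesgue"
    show "muckenhoupt_ineq w \<xi> (max C 1) (ball z r) h"
      by (rule order_trans[OF C[OF *]]) (intro mult_right_mono ennreal_leI, auto)
  qed simp
qed

text \<open>Hoelder with three factors: \<open>g\<close> with weight \<tau>, \<open>w\<close> with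
  weight 1/r, and the constant 1 on the ball with the remaining weight
  \<open>1 - \<tau> - 1 / r\<close>. The powers of the volume add up to -\<tau>.\<close>

lemma reverse_hoelder_ball:
  fixes w :: "real ^ 'n \<Rightarrow> real"
  assumes w: "w \<in> reverse_hoelder r" and r: "1 < r" and \<tau>: "0 < \<tau>" "\<tau> \<le> 1 - 1 / r"
  obtains C where "0 < C" "\<And>z (\<rho>::real) g. 0 < \<rho> \<Longrightarrow> g \<in> borel_measurable lebesgue \<Longrightarrow>
    reverse_hoelder_ineq w \<tau> C (ball z \<rho>) g"
proof -
  have ww: "weight w"
    using w by (simp add: reverse_hoelder_def)
  then have [measurable]: "w \<in> borel_measurable lebesgue" and w0: "0 \<le> w x" for x
    by (auto intro: weight_measurable weight_nonneg)
  obtain C0 where C0: "\<And>z (\<rho>::real). 0 < \<rho> \<Longrightarrow>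
     ennpowr (average (ball z \<rho>) (\<lambda>x. ennreal (w x powr r))) (1 / r)
       \<le> ennreal C0 * average (ball z \<rho>) (\<lambda>x. ennreal (w x))"
    using w by (auto simp: reverse_hoelder_def)
  define C where "C = max C0 1"
  have C: "ennpowr (average (ball z \<rho>) (\<lambda>x. ennreal (w x powr r))) (1 / r)
       \<le> ennreal C * average (ball z \<rho>) (\<lambda>x. ennreal (w x))" if "0 < \<rho>" for z and \<rho> :: real
    by (rule order_trans[OF C0[OF that]]) (intro mult_right_mono ennreal_leI, auto simp: C_def)
  show ?thesis
  proof (rule that[of C])
    fix z :: "real ^ 'n" and \<rho> :: real and g :: "real ^ 'n \<Rightarrow> ennreal"
    assume "0 < \<rho>" and [measurable]: "g \<in> borel_measurable lebesgue"
    let ?B = "ball z \<rho>"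
    obtain b where b: "0 < b" "emeasure lebesgue ?B = ennreal b"
      using emeasure_lebesgue_ball_pos[OF \<open>0 < \<rho>\<close>] .
    define G where "G = (\<integral>\<^sup>+x\<in>?B. ennpowr (g x) (1 / \<tau>) \<partial>lebesgue)"
    define R where "R = (\<integral>\<^sup>+x\<in>?B. ennreal (w x powr r) \<partial>lebesgue)"
    define W where "W = wmeasure w ?B"
    define \<theta> where "\<theta> i = (if i = 0 then \<tau> else if i = 1 then 1 / r else 1 - \<tau> - 1 / r)" for i :: nat
    define F :: "nat \<Rightarrow> real ^ 'n \<Rightarrow> ennreal"
      where "F i x = (if i = 0 then ennpowr (g x) (1 / \<tau>) else if i = 1 then ennreal (w x powr r) else 1)
        * indicator ?B x" for i x
    have eq: "(\<Prod>i<3. ennpowr (F i x) (\<theta> i)) = g x * ennreal (w x) * indicator ?B x" for x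
    proof (cases "x \<in> ?B")
      case True
      then have "ennpowr (F 0 x) (\<theta> 0) = g x" "ennpowr (F 1 x) (\<theta> 1) = ennreal (w x)" "ennpowr (F 2 x) (\<theta> 2) = 1"
        using r \<tau> w0[of x] by (simp_all add: F_def \<theta>_def ennpowr_ennpowr ennpowr_ennreal_nonneg powr_powr)
      with True show ?thesis by (simp add: numeral_3_eq_3 numeral_2_eq_2)
    next
      case False
      then have "ennpowr (F 0 x) (\<theta> 0) = 0"
        using \<tau> by (simp add: F_def \<theta>_def)
      with False show ?thesis by (simp add: numeral_3_eq_3)
    qed
    have "(\<integral>\<^sup>+x\<in>?B. g x * ennreal (w x) \<partial>lebesgue) \<le> (\<Prod>i<3. ennpowr (\<integral>\<^sup>+x. F i x \<partial>lebesgue) (\<theta> i))"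
      unfolding eq[symmetric] using r \<tau>
      by (intro nn_integral_prod_ennpowr_le) (auto simp: \<theta>_def F_def numeral_3_eq_3)
    also have "\<dots> = ennpowr G \<tau> * ennpowr R (1 / r) * ennpowr (ennreal b) (1 - \<tau> - 1 / r)"
      by (simp add: numeral_3_eq_3 \<theta>_def F_def G_def R_def b(2)[symmetric])
    finally have 1: "(\<integral>\<^sup>+x\<in>?B. g x * ennreal (w x) \<partial>lebesgue)
      \<le> ennpowr G \<tau> * ennpowr R (1 / r) * ennreal (b powr (1 - \<tau> - 1 / r))" (is "?I \<le> _")
      using b by (simp add: ennpowr_ennreal)
    have "ennpowr R (1 / r) = ennpowr (ennreal b) (1 / r) * ennpowr (R / ennreal b) (1 / r)"
      using r b(1) by (simp add: ennreal_divide_cancel_left flip: ennpowr_mult)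
    also have "\<dots> \<le> ennpowr (ennreal b) (1 / r) * (ennreal C * (W / ennreal b))"
      using C[OF \<open>0 < \<rho>\<close>, of z]
      by (intro mult_left_mono) (simp_all add: average_def R_def W_def wmeasure_def b(2))
    also have "\<dots> = ennreal C * (ennreal (b powr (1 / r)) * (W / ennreal b))"
      using b by (simp add: ennpowr_ennreal mult_ac)
    also have "W / ennreal b = ennreal (1 / b) * W"
      using b by (simp add: divide_ennreal_def inverse_ennreal inverse_eq_divide mult.commute)
    finally have 2: "ennpowr R (1 / r) \<le> ennreal C * (ennreal (b powr (1 / r)) * (ennreal (1 / b) * W))" .
    have b1: "b powr \<tau> * (b powr (1 / r) * (1 / b) * b powr (1 - \<tau> - 1 / r)) = 1"
    proof -
      have "1 / b = b powr (- 1)"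
        using b by (simp add: powr_minus inverse_eq_divide)
      then show ?thesis using b by (simp flip: powr_add)
    qed
    have "ennpowr (ennreal b) \<tau> * ?I
      \<le> ennreal (b powr \<tau>) * (ennpowr G \<tau> * (ennreal C * (ennreal (b powr (1 / r)) * (ennreal (1 / b) * W)))
          * ennreal (b powr (1 - \<tau> - 1 / r)))"
      using b 1 2 by (intro mult_mono order_trans[OF 1]) (auto simp: ennpowr_ennreal intro!: mult_mono)
    also have "\<dots> = ennreal C * ennpowr G \<tau> * W
        * (ennreal (b powr \<tau>) * (ennreal (b powr (1 / r)) * ennreal (1 / b) * ennreal (b powr (1 - \<tau> - 1 / r))))"
      by (simp only: mult_ac)
    also have "(ennreal (b powr \<tau>) * (ennreal (b powr (1 / r)) * ennreal (1 / b) * ennreal (b powr (1 - \<tau> - 1 / r)))) = 1"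
      using b b1 by (simp flip: ennreal_mult)
    finally show "ennpowr (emeasure lebesgue ?B) \<tau> * ?I
      \<le> ennreal C * ennpowr (\<integral>\<^sup>+x\<in>?B. ennpowr (g x) (1 / \<tau>) \<partial>lebesgue) \<tau> * wmeasure w ?B"
      by (simp add: b(2) G_def W_def)
  qed (simp add: C_def)
qed

section \<open>Weight inequalities on dyadic balls\<close>

lemma dyadic_ball_eq_cball: "dyadic_ball k = cball 0 (2 powi k)"
  by (auto simp: dyadic_ball_def)

lemma dyadic_ball_measurable [measurable]: "dyadic_ball k \<in> sets lebesgue"
  by (simp add: dyadic_ball_eq_cball)

lemma dyadic_ball_mono: "j \<le> k \<Longrightarrow> dyadic_ball j \<subseteq> dyadic_ball k"
  unfolding dyadic_ball_def by (auto intro: order_trans[OF _ power_int_increasing[of j k 2]])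

lemma two_powi_eq_powr: "2 powi k = (2::real) powr of_int k"
  by (simp add: powr_real_of_int')

text \<open>The weight classes are defined by open balls and the dyadic balls are closed; the sphere
  between them is a null set.\<close>

lemma nn_integral_cball_eq_ball:
  fixes z :: "real ^ 'n"
  shows "(\<integral>\<^sup>+x\<in>cball z r. f x \<partial>lebesgue) = (\<integral>\<^sup>+x\<in>ball z r. f x \<partial>lebesgue)"
proof (rule nn_integral_cong_AE)
  have "AE x in lebesgue. x \<notin> sphere z r"
    using negligible_sphere[of z r] by (intro AE_not_in) (simp add: negligible_iff_null_sets)
  then show "AE x in lebesgue. f x * indicator (cball z r) x = f x * indicator (ball z r) x"
    by eventually_elim (auto simp: indicator_def)
qed

lemma nn_integral_dyadic_ball:
  fixes f :: "real ^ 'n \<Rightarrow> ennreal"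
  shows "(\<integral>\<^sup>+x\<in>dyadic_ball k. f x \<partial>lebesgue) = (\<integral>\<^sup>+x\<in>ball 0 (2 powi k). f x \<partial>lebesgue)"
  by (simp add: dyadic_ball_eq_cball nn_integral_cball_eq_ball)

lemma emeasure_ball_dyadic:
  "emeasure lebesgue (ball (0 :: real ^ 'n) (2 powi k))
    = ennreal (unit_ball_vol (real CARD('n)) * 2 powr (of_int k * real CARD('n)))"
proof -
  have "(2 powi k) ^ CARD('n) = (2::real) powr (of_int k * real CARD('n))"
    by (simp add: two_powi_eq_powr powr_powr flip: powr_realpow)
  then show ?thesis by (simp add: emeasure_ball)
qed

lemma emeasure_dyadic_ball:
  "emeasure lebesgue (dyadic_ball k :: (real ^ 'n) set)
    = ennreal (unit_ball_vol (real CARD('n)) * 2 powr (of_int k * real CARD('n)))"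
  using nn_integral_dyadic_ball[where f = "\<lambda>_::real ^ 'n. 1" and k = k] emeasure_ball_dyadic[of k, where 'n='n]
  by simp

text \<open>Here and in the next abbreviation the volume of the unit ball has gone into the
  constant, so that only a power of 2 remains.\<close>

abbreviation dyadic_muckenhoupt_ineq ::
  "(real ^ 'n \<Rightarrow> real) \<Rightarrow> real \<Rightarrow> real \<Rightarrow> int \<Rightarrow> (real ^ 'n \<Rightarrow> ennreal) \<Rightarrow> bool"
  where "dyadic_muckenhoupt_ineq w \<xi> C k h \<equiv>
    ennpowr (\<integral>\<^sup>+x\<in>dyadic_ball k. h x \<partial>lebesgue) \<xi> * wmeasure w (dyadic_ball k)
      \<le> ennreal (C * 2 powr (of_int k * real CARD('n) * \<xi>))
        * (\<integral>\<^sup>+x\<in>dyadic_ball k. ennpowr (h x) \<xi> * ennreal (w x) \<partial>lebesgue)"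

abbreviation dyadic_reverse_hoelder_ineq ::
  "(real ^ 'n \<Rightarrow> real) \<Rightarrow> real \<Rightarrow> real \<Rightarrow> int \<Rightarrow> (real ^ 'n \<Rightarrow> ennreal) \<Rightarrow> bool"
  where "dyadic_reverse_hoelder_ineq w \<tau> C k g \<equiv>
    ennreal (2 powr (of_int k * real CARD('n) * \<tau>)) * (\<integral>\<^sup>+x\<in>dyadic_ball k. g x * ennreal (w x) \<partial>lebesgue)
      \<le> ennreal C * ennpowr (\<integral>\<^sup>+x\<in>dyadic_ball k. ennpowr (g x) (1 / \<tau>) \<partial>lebesgue) \<tau>
        * wmeasure w (dyadic_ball k)"

lemma muckenhoupt_dyadic:
  fixes w :: "real ^ 'n \<Rightarrow> real"
  assumes w: "w \<in> muckenhoupt \<xi>" and \<xi>: "1 \<le> \<xi>"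
  obtains C where "0 < C" "\<And>k h. h \<in> borel_measurable lebesgue \<Longrightarrow>
    dyadic_muckenhoupt_ineq w \<xi> C k h"
proof -
  obtain C where C: "0 < C" "\<And>z (r::real) h. 0 < r \<Longrightarrow> h \<in> borel_measurable lebesgue \<Longrightarrow>
    muckenhoupt_ineq w \<xi> C (ball z r) h"
    using muckenhoupt_ball[OF w] by blast
  define u where "u = unit_ball_vol (real CARD('n))"
  have u: "0 < u" by (simp add: u_def)
  show ?thesis
  proof (rule that[of "C * u powr \<xi>"])
    fix k and h :: "real ^ 'n \<Rightarrow> ennreal" assume h: "h \<in> borel_measurable lebesgue"
    have "ennreal C * ennpowr (emeasure lebesgue (ball (0 :: real ^ 'n) (2 powi k))) \<xi>
        = ennreal (C * u powr \<xi> * 2 powr (of_int k * real CARD('n) * \<xi>))"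
      using C(1) u by (simp add: emeasure_ball_dyadic u_def[symmetric] ennpowr_ennreal powr_mult powr_powr mult.assoc
          flip: ennreal_mult)
    then show "dyadic_muckenhoupt_ineq w \<xi> (C * u powr \<xi>) k h"
      using C(2)[OF _ h, of "2 powi k" 0] by (simp add: nn_integral_dyadic_ball wmeasure_def)
  qed (use C(1) u in simp)
qed

lemma reverse_hoelder_dyadic:
  fixes w :: "real ^ 'n \<Rightarrow> real"
  assumes w: "w \<in> reverse_hoelder r" and r: "1 < r" and \<tau>: "0 < \<tau>" "\<tau> \<le> 1 - 1 / r"
  obtains C where "0 < C" "\<And>k g. g \<in> borel_measurable lebesgue \<Longrightarrow>
    dyadic_reverse_hoelder_ineq w \<tau> C k g"
proof -
  obtain C where C: "0 < C" "\<And>z (\<rho>::real) g. 0 < \<rho> \<Longrightarrow> g \<in> borel_measurable lebesgue \<Longrightarrow>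
    reverse_hoelder_ineq w \<tau> C (ball z \<rho>) g"
    using reverse_hoelder_ball[OF w r \<tau>] by blast
  define u where "u = unit_ball_vol (real CARD('n))"
  have u: "0 < u" by (simp add: u_def)
  show ?thesis
  proof (rule that[of "C * u powr (- \<tau>)"])
    fix k and g :: "real ^ 'n \<Rightarrow> ennreal" assume g: "g \<in> borel_measurable lebesgue"
    let ?p = "2 powr (of_int k * real CARD('n) * \<tau>)"
    let ?I = "\<integral>\<^sup>+x\<in>dyadic_ball k. g x * ennreal (w x) \<partial>lebesgue"
    let ?R = "ennpowr (\<integral>\<^sup>+x\<in>dyadic_ball k. ennpowr (g x) (1 / \<tau>) \<partial>lebesgue) \<tau> * wmeasure w (dyadic_ball k)"
    have eq: "ennpowr (emeasure lebesgue (ball (0 :: real ^ 'n) (2 powi k))) \<tau> = ennreal (u powr \<tau>) * ennreal ?p"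
      using u by (simp add: emeasure_ball_dyadic u_def[symmetric] ennpowr_ennreal powr_mult powr_powr
          flip: ennreal_mult)
    have "ennreal (u powr \<tau>) * ennreal ?p * ?I \<le> ennreal C * ?R"
      using C(2)[OF _ g, of "2 powi k" 0] unfolding wmeasure_def nn_integral_dyadic_ball eq
      by (simp add: mult.assoc)
    then have "ennreal (u powr (- \<tau>)) * (ennreal (u powr \<tau>) * ennreal ?p * ?I)
        \<le> ennreal (u powr (- \<tau>)) * (ennreal C * ?R)"
      by (intro mult_left_mono) auto
    moreover have "ennreal (u powr (- \<tau>)) * ennreal (u powr \<tau>) = 1"
      using u by (simp flip: ennreal_mult powr_add)
    ultimately show "ennreal ?p * ?I
      \<le> ennreal (C * u powr (- \<tau>))
        * ennpowr (\<integral>\<^sup>+x\<in>dyadic_ball k. ennpowr (g x) (1 / \<tau>) \<partial>lebesgue) \<tau> * wmeasure w (dyadic_ball k)"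
      using C(1) by (simp add: ennreal_mult mult.assoc[symmetric]) (simp add: mult_ac)
  qed (use C(1) u in simp)
qed

text \<open>A weight vanishing almost everywhere satisfies every reverse Hoelder inequality. A
  finite critical index therefore rules out the zero weight, which \<open>muckenhoupt\<close>
  admits.\<close>

lemma critical_index_weight_zero:
  fixes w :: "real ^ 'n \<Rightarrow> real"
  assumes w: "weight w" "AE x in lebesgue. w x = 0"
  shows "critical_index w = \<infinity>"
proof -
  have "w \<in> reverse_hoelder r" if r: "1 < r" for r
  proof -
    have "average (ball z \<rho>) (\<lambda>x. ennreal (w x powr r)) = 0" for z :: "real ^ 'n" and \<rho> :: real
    proof -
      have "(\<integral>\<^sup>+x\<in>ball z \<rho>. ennreal (w x powr r) \<partial>lebesgue) = (\<integral>\<^sup>+x. 0 \<partial>(lebesgue :: (real ^ 'n) measure))"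
        using w(2) by (intro nn_integral_cong_AE) (auto elim!: eventually_mono)
      then show ?thesis by (simp add: average_def)
    qed
    then show ?thesis
      using w(1) r by (auto simp: reverse_hoelder_def)
  qed
  then have "ereal r \<le> critical_index w" if "1 < r" for r
    unfolding critical_index_def using that by (intro Sup_upper) auto
  then have "ereal B \<le> critical_index w" for B
    by (metis ereal_less_eq(3) gt_ex le_cases less_le_trans order_trans)
  then show ?thesis
    by (metis ereal_top)
qed

text \<open>Tested on the indicator of the zero set of \<open>w\<close>, the A_\<xi> inequality has
  right side 0. On a ball of positive mass the zero set is therefore null.\<close>

lemma muckenhoupt_AE_pos:
  fixes w :: "real ^ 'n \<Rightarrow> real"
  assumes w: "w \<in> muckenhoupt \<xi>" and \<xi>: "1 \<le> \<xi>" and r: "critical_index w = ereal r"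
  shows "AE x in lebesgue. 0 < w x"
proof -
  have ww: "weight w" and [measurable]: "w \<in> borel_measurable lebesgue"
    using w by (auto intro: muckenhoupt_weight weight_measurable)
  have "\<not> (AE x in lebesgue. w x = 0)"
    using critical_index_weight_zero[OF ww] r by auto
  have UN: "(\<Union>k::nat. dyadic_ball (int k)) = (UNIV :: (real ^ 'n) set)"
  proof -
    have "\<exists>k::nat. norm x \<le> 2 powi int k" for x :: "real ^ 'n"
    proof -
      obtain k :: nat where "norm x \<le> real k"
        using real_arch_simple by blast
      also have "real k \<le> 2 powi int k"
        using of_nat_less_two_power[of k, where 'a=real] by simp
      finally show ?thesis by blast
    qed
    then show ?thesis by (auto simp: dyadic_ball_def)
  qed
  have ex: "\<exists>k0::nat. wmeasure w (dyadic_ball (int k0)) \<noteq> 0"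
  proof (rule ccontr)
    assume "\<not> ?thesis"
    then have "AE x in lebesgue. ennreal (w x) * indicator (dyadic_ball (int k)) x = 0" for k :: nat
      by (simp add: wmeasure_def nn_integral_0_iff_AE)
    then have "AE x in lebesgue. \<forall>k::nat. ennreal (w x) * indicator (dyadic_ball (int k)) x = 0"
      by (subst AE_all_countable) blast
    then have "AE x in lebesgue. w x = 0"
    proof eventually_elim
      case (elim x)
      obtain k :: nat where "x \<in> dyadic_ball (int k)"
        using UN by blast
      with elim[rule_format, of k] show ?case
        using weight_nonneg[OF ww, of x] by (simp add: ennreal_eq_0_iff)
    qed
    with \<open>\<not> (AE x in lebesgue. w x = 0)\<close> show False ..
  qed
  then obtain k0 :: nat where k0: "wmeasure w (dyadic_ball (int k0)) \<noteq> 0" ..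
  obtain C where C: "0 < C" "\<And>k h. h \<in> borel_measurable lebesgue \<Longrightarrow>
    dyadic_muckenhoupt_ineq w \<xi> C k h"
    using muckenhoupt_dyadic[OF w \<xi>] by blast
  \<comment> \<open>The mass of the ball has to be cancelled. One ball with mass exists, all larger
    ones inherit it, and they still exhaust the space.\<close>
  have "AE x in lebesgue. x \<in> dyadic_ball (int k) \<longrightarrow> 0 < w x" if "k0 \<le> k" for k
  proof -
    define h :: "real ^ 'n \<Rightarrow> ennreal" where "h x = (if w x = 0 then 1 else 0)" for x
    have [measurable]: "h \<in> borel_measurable lebesgue"
      unfolding h_def by measurable
    have "wmeasure w (dyadic_ball (int k0)) \<le> wmeasure w (dyadic_ball (int k))"
      unfolding wmeasure_def using dyadic_ball_mono[of "int k0" "int k"] that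
      by (intro nn_integral_mono) (auto simp: indicator_def)
    then have ne: "wmeasure w (dyadic_ball (int k)) \<noteq> 0"
      using k0 by (metis le_zero_eq)
    have "ennpowr (h x) \<xi> * ennreal (w x) = 0" for x
      using \<xi> by (auto simp: h_def)
    then have "ennpowr (\<integral>\<^sup>+x\<in>dyadic_ball (int k). h x \<partial>lebesgue) \<xi> * wmeasure w (dyadic_ball (int k)) \<le> 0"
      using C(2)[of h "int k"] by (simp only: \<open>h \<in> borel_measurable lebesgue\<close>) simp
    then have "(\<integral>\<^sup>+x\<in>dyadic_ball (int k). h x \<partial>lebesgue) = 0"
      using ne \<xi> by (simp add: ennpowr_eq_0_iff)
    then have "AE x in lebesgue. h x * indicator (dyadic_ball (int k)) x = 0"
      by (subst (asm) nn_integral_0_iff_AE) measurable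
    then show ?thesis
      by eventually_elim (use weight_nonneg[OF ww] in \<open>auto simp: h_def less_le split: if_splits\<close>)
  qed
  then have "AE x in lebesgue. \<forall>k::nat. k0 \<le> k \<longrightarrow> x \<in> dyadic_ball (int k) \<longrightarrow> 0 < w x"
    by (simp add: AE_all_countable)
  then show ?thesis
  proof eventually_elim
    case (elim x)
    obtain k :: nat where "x \<in> dyadic_ball (int k)"
      using UN by blast
    then have "x \<in> dyadic_ball (int (max k k0))"
      using dyadic_ball_mono[of "int k" "int (max k k0)"] by auto
    then show ?case using elim by (meson max.cobounded2)
  qed
qed

section \<open>Growth of the masses of dyadic balls, as real numbers\<close>

definition dyadic_mass :: "(real ^ 'n \<Rightarrow> real) \<Rightarrow> int \<Rightarrow> real" where
  "dyadic_mass w k = enn2real (wmeasure w (dyadic_ball k))"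

lemma wmeasure_dyadic_ball:
  assumes "weight w"
  shows "wmeasure w (dyadic_ball k) = ennreal (dyadic_mass w k)"
  using wmeasure_compact_finite[OF assms, of "dyadic_ball k"]
  by (simp add: dyadic_mass_def dyadic_ball_eq_cball)

lemma dyadic_mass_pos:
  fixes w :: "real ^ 'n \<Rightarrow> real"
  assumes w: "w \<in> muckenhoupt \<xi>" and \<xi>: "1 \<le> \<xi>" and r: "critical_index w = ereal r"
  shows "0 < dyadic_mass w k"
proof -
  have ww: "weight w" and [measurable]: "w \<in> borel_measurable lebesgue"
    using w by (auto intro: muckenhoupt_weight weight_measurable)
  have "wmeasure w (dyadic_ball k) \<noteq> 0"
  proof
    assume "wmeasure w (dyadic_ball k) = 0"
    then have "AE x in lebesgue. ennreal (w x) * indicator (dyadic_ball k) x = 0"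
      by (simp add: wmeasure_def nn_integral_0_iff_AE)
    with muckenhoupt_AE_pos[OF assms] have "AE x :: real ^ 'n in lebesgue. x \<notin> dyadic_ball k"
      by eventually_elim (auto simp: indicator_def split: if_splits)
    then have "dyadic_ball k \<in> null_sets (lebesgue :: (real ^ 'n) measure)"
      by (subst AE_iff_null_sets) auto
    moreover have "0 < unit_ball_vol (real CARD('n)) * 2 powr (of_int k * real CARD('n))"
      by (intro mult_pos_pos) simp_all
    ultimately show False
      using emeasure_dyadic_ball[of k, where 'n='n] by (metis ennreal_eq_0_iff not_le null_setsD1)
  qed
  then show ?thesis
    using wmeasure_dyadic_ball[OF ww, of k] by (metis ennreal_eq_0_iff not_le)
qed

text \<open>The A_\<xi> inequality on the larger ball, tested on the indicator of the smaller
  one.\<close>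

lemma dyadic_mass_growth_upper:
  fixes w :: "real ^ 'n \<Rightarrow> real"
  assumes w: "w \<in> muckenhoupt \<xi>" and \<xi>: "1 \<le> \<xi>"
  obtains C where "0 < C" "\<And>j k. j \<le> k \<Longrightarrow>
    dyadic_mass w k \<le> C * (2 powr of_int (k - j)) powr (real CARD('n) * \<xi>) * dyadic_mass w j"
proof -
  have ww: "weight w" and [measurable]: "w \<in> borel_measurable lebesgue"
    using w by (auto intro: muckenhoupt_weight weight_measurable)
  obtain C where C: "0 < C" "\<And>k h. h \<in> borel_measurable lebesgue \<Longrightarrow>
    dyadic_muckenhoupt_ineq w \<xi> C k h"
    using muckenhoupt_dyadic[OF w \<xi>] by blast
  define u where "u = unit_ball_vol (real CARD('n))"
  have u: "0 < u" by (simp add: u_def)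
  let ?n = "real CARD('n)"
  show ?thesis
  proof (rule that[of "C * u powr (- \<xi>)"])
    fix j k :: int assume jk: "j \<le> k"
    let ?h = "indicator (dyadic_ball j) :: real ^ 'n \<Rightarrow> ennreal"
    have ind: "?h x * indicator (dyadic_ball k) x = ?h x" "ennpowr (?h x) \<xi> = ?h x" for x
      using dyadic_ball_mono[OF jk] \<xi> by (auto simp: indicator_def)
    have "(\<integral>\<^sup>+x\<in>dyadic_ball k. ?h x \<partial>lebesgue) = ennreal (u * 2 powr (of_int j * ?n))"
      by (simp add: ind emeasure_dyadic_ball u_def)
    moreover have "(\<integral>\<^sup>+x\<in>dyadic_ball k. ennpowr (?h x) \<xi> * ennreal (w x) \<partial>lebesgue) = wmeasure w (dyadic_ball j)"
      unfolding wmeasure_def ind using ind by (intro nn_integral_cong) (simp add: mult_ac)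
    ultimately have "ennreal ((u * 2 powr (of_int j * ?n)) powr \<xi>) * ennreal (dyadic_mass w k)
        \<le> ennreal (C * 2 powr (of_int k * ?n * \<xi>)) * ennreal (dyadic_mass w j)"
      using C(2)[of ?h k] u by (simp add: ennpowr_ennreal wmeasure_dyadic_ball[OF ww])
    then have "(u * 2 powr (of_int j * ?n)) powr \<xi> * dyadic_mass w k
        \<le> C * 2 powr (of_int k * ?n * \<xi>) * dyadic_mass w j"
      using C(1) by (simp add: dyadic_mass_def flip: ennreal_mult)
    then have "u powr \<xi> * 2 powr (of_int j * ?n * \<xi>) * dyadic_mass w k
        \<le> C * 2 powr (of_int k * ?n * \<xi>) * dyadic_mass w j"
      using u by (simp add: powr_mult powr_powr)
    then have "dyadic_mass w k \<le> C * 2 powr (of_int k * ?n * \<xi>) * dyadic_mass w j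
        / (u powr \<xi> * 2 powr (of_int j * ?n * \<xi>))"
      using u by (simp add: field_simps)
    also have "\<dots> = C * u powr (- \<xi>) * (2 powr (of_int k * ?n * \<xi>) / 2 powr (of_int j * ?n * \<xi>)) * dyadic_mass w j"
      by (simp add: powr_minus divide_inverse mult_ac)
    also have "2 powr (of_int k * ?n * \<xi>) / 2 powr (of_int j * ?n * \<xi>)
        = (2 powr of_int (k - j)) powr (real CARD('n) * \<xi>)"
      by (simp add: powr_powr left_diff_distrib mult.assoc flip: powr_diff)
    finally show "dyadic_mass w k \<le> C * u powr (- \<xi>) * (2 powr of_int (k - j)) powr (?n * \<xi>) * dyadic_mass w j" .
  qed (use C(1) u in simp)
qed

lemma critical_index_reverse_hoelder:
  assumes "ereal s < critical_index w" "1 \<le> s"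
  obtains r where "s < r" "1 < r" "w \<in> reverse_hoelder r"
  using assms unfolding critical_index_def less_Sup_iff by auto

text \<open>The dual reverse Hoelder inequality, tested on the same indicator. As \<delta> lies
  strictly below the critical index, some order \<open>r > \<delta>\<close> is available, and \<tau>
  = 1 - 1/\<delta> is admissible for it.\<close>

lemma dyadic_mass_growth_lower:
  fixes w :: "real ^ 'n \<Rightarrow> real"
  assumes w: "weight w" and \<delta>: "1 < \<delta>" "ereal \<delta> < critical_index w"
  obtains C where "0 < C" "\<And>j k. j \<le> k \<Longrightarrow>
    dyadic_mass w j \<le> C * (2 powr of_int (j - k)) powr (real CARD('n) * ((\<delta> - 1) / \<delta>)) * dyadic_mass w k"
proof -
  have [measurable]: "w \<in> borel_measurable lebesgue"
    using w by (rule weight_measurable)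
  obtain r where r: "\<delta> < r" "1 < r" "w \<in> reverse_hoelder r"
    using critical_index_reverse_hoelder[of \<delta> w] \<delta> by auto
  define \<tau> where "\<tau> = (\<delta> - 1) / \<delta>"
  have \<tau>: "0 < \<tau>" "\<tau> \<le> 1 - 1 / r"
    using \<delta>(1) r by (auto simp: \<tau>_def field_simps)
  obtain C where C: "0 < C" "\<And>k g. g \<in> borel_measurable lebesgue \<Longrightarrow>
    dyadic_reverse_hoelder_ineq w \<tau> C k g"
    using reverse_hoelder_dyadic[OF r(3,2) \<tau>] by blast
  define u where "u = unit_ball_vol (real CARD('n))"
  have u: "0 < u" by (simp add: u_def)
  let ?n = "real CARD('n)"
  show ?thesis
  proof (rule that[of "C * u powr \<tau>"])
    fix j k :: int assume jk: "j \<le> k"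
    let ?h = "indicator (dyadic_ball j) :: real ^ 'n \<Rightarrow> ennreal"
    have ind: "?h x * indicator (dyadic_ball k) x = ?h x" "ennpowr (?h x) (1 / \<tau>) = ?h x" for x
      using dyadic_ball_mono[OF jk] \<tau> by (auto simp: indicator_def)
    have "(\<integral>\<^sup>+x\<in>dyadic_ball k. ennpowr (?h x) (1 / \<tau>) \<partial>lebesgue) = ennreal (u * 2 powr (of_int j * ?n))"
      by (simp add: ind emeasure_dyadic_ball u_def)
    moreover have "(\<integral>\<^sup>+x\<in>dyadic_ball k. ?h x * ennreal (w x) \<partial>lebesgue) = wmeasure w (dyadic_ball j)"
      unfolding wmeasure_def using ind by (intro nn_integral_cong) (simp add: mult_ac)
    ultimately have "ennreal (2 powr (of_int k * ?n * \<tau>)) * ennreal (dyadic_mass w j)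
        \<le> ennreal C * ennreal ((u * 2 powr (of_int j * ?n)) powr \<tau>) * ennreal (dyadic_mass w k)"
      using C(2)[of ?h k] u by (simp add: ennpowr_ennreal wmeasure_dyadic_ball[OF w])
    then have "2 powr (of_int k * ?n * \<tau>) * dyadic_mass w j
        \<le> C * (u * 2 powr (of_int j * ?n)) powr \<tau> * dyadic_mass w k"
      using C(1) by (simp add: dyadic_mass_def flip: ennreal_mult)
    then have "2 powr (of_int k * ?n * \<tau>) * dyadic_mass w j
        \<le> C * u powr \<tau> * 2 powr (of_int j * ?n * \<tau>) * dyadic_mass w k"
      using u by (simp add: powr_mult powr_powr mult.assoc)
    then have "dyadic_mass w j \<le> C * u powr \<tau> * 2 powr (of_int j * ?n * \<tau>) * dyadic_mass w k
        / 2 powr (of_int k * ?n * \<tau>)"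
      by (simp add: field_simps)
    also have "\<dots> = C * u powr \<tau> * (2 powr (of_int j * ?n * \<tau>) / 2 powr (of_int k * ?n * \<tau>)) * dyadic_mass w k"
      by simp
    also have "2 powr (of_int j * ?n * \<tau>) / 2 powr (of_int k * ?n * \<tau>)
        = (2 powr of_int (j - k)) powr (real CARD('n) * \<tau>)"
      by (simp add: powr_powr left_diff_distrib mult.assoc flip: powr_diff)
    finally show "dyadic_mass w j \<le> C * u powr \<tau>
        * (2 powr of_int (j - k)) powr (?n * ((\<delta> - 1) / \<delta>)) * dyadic_mass w k"
      by (simp add: \<tau>_def)
  qed (use C(1) u in simp)
qed

text \<open>In the application \<open>t\<close> is a matrix norm and 2^l the dyadic number next to
  it. Whether \<open>t < 1\<close> fixes the sign of \<open>l\<close>, hence which ball is the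
  larger one and which of the two growth bounds governs the ratio.\<close>

lemma dyadic_mass_ratio_powr:
  fixes w :: "real ^ 'n \<Rightarrow> real"
  assumes w: "w \<in> muckenhoupt \<xi>" and \<xi>: "1 \<le> \<xi>" and r: "critical_index w = ereal r"
    and \<delta>: "1 < \<delta>" "\<delta> < r" and s: "0 \<le> s"
  defines "\<theta> \<equiv> (\<delta> - 1) / \<delta>" and "n \<equiv> real CARD('n)"
  obtains C where "0 < C"
    and "\<And>k l t. 0 < t \<Longrightarrow> t \<le> 2 powr of_int l \<Longrightarrow> 2 powr of_int l \<le> 2 * t \<Longrightarrow>
      (dyadic_mass w k / dyadic_mass w (k + l)) powr s
        \<le> C * (if t < 1 then t powr (- (n * \<xi> * s)) else t powr (- (n * \<theta> * s)))"
    and "\<And>k l t. 0 < t \<Longrightarrow> t \<le> 2 powr of_int l \<Longrightarrow> 2 powr of_int l \<le> 2 * t \<Longrightarrow>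
      (dyadic_mass w (k + l) / dyadic_mass w k) powr s
        \<le> C * (if t < 1 then t powr (n * \<theta> * s) else t powr (n * \<xi> * s))"
proof -
  have ww: "weight w" using w by (rule muckenhoupt_weight)
  have pos: "0 < dyadic_mass w k" for k
    using dyadic_mass_pos[OF w \<xi> r] .
  have \<theta>: "0 < \<theta>" using \<delta> by (simp add: \<theta>_def)
  have n: "0 < n" by (simp add: n_def)
  obtain C1 where C1: "0 < C1" "\<And>j k. j \<le> k \<Longrightarrow>
    dyadic_mass w k \<le> C1 * (2 powr of_int (k - j)) powr (n * \<xi>) * dyadic_mass w j"
    using dyadic_mass_growth_upper[OF w \<xi>] unfolding n_def by blast
  obtain C2 where C2: "0 < C2" "\<And>j k. j \<le> k \<Longrightarrow>
    dyadic_mass w j \<le> C2 * (2 powr of_int (j - k)) powr (n * \<theta>) * dyadic_mass w k"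
    using dyadic_mass_growth_lower[OF ww \<delta>(1)] r \<delta>(2) unfolding n_def \<theta>_def by auto
  \<comment> \<open>The four summands cover the four uses of \<open>key\<close>: negative powers of
    2^l are bounded through \<open>t <= 2^l\<close> without loss (\<open>inv\<close>), positive ones
    through \<open>2^l <= 2 t\<close> at the price of a power of 2 (\<open>dbl\<close>).\<close>
  define C where "C = C1 powr s * 2 powr (n * \<xi> * s) + C2 powr s * 2 powr (n * \<theta> * s) + C1 powr s + C2 powr s"
  have Cs: "C1 powr s \<le> C" "C2 powr s \<le> C" "C1 powr s * 2 powr (n * \<xi> * s) \<le> C" "C2 powr s * 2 powr (n * \<theta> * s) \<le> C"
    by (simp_all add: C_def)
  have key: "(dyadic_mass w a / dyadic_mass w b) powr s \<le> C * t powr (e * s)"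
    if "dyadic_mass w a \<le> D * x powr e' * dyadic_mass w b" "0 < D" "0 < x" "0 < t"
      "x powr e' \<le> E * t powr e" "0 < E" "D powr s * E powr s \<le> C" for a b D x e' t E e
  proof -
    have "dyadic_mass w a / dyadic_mass w b \<le> D * x powr e'"
      using that(1) pos[of b] by (simp add: field_simps)
    also have "\<dots> \<le> D * (E * t powr e)"
      using that by (intro mult_left_mono) auto
    finally have "(dyadic_mass w a / dyadic_mass w b) powr s \<le> (D * (E * t powr e)) powr s"
      using pos[of a] pos[of b] s by (intro powr_mono2) auto
    also have "\<dots> = D powr s * E powr s * t powr (e * s)"
      using that by (simp add: powr_mult powr_powr mult.assoc)
    also have "\<dots> \<le> C * t powr (e * s)"
      using that by (intro mult_right_mono) auto
    finally show ?thesis .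
  qed
  \<comment> \<open>From 2^l <= 2 t < 2 one gets l < 1. The value l = 0 remains possible, and the
    growth bounds allow equal balls.\<close>
  have l_neg: "l \<le> 0" if "t < 1" "2 powr of_int l \<le> 2 * t" for l :: int and t :: real
  proof -
    have "(2::real) powr of_int l < 2 powr 1"
      using that by simp
    then have "real_of_int l < 1"
      by (subst (asm) powr_less_cancel_iff) auto
    then show ?thesis by linarith
  qed
  have l_pos: "0 \<le> l" if "\<not> t < 1" "t \<le> 2 powr of_int l" for l :: int and t :: real
  proof -
    have "(2::real) powr 0 \<le> 2 powr of_int l"
      using that by simp
    then have "0 \<le> real_of_int l"
      by (subst (asm) powr_le_cancel_iff) auto
    then show ?thesis by linarith
  qed
  have inv: "(2 powr of_int (- l)) powr e \<le> 1 * t powr (- e)"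
    if "0 < t" "t \<le> 2 powr of_int l" "0 \<le> e" for l :: int and t e :: real
  proof -
    have "(2 powr of_int (- l)) powr e = (2 powr of_int l) powr (- e)"
      by (simp add: powr_powr)
    also have "\<dots> \<le> t powr (- e)"
      using that by (intro powr_mono2') auto
    finally show ?thesis by simp
  qed
  have dbl: "(2 powr of_int l) powr e \<le> 2 powr e * t powr e"
    if "0 < t" "2 powr of_int l \<le> 2 * t" "0 \<le> e" for l :: int and t e :: real
    using that powr_mono2[of e "2 powr of_int l" "2 * t"] by (simp add: powr_mult)
  show ?thesis
  proof (rule that[of C])
    show "0 < C"
      using C1(1) C2(1) by (simp add: C_def add_pos_pos)
  next
    fix k l :: int and t :: real
    assume t: "0 < t" "t \<le> 2 powr of_int l" "2 powr of_int l \<le> 2 * t"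
    show "(dyadic_mass w k / dyadic_mass w (k + l)) powr s
        \<le> C * (if t < 1 then t powr (- (n * \<xi> * s)) else t powr (- (n * \<theta> * s)))"
    proof (cases "t < 1")
      case True
      have "(dyadic_mass w k / dyadic_mass w (k + l)) powr s \<le> C * t powr (- (n * \<xi>) * s)"
        using key[OF _ C1(1) _ t(1) inv[OF t(1,2), of "n * \<xi>"], of k "k + l"] C1(2)[of "k + l" k] l_neg[OF True t(3)] n \<xi> Cs
        by simp
      with True show ?thesis by simp
    next
      case False
      have "(dyadic_mass w k / dyadic_mass w (k + l)) powr s \<le> C * t powr (- (n * \<theta>) * s)"
        using key[OF _ C2(1) _ t(1) inv[OF t(1,2), of "n * \<theta>"], of k "k + l"] C2(2)[of k "k + l"] l_pos[OF False t(2)] n \<theta> Cs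
        by simp
      with False show ?thesis by simp
    qed
    show "(dyadic_mass w (k + l) / dyadic_mass w k) powr s
        \<le> C * (if t < 1 then t powr (n * \<theta> * s) else t powr (n * \<xi> * s))"
    proof (cases "t < 1")
      case True
      have "(dyadic_mass w (k + l) / dyadic_mass w k) powr s \<le> C * t powr (n * \<theta> * s)"
        using key[OF _ C2(1) _ t(1) dbl[OF t(1,3), of "n * \<theta>"], of "k + l" k] C2(2)[of "k + l" k] l_neg[OF True t(3)] n \<theta> Cs
        by (simp add: powr_powr)
      with True show ?thesis by simp
    next
      case False
      have "(dyadic_mass w (k + l) / dyadic_mass w k) powr s \<le> C * t powr (n * \<xi> * s)"
        using key[OF _ C1(1) _ t(1) dbl[OF t(1,3), of "n * \<xi>"], of "k + l" k] C1(2)[of k "k + l"] l_pos[OF False t(2)] n \<xi> Cs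
        by (simp add: powr_powr)
      with False show ?thesis by simp
    qed
  qed
qed

subsection \<open>Estimates on dyadic balls\<close>

lemma ennreal_mult_le_imp_le_divide:
  assumes a: "0 < a" and le: "ennreal a * x \<le> y"
  shows "x \<le> ennreal (1 / a) * y"
proof -
  have "x = ennreal (1 / a) * (ennreal a * x)"
    using a by (simp add: mult.assoc[symmetric] flip: ennreal_mult)
  also have "\<dots> \<le> ennreal (1 / a) * y"
    using le by (intro mult_left_mono) auto
  finally show ?thesis .
qed

lemma prod_mult_ennreal:
  assumes "\<And>i. i \<in> I \<Longrightarrow> 0 \<le> a i"
  shows "(\<Prod>i\<in>I. ennreal (a i) * b i) = ennreal (\<Prod>i\<in>I. a i) * (\<Prod>i\<in>I. b i)"
  using assms by (simp add: prod.distrib prod_ennreal)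

lemma dyadic_image_subset:
  fixes A :: "real ^ 'n ^ 'n"
  assumes "norm A \<le> 2 powr of_int l" "x \<in> dyadic_ball k"
  shows "A *v x \<in> dyadic_ball (k + l)"
proof -
  have "norm (A *v x) \<le> norm A * norm x"
    by (rule norm_matrix_vector_mult_le)
  also have "\<dots> \<le> 2 powr of_int l * 2 powr of_int k"
    using assms by (intro mult_mono) (auto simp: dyadic_ball_def two_powi_eq_powr)
  finally show ?thesis
    by (simp add: dyadic_ball_def two_powi_eq_powr powr_add mult.commute)
qed

lemma borel_measurable_matrix_vector_mult [measurable (raw)]:
  fixes A :: "'a \<Rightarrow> real ^ 'n ^ 'k" and x :: "'a \<Rightarrow> real ^ 'n"
  assumes "A \<in> borel_measurable M" "x \<in> borel_measurable M"
  shows "(\<lambda>z. A z *v x z) \<in> borel_measurable M"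
proof -
  have "continuous_on UNIV (\<lambda>z :: (real ^ 'n ^ 'k) \<times> (real ^ 'n). fst z *v snd z)"
    unfolding matrix_vector_mult_def by (intro continuous_intros)
  with assms show ?thesis
    by (rule borel_measurable_continuous_Pair)
qed

text \<open>The image of the ball is an ellipsoid inside the larger ball; after the substitution the
  integral is enlarged from the one to the other.\<close>

lemma nn_integral_dyadic_linear_le:
  fixes A :: "real ^ 'n ^ 'n" and h :: "real ^ 'n \<Rightarrow> ennreal"
  assumes A: "det A \<noteq> 0" "norm A \<le> 2 powr of_int l" and h [measurable]: "h \<in> borel_measurable borel"
  shows "(\<integral>\<^sup>+x\<in>dyadic_ball k. h (A *v x) \<partial>lebesgue)
    \<le> ennreal \<bar>det (matrix_inv A)\<bar> * (\<integral>\<^sup>+x\<in>dyadic_ball (k + l). h x \<partial>lebesgue)"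
proof -
  have [measurable]: "dyadic_ball j \<in> sets (borel :: (real ^ 'n) measure)" for j
    by (simp add: dyadic_ball_eq_cball)
  define g where "g x = h x * indicator (dyadic_ball (k + l)) x" for x
  have [measurable]: "g \<in> borel_measurable borel"
    unfolding g_def by measurable
  have "(\<integral>\<^sup>+x\<in>dyadic_ball k. h (A *v x) \<partial>lebesgue) \<le> (\<integral>\<^sup>+x. g (A *v x) \<partial>lebesgue)"
    using dyadic_image_subset[OF A(2)] by (intro nn_integral_mono) (auto simp: g_def indicator_def)
  also have "\<dots> = (\<integral>\<^sup>+x. g (A *v x) \<partial>lborel)"
    by (simp add: nn_integral_completion)
  also have "\<dots> = ennreal \<bar>det (matrix_inv A)\<bar> * (\<integral>\<^sup>+x. g x \<partial>lborel)"
    using A(1) by (rule nn_integral_lborel_matrix) measurable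
  also have "(\<integral>\<^sup>+x. g x \<partial>lborel) = (\<integral>\<^sup>+x. g x \<partial>lebesgue)"
    by (simp add: nn_integral_completion)
  finally show ?thesis by (simp add: g_def)
qed

text \<open>The exponent \<tau> = qs \<xi> / q is chosen so that, once the weight is removed, the
  product carries the power q/\<xi>. Hoelder with weights \<open>q / qq i\<close> then produces the
  powers \<open>qq i / \<xi>\<close>, exactly those which the A_\<xi> inequality converts into
  weighted integrals of order \<open>qq i\<close>.\<close>

lemma dyadic_product_estimate:
  fixes w :: "real ^ 'n \<Rightarrow> real" and A :: "nat \<Rightarrow> real ^ 'n ^ 'n" and g :: "nat \<Rightarrow> real ^ 'n \<Rightarrow> ennreal"
    and l :: "nat \<Rightarrow> int"
  defines "n \<equiv> real CARD('n)"
  assumes I: "finite I" "I \<noteq> {}"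
    and q: "0 < q" "\<And>i. i \<in> I \<Longrightarrow> 0 < qq i" "(\<Sum>i\<in>I. 1 / qq i) = 1 / q" and qs: "0 < qs" and \<xi>: "1 \<le> \<xi>"
    and w: "weight w" and W: "\<And>k. 0 < dyadic_mass w k"
    and CR: "0 < CR" "\<And>k g. g \<in> borel_measurable lebesgue \<Longrightarrow>
      dyadic_reverse_hoelder_ineq w (qs * \<xi> / q) CR k g"
    and CA: "0 < CA" "\<And>k h. h \<in> borel_measurable lebesgue \<Longrightarrow>
      dyadic_muckenhoupt_ineq w \<xi> CA k h"
    and A: "\<And>i. i \<in> I \<Longrightarrow> det (A i) \<noteq> 0" "\<And>i. i \<in> I \<Longrightarrow> norm (A i) \<le> 2 powr of_int (l i)"
      "\<And>i. i \<in> I \<Longrightarrow> 2 powr of_int (l i) \<le> 2 * norm (A i)"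
    and g: "\<And>i. i \<in> I \<Longrightarrow> g i \<in> borel_measurable borel"
  shows "ennpowr (\<integral>\<^sup>+x\<in>dyadic_ball k. (\<Prod>i\<in>I. ennpowr (g i (A i *v x)) qs) * ennreal (w x) \<partial>lebesgue) (1 / qs)
    \<le> ennreal ((CR * dyadic_mass w k) powr (1 / qs)) *
      (\<Prod>i\<in>I. ennreal (CA powr (1 / qq i) * 2 powr (n * \<xi> / qq i)
          * (\<bar>det (matrix_inv (A i))\<bar> powr (\<xi> / qq i) * norm (A i) powr (\<xi> * n / qq i))
          * dyadic_mass w (k + l i) powr (- 1 / qq i))
        * ennpowr (\<integral>\<^sup>+x\<in>dyadic_ball (k + l i). ennpowr (g i x) (qq i) * ennreal (w x) \<partial>lebesgue) (1 / qq i))"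
proof -
  note CR = CR[folded n_def] and CA = CA[folded n_def]
  define \<tau> where "\<tau> = qs * \<xi> / q"
  have \<tau>: "0 < \<tau>" using q(1) qs \<xi> by (simp add: \<tau>_def)
  define B :: "(real ^ 'n) set" where "B = dyadic_ball k"
  have [measurable]: "B \<in> sets lebesgue" by (simp add: B_def)
  define H where "H x = (\<Prod>i\<in>I. ennpowr (g i (A i *v x)) qs)" for x
  have gA [measurable]: "(\<lambda>x. g i (A i *v x)) \<in> borel_measurable lebesgue" if "i \<in> I" for i
  proof -
    note [measurable] = g[OF that]
    have "(\<lambda>x. g i (A i *v x)) \<in> borel_measurable borel"
      by measurable
    then show ?thesis
      by (intro measurable_completion) simp
  qed
  have [measurable]: "H \<in> borel_measurable lebesgue"
    unfolding H_def by (intro borel_measurable_prod_ennreal borel_measurable_ennpowr gA)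
  define D where "D i = \<bar>det (matrix_inv (A i))\<bar>" for i
  define J where "J i = (\<integral>\<^sup>+x\<in>dyadic_ball (k + l i). ennpowr (g i x) (qq i / \<xi>) \<partial>lebesgue)" for i
  define F where "F i = (\<integral>\<^sup>+x\<in>dyadic_ball (k + l i). ennpowr (g i x) (qq i) * ennreal (w x) \<partial>lebesgue)" for i
  define W where "W = dyadic_mass w"
  have W: "0 < W k" for k using assms by (simp add: W_def)

  \<comment> \<open>The A_\<xi> inequality on the larger ball for \<open>g i\<close> to the power
    \<open>qq i / \<xi>\<close>, followed by a root of order \<open>qq i\<close>.\<close>
  have J_le: "ennpowr (ennreal (D i) * J i) (\<xi> / qq i)
      \<le> ennreal (D i powr (\<xi> / qq i) * (CA powr (1 / qq i) * 2 powr (of_int (k + l i) * n * \<xi> / qq i)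
          * W (k + l i) powr (- 1 / qq i))) * ennpowr (F i) (1 / qq i)" if i: "i \<in> I" for i
  proof -
    have [measurable]: "g i \<in> borel_measurable lebesgue"
      using g[OF i] by (intro measurable_completion) simp
    have 0: "0 < qq i" "0 < \<xi>" using q i \<xi> by auto
    have "ennpowr (J i) \<xi> * ennreal (W (k + l i)) \<le> ennreal (CA * 2 powr (of_int (k + l i) * n * \<xi>)) * F i"
      using CA(2)[of "\<lambda>x. ennpowr (g i x) (qq i / \<xi>)" "k + l i"] 0
      by (simp add: J_def F_def W_def wmeasure_dyadic_ball[OF w] ennpowr_ennpowr)
    then have "ennpowr (J i) \<xi> \<le> ennreal (1 / W (k + l i)) * (ennreal (CA * 2 powr (of_int (k + l i) * n * \<xi>)) * F i)"
      by (intro ennreal_mult_le_imp_le_divide W) (simp add: mult.commute)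
    also have "\<dots> = ennreal (CA * 2 powr (of_int (k + l i) * n * \<xi>) / W (k + l i)) * F i"
      using CA(1) W[of "k + l i"] by (simp add: mult.assoc[symmetric] flip: ennreal_mult)
    finally have "ennpowr (ennpowr (J i) \<xi>) (1 / qq i) \<le> ennpowr \<dots> (1 / qq i)"
      using 0 by (intro ennpowr_mono) auto
    also have "\<dots> = ennreal ((CA * 2 powr (of_int (k + l i) * n * \<xi>) / W (k + l i)) powr (1 / qq i)) * ennpowr (F i) (1 / qq i)"
      using 0 CA(1) W[of "k + l i"] by (simp add: ennpowr_mult ennpowr_ennreal)
    also have "(CA * 2 powr (of_int (k + l i) * n * \<xi>) / W (k + l i)) powr (1 / qq i)
        = CA powr (1 / qq i) * 2 powr (of_int (k + l i) * n * \<xi> / qq i) * W (k + l i) powr (- 1 / qq i)"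
      using CA(1) W[of "k + l i"] by (simp add: powr_mult powr_powr powr_minus divide_inverse inverse_powr)
    finally have "ennpowr (J i) (\<xi> / qq i)
      \<le> ennreal (CA powr (1 / qq i) * 2 powr (of_int (k + l i) * n * \<xi> / qq i) * W (k + l i) powr (- 1 / qq i)) * ennpowr (F i) (1 / qq i)"
      by (simp add: ennpowr_ennpowr)
    then have "ennreal (D i powr (\<xi> / qq i)) * ennpowr (J i) (\<xi> / qq i) \<le> ennreal (D i powr (\<xi> / qq i)) * \<dots>"
      by (intro mult_left_mono) auto
    then show ?thesis
      using 0 by (simp add: ennpowr_mult ennpowr_ennreal_nonneg D_def ennreal_mult' mult.assoc)
  qed

  have hoelder: "(\<integral>\<^sup>+x\<in>B. ennpowr (H x) (1 / \<tau>) \<partial>lebesgue) \<le> (\<Prod>i\<in>I. ennpowr (ennreal (D i) * J i) (q / qq i))"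
  proof -
    have "(\<integral>\<^sup>+x\<in>B. ennpowr (H x) (1 / \<tau>) \<partial>lebesgue)
        = (\<integral>\<^sup>+x. (\<Prod>i\<in>I. ennpowr (ennpowr (g i (A i *v x)) (qq i / \<xi>) * indicator B x) (q / qq i)) \<partial>lebesgue)"
    proof (intro nn_integral_cong)
      fix x
      show "ennpowr (H x) (1 / \<tau>) * indicator B x
        = (\<Prod>i\<in>I. ennpowr (ennpowr (g i (A i *v x)) (qq i / \<xi>) * indicator B x) (q / qq i))"
      proof (cases "x \<in> B")
        case True
        have "qs * (1 / \<tau>) = q / \<xi>"
          using qs by (simp add: \<tau>_def)
        moreover have "qq i / \<xi> * (q / qq i) = q / \<xi>" if "i \<in> I" for i
          using q(2)[OF that] by simp
        ultimately show ?thesis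
          using True \<tau> by (auto simp: H_def ennpowr_prod ennpowr_ennpowr simp del: times_divide_eq_right times_divide_eq_left intro!: prod.cong)
      next
        case False
        \<comment> \<open>Off the ball both sides are 0; on the right this takes an actual factor,
          since an empty product would be 1.\<close>
        obtain i where i: "i \<in> I" using I by blast
        have "(\<Prod>i\<in>I. ennpowr (ennpowr (g i (A i *v x)) (qq i / \<xi>) * indicator B x) (q / qq i)) = 0"
          using False i q(1) q(2)[OF i] I by (intro prod_zero bexI[of _ i]) auto
        then show ?thesis using False by simp
      qed
    qed
    also have "\<dots> \<le> (\<Prod>i\<in>I. ennpowr (\<integral>\<^sup>+x. ennpowr (g i (A i *v x)) (qq i / \<xi>) * indicator B x \<partial>lebesgue) (q / qq i))"
    proof (rule nn_integral_prod_ennpowr_le[OF I(1)])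
      show "(\<Sum>i\<in>I. q / qq i) = 1"
        using q(1,3) sum_distrib_left[of q "\<lambda>i. 1 / qq i" I] by simp
      show "0 \<le> q / qq i" if "i \<in> I" for i
        using q(1) q(2)[OF that] by simp
      show "(\<lambda>x. ennpowr (g i (A i *v x)) (qq i / \<xi>) * indicator B x) \<in> borel_measurable lebesgue" if "i \<in> I" for i
        using gA[OF that] by measurable
    qed
    also have "\<dots> \<le> (\<Prod>i\<in>I. ennpowr (ennreal (D i) * J i) (q / qq i))"
    proof (rule prod_mono_ennreal)
      fix i assume i: "i \<in> I"
      have "(\<lambda>x. ennpowr (g i x) (qq i / \<xi>)) \<in> borel_measurable borel"
        using g[OF i] by measurable
      from nn_integral_dyadic_linear_le[OF A(1)[OF i] A(2)[OF i] this, of k]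
      show "ennpowr (\<integral>\<^sup>+x. ennpowr (g i (A i *v x)) (qq i / \<xi>) * indicator B x \<partial>lebesgue) (q / qq i)
          \<le> ennpowr (ennreal (D i) * J i) (q / qq i)"
        unfolding D_def J_def B_def using q(1) q(2)[OF i] by (intro ennpowr_mono) auto
    qed
    finally show ?thesis .
  qed

  let ?p = "2 powr (of_int k * n * \<tau>)"
  have "ennreal ?p * (\<integral>\<^sup>+x\<in>B. H x * ennreal (w x) \<partial>lebesgue)
      \<le> ennreal CR * ennpowr (\<integral>\<^sup>+x\<in>B. ennpowr (H x) (1 / \<tau>) \<partial>lebesgue) \<tau> * ennreal (W k)"
    using CR(2)[of H k] by (simp add: \<tau>_def B_def W_def wmeasure_dyadic_ball[OF w])
  also have "\<dots> \<le> ennreal CR * ennpowr (\<Prod>i\<in>I. ennpowr (ennreal (D i) * J i) (q / qq i)) \<tau> * ennreal (W k)"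
    using hoelder \<tau> by (intro mult_right_mono mult_left_mono ennpowr_mono) auto
  finally have "(\<integral>\<^sup>+x\<in>B. H x * ennreal (w x) \<partial>lebesgue)
      \<le> ennreal (1 / ?p) * (ennreal CR * ennpowr (\<Prod>i\<in>I. ennpowr (ennreal (D i) * J i) (q / qq i)) \<tau> * ennreal (W k))"
    by (intro ennreal_mult_le_imp_le_divide) auto
  also have "\<dots> = ennreal (CR * W k / ?p) * ennpowr (\<Prod>i\<in>I. ennpowr (ennreal (D i) * J i) (q / qq i)) \<tau>"
  proof -
    have "ennreal (CR * W k / ?p) = ennreal (1 / ?p) * ennreal CR * ennreal (W k)"
      using CR(1) W[of k] by (simp flip: ennreal_mult)
    then show ?thesis by (simp add: mult_ac)
  qed
  finally have "ennpowr (\<integral>\<^sup>+x\<in>B. H x * ennreal (w x) \<partial>lebesgue) (1 / qs) \<le> ennpowr \<dots> (1 / qs)"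
    using qs by (intro ennpowr_mono) auto
  also have "\<dots> = ennreal ((CR * W k / ?p) powr (1 / qs))
      * (\<Prod>i\<in>I. ennpowr (ennreal (D i) * J i) (\<xi> / qq i))"
  proof -
    have "q / qq i * (\<tau> * (1 / qs)) = \<xi> / qq i" for i
      using q(1) qs by (simp add: \<tau>_def field_simps)
    then show ?thesis
      using CR(1) W[of k] qs \<tau> by (simp add: ennpowr_mult ennpowr_ennreal ennpowr_ennpowr ennpowr_prod mult.assoc
          del: times_divide_eq_right times_divide_eq_left)
  qed
  \<comment> \<open>The power 2^(-k n \<tau> / qs) is distributed over the factors, which is
    possible because \<tau>/qs = \<xi>/q is the sum of the \<open>\<xi> / qq i\<close>.\<close>
  also have "(CR * W k / ?p) powr (1 / qs) = (CR * W k) powr (1 / qs) * (\<Prod>i\<in>I. 2 powr (- (of_int k * n * \<xi> / qq i)))"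
  proof -
    have "(\<Prod>i\<in>I. 2 powr (- (of_int k * n * \<xi> / qq i))) = (2::real) powr (\<Sum>i\<in>I. - (of_int k * n * \<xi> / qq i))"
      using I(1) by (simp add: powr_sum)
    also have "(\<Sum>i\<in>I. - (of_int k * n * \<xi> / qq i)) = - (of_int k * n * \<xi>) * (\<Sum>i\<in>I. 1 / qq i)"
      by (simp add: sum_distrib_left)
    also have "\<dots> = - (of_int k * n * \<tau> * (1 / qs))"
      using qs q(1) unfolding q(3) by (simp add: \<tau>_def)
    also have "2 powr \<dots> = (?p powr (1 / qs)) powr (- 1)"
      by (simp only: powr_powr mult_minus1_right)
    finally show ?thesis
      using CR(1) W[of k] by (simp add: powr_mult powr_minus divide_inverse inverse_powr)
  qed
  also have "ennreal \<dots> * (\<Prod>i\<in>I. ennpowr (ennreal (D i) * J i) (\<xi> / qq i))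
      = ennreal ((CR * W k) powr (1 / qs)) *
        (\<Prod>i\<in>I. ennreal (2 powr (- (of_int k * n * \<xi> / qq i))) * ennpowr (ennreal (D i) * J i) (\<xi> / qq i))"
    by (simp add: ennreal_mult' prod_nonneg prod_mult_ennreal mult.assoc)
  also have "\<dots> \<le> ennreal ((CR * W k) powr (1 / qs)) *
      (\<Prod>i\<in>I. ennreal (CA powr (1 / qq i) * 2 powr (n * \<xi> / qq i)
          * (D i powr (\<xi> / qq i) * norm (A i) powr (\<xi> * n / qq i))
          * W (k + l i) powr (- 1 / qq i)) * ennpowr (F i) (1 / qq i))"
  proof (intro mult_left_mono prod_mono_ennreal)
    fix i assume i: "i \<in> I"
    have 0: "0 < qq i" "0 < \<xi>" "0 < n" using q i \<xi> by (auto simp: n_def)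
    have "ennreal (2 powr (- (of_int k * n * \<xi> / qq i))) * ennpowr (ennreal (D i) * J i) (\<xi> / qq i)
        \<le> ennreal (2 powr (- (of_int k * n * \<xi> / qq i)))
          * (ennreal (D i powr (\<xi> / qq i) * (CA powr (1 / qq i) * 2 powr (of_int (k + l i) * n * \<xi> / qq i)
          * W (k + l i) powr (- 1 / qq i))) * ennpowr (F i) (1 / qq i))"
      by (intro mult_left_mono J_le[OF i]) auto
    also have "\<dots> = ennreal (D i powr (\<xi> / qq i) * CA powr (1 / qq i) * W (k + l i) powr (- 1 / qq i)
        * (2 powr (- (of_int k * n * \<xi> / qq i)) * 2 powr (of_int (k + l i) * n * \<xi> / qq i))) * ennpowr (F i) (1 / qq i)"
      by (simp add: mult.assoc[symmetric] flip: ennreal_mult) (simp add: mult_ac)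
    also have "\<dots> \<le> ennreal (D i powr (\<xi> / qq i) * CA powr (1 / qq i) * W (k + l i) powr (- 1 / qq i)
        * (2 powr (n * \<xi> / qq i) * norm (A i) powr (n * \<xi> / qq i))) * ennpowr (F i) (1 / qq i)"
    proof (intro mult_right_mono ennreal_leI mult_left_mono)
      \<comment> \<open>The index \<open>k\<close> cancels. Only \<open>l i\<close> survives, and it
        becomes the matrix norm up to a factor 2.\<close>
      have "2 powr (- (of_int k * n * \<xi> / qq i)) * 2 powr (of_int (k + l i) * n * \<xi> / qq i) = (2 powr of_int (l i)) powr (n * \<xi> / qq i)"
        using 0 by (simp add: powr_powr field_simps flip: powr_add)
      also have "\<dots> \<le> (2 * norm (A i)) powr (n * \<xi> / qq i)"
        using 0 A(3)[OF i] by (intro powr_mono2) auto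
      finally show "2 powr (- (of_int k * n * \<xi> / qq i)) * 2 powr (of_int (k + l i) * n * \<xi> / qq i)
          \<le> 2 powr (n * \<xi> / qq i) * norm (A i) powr (n * \<xi> / qq i)"
        by (simp add: powr_mult)
    qed auto
    finally show "ennreal (2 powr (- (of_int k * n * \<xi> / qq i))) * ennpowr (ennreal (D i) * J i) (\<xi> / qq i)
        \<le> ennreal (CA powr (1 / qq i) * 2 powr (n * \<xi> / qq i)
          * (D i powr (\<xi> / qq i) * norm (A i) powr (\<xi> * n / qq i))
          * W (k + l i) powr (- 1 / qq i)) * ennpowr (F i) (1 / qq i)"
      by (simp add: mult_ac)
  qed auto
  finally show ?thesis
    by (simp add: H_def B_def D_def F_def W_def)
qed

section \<open>Sums over dyadic annuli and a discrete Hardy inequality\<close>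

lemma bij_betw_nat_atMost_int: "bij_betw (\<lambda>i. k - int i) UNIV {..k}"
proof (rule bij_betwI)
  show "(\<lambda>j. nat (k - j)) \<in> {..k} \<rightarrow> UNIV" by simp
qed auto

text \<open>Written over a counting measure, the series fall under the same Hoelder and Minkowski
  inequalities as the integrals.\<close>

lemma infsum_atMost_int_eq_nn_integral:
  fixes f :: "int \<Rightarrow> ennreal"
  shows "(\<Sum>\<^sub>\<infinity>k\<in>{..k0}. f k) = (\<integral>\<^sup>+k. f k \<partial>count_space {..k0})"
proof -
  let ?g = "\<lambda>i. f (k0 - int i)"
  have "(?g has_sum infsum ?g UNIV) UNIV"
    by (intro has_sum_infsum nonneg_summable_on_complete) simp
  then have "infsum ?g UNIV = suminf ?g"
    by (intro sums_unique has_sum_imp_sums)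
  also have "\<dots> = (\<integral>\<^sup>+i. ?g i \<partial>count_space UNIV)"
    by (rule nn_integral_count_space_nat[symmetric])
  finally show ?thesis
    by (simp add: infsum_reindex_bij_betw[OF bij_betw_nat_atMost_int, of f k0]
        nn_integral_bij_count_space[OF bij_betw_nat_atMost_int, of f k0])
qed

lemma nn_integral_count_space_mono_set:
  fixes f :: "'a \<Rightarrow> ennreal"
  assumes "A \<subseteq> B"
  shows "(\<integral>\<^sup>+x. f x \<partial>count_space A) \<le> (\<integral>\<^sup>+x. f x \<partial>count_space B)"
proof -
  have "(\<integral>\<^sup>+x. f x \<partial>count_space A) = (\<integral>\<^sup>+x. f x * indicator A x \<partial>count_space UNIV)"
    by (rule nn_integral_count_space_indicator) simp
  also have "\<dots> \<le> (\<integral>\<^sup>+x. f x * indicator B x \<partial>count_space UNIV)"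
    using assms by (intro nn_integral_mono) (auto simp: indicator_def)
  also have "\<dots> = (\<integral>\<^sup>+x. f x \<partial>count_space B)"
    by (rule nn_integral_count_space_indicator[symmetric]) simp
  finally show ?thesis .
qed

text \<open>Every term is at most the total S, so b^q <= b S^(q-1); summing gives S^q.\<close>

lemma ennpowr_sum_le:
  fixes b :: "'a \<Rightarrow> ennreal"
  assumes q: "1 \<le> q"
  shows "ennpowr (\<integral>\<^sup>+i. ennpowr (b i) q \<partial>count_space A) (1 / q) \<le> (\<integral>\<^sup>+i. b i \<partial>count_space A)"
proof -
  let ?S = "\<integral>\<^sup>+i. b i \<partial>count_space A"
  have eq: "x * ennpowr x (q - 1) = ennpowr x q" for x
    using ennpowr_add[of 1 "q - 1" x] q by simp
  have "(\<integral>\<^sup>+i. ennpowr (b i) q \<partial>count_space A) \<le> (\<integral>\<^sup>+i. b i * ennpowr ?S (q - 1) \<partial>count_space A)"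
  proof (rule nn_integral_mono)
    fix i assume "i \<in> space (count_space A)"
    then have "ennpowr (b i) (q - 1) \<le> ennpowr ?S (q - 1)"
      using q by (intro ennpowr_mono nn_integral_ge_point) auto
    then show "ennpowr (b i) q \<le> b i * ennpowr ?S (q - 1)"
      unfolding eq[of "b i", symmetric] by (rule mult_left_mono) simp
  qed
  also have "\<dots> = ennpowr ?S q"
    by (simp add: nn_integral_multc eq)
  finally have "ennpowr (\<integral>\<^sup>+i. ennpowr (b i) q \<partial>count_space A) (1 / q) \<le> ennpowr (ennpowr ?S q) (1 / q)"
    using q by (intro ennpowr_mono) auto
  then show ?thesis
    using q by (simp add: ennpowr_ennpowr)
qed

lemma dyadic_annulus_measurable [measurable]: "dyadic_annulus k \<in> sets lebesgue"
  by (simp add: dyadic_annulus_def)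

lemma dyadic_exponent_exists:
  fixes t :: real
  assumes "0 < t"
  obtains l :: int where "t \<le> 2 powr of_int l" "2 powr of_int l \<le> 2 * t" "2 powr of_int (l - 1) < t"
proof (rule that[of "\<lceil>log 2 t\<rceil>"])
  show "t \<le> 2 powr of_int \<lceil>log 2 t\<rceil>"
    using assms by (simp add: le_powr_iff le_of_int_ceiling)
  have "2 powr of_int (\<lceil>log 2 t\<rceil> - 1) < 2 powr (log 2 t)"
    by (subst powr_less_cancel_iff) (auto, linarith)
  then show *: "2 powr of_int (\<lceil>log 2 t\<rceil> - 1) < t"
    using assms by simp
  then show "2 powr of_int \<lceil>log 2 t\<rceil> \<le> 2 * t"
    by (simp add: powr_diff)
qed

lemma dyadic_ball_subset_UN_annulus:
  fixes x :: "real ^ 'n"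
  assumes "x \<in> dyadic_ball k" "x \<noteq> 0"
  obtains i :: nat where "x \<in> dyadic_annulus (k - int i)"
proof -
  have "0 < norm x" using assms by simp
  then obtain l :: int where l: "norm x \<le> 2 powr of_int l" "2 powr of_int (l - 1) < norm x"
    using dyadic_exponent_exists by metis
  have "norm x \<le> 2 powr of_int k"
    using assms by (simp add: dyadic_ball_def two_powi_eq_powr)
  with l(2) have "2 powr of_int (l - 1) < (2::real) powr of_int k"
    by (rule less_le_trans)
  then have "real_of_int (l - 1) < real_of_int k"
    by (subst (asm) powr_less_cancel_iff) auto
  then have "l \<le> k" by linarith
  moreover have "x \<in> dyadic_annulus l"
    using l by (simp add: dyadic_annulus_def dyadic_ball_def two_powi_eq_powr)
  ultimately show ?thesis
    using that[of "nat (k - l)"] by simp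
qed

text \<open>Up to the origin, a null set, the annuli cover the ball; the root of order
  \<open>q\<close> of the sum of their contributions is then bounded by
  \<open>ennpowr_sum_le\<close>.\<close>

lemma dyadic_ball_norm_le_sum_annuli:
  fixes G :: "real ^ 'n \<Rightarrow> ennreal"
  assumes [measurable]: "G \<in> borel_measurable lebesgue" and q: "1 \<le> q"
  shows "ennpowr (\<integral>\<^sup>+x\<in>dyadic_ball k. G x \<partial>lebesgue) (1 / q)
    \<le> (\<integral>\<^sup>+i. ennpowr (\<integral>\<^sup>+x\<in>dyadic_annulus (k - int i). G x \<partial>lebesgue) (1 / q) \<partial>count_space UNIV)"
proof -
  have "AE x in lebesgue. x \<noteq> (0 :: real ^ 'n)"
    using AE_not_in[of "{0}" "lebesgue :: (real ^ 'n) measure"] by simp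
  then have "AE x in lebesgue. G x * indicator (dyadic_ball k) x
      \<le> (\<integral>\<^sup>+i. G x * indicator (dyadic_annulus (k - int i)) x \<partial>count_space UNIV)"
  proof eventually_elim
    case (elim x)
    show ?case
    proof (cases "x \<in> dyadic_ball k")
      case True
      then obtain i where "x \<in> dyadic_annulus (k - int i)"
        using elim dyadic_ball_subset_UN_annulus by blast
      then have "G x * indicator (dyadic_ball k) x \<le> G x * indicator (dyadic_annulus (k - int i)) x"
        by (simp add: indicator_def)
      also have "\<dots> \<le> (\<integral>\<^sup>+i. G x * indicator (dyadic_annulus (k - int i)) x \<partial>count_space UNIV)"
        by (rule nn_integral_ge_point) simp
      finally show ?thesis .
    qed simp
  qed
  then have "(\<integral>\<^sup>+x\<in>dyadic_ball k. G x \<partial>lebesgue)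
      \<le> (\<integral>\<^sup>+x. (\<integral>\<^sup>+i. G x * indicator (dyadic_annulus (k - int i)) x \<partial>count_space UNIV) \<partial>lebesgue)"
    by (rule nn_integral_mono_AE)
  also have "\<dots> = (\<integral>\<^sup>+i. (\<integral>\<^sup>+x\<in>dyadic_annulus (k - int i). G x \<partial>lebesgue) \<partial>count_space UNIV)"
    by (rule nn_integral_count_space_nn_integral) auto
  also have "\<dots> = (\<integral>\<^sup>+i. ennpowr (ennpowr (\<integral>\<^sup>+x\<in>dyadic_annulus (k - int i). G x \<partial>lebesgue) (1 / q)) q \<partial>count_space UNIV)"
    using q by (simp add: ennpowr_ennpowr)
  finally have "ennpowr (\<integral>\<^sup>+x\<in>dyadic_ball k. G x \<partial>lebesgue) (1 / q) \<le> ennpowr \<dots> (1 / q)"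
    using q by (intro ennpowr_mono) auto
  also have "\<dots> \<le> (\<integral>\<^sup>+i. ennpowr (\<integral>\<^sup>+x\<in>dyadic_annulus (k - int i). G x \<partial>lebesgue) (1 / q) \<partial>count_space UNIV)"
    using q by (rule ennpowr_sum_le)
  finally show ?thesis .
qed

lemma count_space_pair_sigma_finite:
  assumes "sigma_finite_measure M" "countable A"
  shows "pair_sigma_finite (count_space A) M"
  using assms by (intro pair_sigma_finite.intro sigma_finite_measure_count_space_countable) auto

text \<open>Since \<open>V\<close> grows geometrically and \<open>a < 0\<close>, passing from the
  ball to its i-th inner annulus gains a factor of a convergent geometric series. Minkowski's
  inequality takes the sum over \<open>i\<close> outside, and each shifted sum is bounded by the
  unshifted one.\<close>

lemma dyadic_hardy:
  fixes G :: "real ^ 'n \<Rightarrow> ennreal" and V :: "int \<Rightarrow> real"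
  assumes [measurable]: "G \<in> borel_measurable lebesgue" and q: "1 \<le> q" and p: "1 \<le> p"
    and V: "\<And>k. 0 < V k" and C: "0 < C" "\<And>j k. j \<le> k \<Longrightarrow> V j \<le> C * (2 powr of_int (j - k)) powr e * V k"
    and e: "0 < e" and a: "a < 0"
  shows "ennpowr (\<integral>\<^sup>+k. ennpowr (ennreal (V k powr a)
        * ennpowr (\<integral>\<^sup>+x\<in>dyadic_ball k. G x \<partial>lebesgue) (1 / q)) p \<partial>count_space {..K}) (1 / p)
    \<le> ennreal (C powr (- a) * (1 / (1 - 2 powr (e * a)))) *
      ennpowr (\<integral>\<^sup>+k. ennpowr (ennreal (V k powr a)
        * ennpowr (\<integral>\<^sup>+x\<in>dyadic_annulus k. G x \<partial>lebesgue) (1 / q)) p \<partial>count_space {..K}) (1 / p)"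
    (is "?lhs \<le> _ * ?S")
proof -
  define b where "b k = ennpowr (\<integral>\<^sup>+x\<in>dyadic_annulus k. G x \<partial>lebesgue) (1 / q)" for k
  define u where "u i = C powr (- a) * (2 powr (e * a)) ^ i" for i :: nat
  define F where "F k i = ennreal (u i) * (ennreal (V (k - int i) powr a) * b (k - int i))" for k i
  \<comment> \<open>A negative power reverses the growth inequality: V(k - i) <= C z V(k) becomes
    V(k)^a <= (C z)^(-a) V(k - i)^a, and z^(-a) is the i-th power of 2^(e a) < 1.\<close>
  have V_le: "V k powr a \<le> u i * V (k - int i) powr a" for k i
  proof -
    define z where "z = (2 powr of_int (- int i)) powr e"
    have z: "0 < z" by (simp add: z_def)
    have le: "V (k - int i) \<le> C * z * V k"
      using C(2)[of "k - int i" k] by (simp add: z_def)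
    have "V k powr a = (1 / (C * z) * (C * z * V k)) powr a"
      using C(1) z by simp
    also have "\<dots> = (1 / (C * z)) powr a * (C * z * V k) powr a"
      using C(1) z V[of k] by (intro powr_mult)
    also have "\<dots> \<le> (1 / (C * z)) powr a * V (k - int i) powr a"
      using le a V by (intro mult_left_mono powr_mono2') auto
    also have "(1 / (C * z)) powr a = C powr (- a) * z powr (- a)"
      using C(1) z by (simp add: powr_mult powr_minus divide_inverse inverse_powr)
    also have "z powr (- a) = (2 powr (e * a)) ^ i"
      by (simp add: z_def powr_powr mult_ac flip: powr_realpow)
    finally show ?thesis by (simp add: u_def)
  qed
  have F: "ennreal (V k powr a) * ennpowr (\<integral>\<^sup>+x\<in>dyadic_ball k. G x \<partial>lebesgue) (1 / q)
      \<le> (\<integral>\<^sup>+i. F k i \<partial>count_space UNIV)" for k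
  proof -
    have "ennreal (V k powr a) * ennpowr (\<integral>\<^sup>+x\<in>dyadic_ball k. G x \<partial>lebesgue) (1 / q)
        \<le> ennreal (V k powr a) * (\<integral>\<^sup>+i. b (k - int i) \<partial>count_space UNIV)"
      unfolding b_def by (intro mult_left_mono dyadic_ball_norm_le_sum_annuli q) auto
    also have "\<dots> = (\<integral>\<^sup>+i. ennreal (V k powr a) * b (k - int i) \<partial>count_space UNIV)"
      by (rule nn_integral_cmult[symmetric]) simp
    also have "\<dots> \<le> (\<integral>\<^sup>+i. F k i \<partial>count_space UNIV)"
    proof (rule nn_integral_mono)
      fix i
      have "ennreal (V k powr a) * b (k - int i) \<le> ennreal (u i * V (k - int i) powr a) * b (k - int i)"
        by (intro mult_right_mono ennreal_leI V_le) auto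
      then show "ennreal (V k powr a) * b (k - int i) \<le> F k i"
        by (simp add: F_def u_def ennreal_mult mult.assoc)
    qed
    finally show ?thesis .
  qed
  interpret pair_sigma_finite "count_space {..K}" "count_space (UNIV :: nat set)"
    by (intro count_space_pair_sigma_finite sigma_finite_measure_count_space_countable) auto
  have "?lhs \<le> ennpowr (\<integral>\<^sup>+k. ennpowr (\<integral>\<^sup>+i. F k i \<partial>count_space UNIV) p \<partial>count_space {..K}) (1 / p)"
    using p F by (intro ennpowr_mono nn_integral_mono) auto
  also have "\<dots> \<le> ennpowr (ennpowr (\<integral>\<^sup>+i. ennpowr (\<integral>\<^sup>+k. ennpowr (F k i) p \<partial>count_space {..K}) (1 / p) \<partial>count_space UNIV) p) (1 / p)"
    using p by (intro ennpowr_mono nn_integral_minkowski) (auto intro: measurable_pair_measure_countable1)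
  also have "\<dots> = (\<integral>\<^sup>+i. ennpowr (\<integral>\<^sup>+k. ennpowr (F k i) p \<partial>count_space {..K}) (1 / p) \<partial>count_space UNIV)"
    using p by (simp add: ennpowr_ennpowr)
  also have "\<dots> \<le> (\<integral>\<^sup>+i. ennreal (u i) * ?S \<partial>count_space UNIV)"
  proof (rule nn_integral_mono)
    fix i :: nat
    have "(\<integral>\<^sup>+k. ennpowr (F k i) p \<partial>count_space {..K})
        = (\<integral>\<^sup>+k. ennpowr (ennreal (u i)) p * ennpowr (ennreal (V (k - int i) powr a) * b (k - int i)) p \<partial>count_space {..K})"
      using p by (simp add: F_def ennpowr_mult)
    also have "\<dots> = ennpowr (ennreal (u i)) p * (\<integral>\<^sup>+k. ennpowr (ennreal (V (k - int i) powr a) * b (k - int i)) p \<partial>count_space {..K})"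
      by (rule nn_integral_cmult) simp
    also have "(\<integral>\<^sup>+k. ennpowr (ennreal (V (k - int i) powr a) * b (k - int i)) p \<partial>count_space {..K})
        = (\<integral>\<^sup>+k. ennpowr (ennreal (V k powr a) * b k) p \<partial>count_space {..K - int i})"
      by (rule nn_integral_bij_count_space) (auto intro!: bij_betwI[of _ _ _ "\<lambda>k. k + int i"])
    \<comment> \<open>Inner annuli have smaller indices, so the shifted range stays below the cutoff
      \<open>K\<close>.\<close>
    also have "\<dots> \<le> (\<integral>\<^sup>+k. ennpowr (ennreal (V k powr a) * b k) p \<partial>count_space {..K})"
      by (rule nn_integral_count_space_mono_set) auto
    finally have "(\<integral>\<^sup>+k. ennpowr (F k i) p \<partial>count_space {..K})
      \<le> ennpowr (ennreal (u i)) p * (\<integral>\<^sup>+k. ennpowr (ennreal (V k powr a) * b k) p \<partial>count_space {..K})"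
      by (simp add: mult_left_mono)
    then have "ennpowr (\<integral>\<^sup>+k. ennpowr (F k i) p \<partial>count_space {..K}) (1 / p) \<le> ennpowr \<dots> (1 / p)"
      using p by (intro ennpowr_mono) auto
    also have "\<dots> = ennreal (u i) * ?S"
      using p by (simp add: ennpowr_mult ennpowr_ennpowr b_def)
    finally show "ennpowr (\<integral>\<^sup>+k. ennpowr (F k i) p \<partial>count_space {..K}) (1 / p) \<le> ennreal (u i) * ?S" .
  qed
  also have "\<dots> = (\<integral>\<^sup>+i. ennreal (u i) \<partial>count_space UNIV) * ?S"
    by (rule nn_integral_multc) simp
  also have "(\<integral>\<^sup>+i. ennreal (u i) \<partial>count_space UNIV) = ennreal (C powr (- a) * (1 / (1 - 2 powr (e * a))))"
  proof -
    have r: "norm (2 powr (e * a)) < 1"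
      using powr_less_mono[of "e * a" 0 2] e a by (simp add: mult_pos_neg)
    have "u sums (C powr (- a) * (1 / (1 - 2 powr (e * a))))"
      unfolding u_def using r by (intro sums_mult geometric_sums)
    then show ?thesis
      by (simp add: nn_integral_count_space_nat) (metis (no_types, lifting) mult_nonneg_nonneg powr_ge_zero
          suminf_ennreal2 sums_iff u_def zero_le_power)
  qed
  finally show ?thesis .
qed

subsection \<open>Balancing the two weights\<close>

lemma wLq_norm_annulus:
  assumes "0 < q" "\<And>x. 0 \<le> w x"
  shows "wLq_norm w q (\<lambda>x. f x * indicator (dyadic_annulus k) x)
    = ennpowr (\<integral>\<^sup>+x\<in>dyadic_annulus k. ennpowr (ennreal (norm (f x))) q * ennreal (w x) \<partial>lebesgue) (1 / q)"
proof -
  have "ennreal (norm (f x * indicator (dyadic_annulus k) x) powr q * w x)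
    = ennpowr (ennreal (norm (f x))) q * ennreal (w x) * indicator (dyadic_annulus k) x" for x
    using assms by (cases "x \<in> dyadic_annulus k") (simp_all add: ennpowr_ennreal_nonneg ennreal_mult)
  then show ?thesis
    by (simp add: wLq_norm_def)
qed

text \<open>The inner sum of the Morrey-Herz norm without the Morrey factor. The masses are positive
  reals in its uses, and the power of \<open>v\<close> sits inside the power \<open>p\<close>, as
  Minkowski's inequality requires.\<close>

definition herz_sum ::
  "(real ^ 'n \<Rightarrow> real) \<Rightarrow> (real ^ 'n \<Rightarrow> real) \<Rightarrow> real \<Rightarrow> real \<Rightarrow> real \<Rightarrow> (real ^ 'n \<Rightarrow> complex) \<Rightarrow> int \<Rightarrow> ennreal"
  where "herz_sum v w \<alpha> p q f k0 =
    ennpowr (\<integral>\<^sup>+k. ennpowr (ennreal (dyadic_mass v k powr (\<alpha> / real CARD('n)))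
      * ennpowr (\<integral>\<^sup>+x\<in>dyadic_annulus k. ennpowr (ennreal (norm (f x))) q * ennreal (w x) \<partial>lebesgue) (1 / q)) p
      \<partial>count_space {..k0}) (1 / p)"

lemma morrey_herz_norm_eq:
  fixes v w :: "real ^ 'n \<Rightarrow> real"
  assumes v: "weight v" "\<And>k. 0 < dyadic_mass v k" and w: "weight w" and "0 < p" "0 < q"
  shows "morrey_herz_norm v w \<alpha> lam p q f =
    (SUP k0. ennreal (dyadic_mass v k0 powr (- lam / real CARD('n))) * herz_sum v w \<alpha> p q f k0)"
proof -
  have w0: "\<And>x. 0 \<le> w x" using w by (simp add: weight_nonneg)
  have "ennpowr (ennreal (dyadic_mass v k)) (\<alpha> * p / real CARD('n))
      = ennpowr (ennreal (dyadic_mass v k powr (\<alpha> / real CARD('n)))) p" for k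
    using v(2)[of k] by (simp add: ennpowr_ennreal powr_powr)
  then show ?thesis
    unfolding morrey_herz_norm_def herz_sum_def
    using assms w0 by (simp add: wmeasure_dyadic_ball wLq_norm_annulus infsum_atMost_int_eq_nn_integral
        ennpowr_mult ennpowr_ennreal[OF v(2)])
qed

lemma herz_sum_le_morrey_herz_norm:
  fixes v w :: "real ^ 'n \<Rightarrow> real"
  assumes v: "weight v" "\<And>k. 0 < dyadic_mass v k" and w: "weight w" and "0 < p" "0 < q"
  shows "herz_sum v w \<alpha> p q f k0
    \<le> ennreal (dyadic_mass v k0 powr (lam / real CARD('n))) * morrey_herz_norm v w \<alpha> lam p q f"
proof -
  have "ennreal (dyadic_mass v k0 powr (- lam / real CARD('n))) * herz_sum v w \<alpha> p q f k0
      \<le> morrey_herz_norm v w \<alpha> lam p q f"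
    unfolding morrey_herz_norm_eq[OF assms] by (intro SUP_upper) simp
  then have "herz_sum v w \<alpha> p q f k0
    \<le> ennreal (1 / dyadic_mass v k0 powr (- lam / real CARD('n))) * morrey_herz_norm v w \<alpha> lam p q f"
    using v(2)[of k0] by (intro ennreal_mult_le_imp_le_divide) auto
  then show ?thesis
    by (simp add: powr_minus divide_inverse)
qed

text \<open>Only exponents and weights are fixed here. Constants obtained from these data alone are
  independent of \<Phi>, the matrices and the functions.\<close>

locale two_weighted_exponents =
  fixes m :: nat and p q qs \<xi> \<eta> \<delta>1 \<delta>2 \<alpha>s lams r\<omega> r\<omega>' rv :: real
    and pp qq \<alpha> lam :: "nat \<Rightarrow> real" and v \<omega> :: "real ^ 'n \<Rightarrow> real" and n :: real
  assumes n_def: "n = real CARD('n)" and m: "1 \<le> m" and p: "1 \<le> p" and q: "1 \<le> q"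
    and pp: "\<And>i. i \<in> {1..m} \<Longrightarrow> 1 \<le> pp i" and qq: "\<And>i. i \<in> {1..m} \<Longrightarrow> 1 \<le> qq i"
    and sum_p: "(\<Sum>i=1..m. 1 / pp i) = 1 / p" and sum_q: "(\<Sum>i=1..m. 1 / qq i) = 1 / q"
    and qs: "1 \<le> qs" and \<xi>: "1 \<le> \<xi>" and \<eta>: "1 \<le> \<eta>"
    and \<alpha>: "\<And>i. i \<in> {1..m} \<Longrightarrow> \<alpha> i < 0" and lam: "\<And>i. i \<in> {1..m} \<Longrightarrow> 0 \<le> lam i"
    and \<omega>: "\<omega> \<in> muckenhoupt \<xi>" and v: "v \<in> muckenhoupt \<eta>"
    and r\<omega>: "critical_index \<omega> = ereal r\<omega>" and rv: "critical_index v = ereal rv"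
    and r\<omega>': "1 / r\<omega> + 1 / r\<omega>' = 1"
    and \<omega>_le_v: "\<exists>C::real. \<forall>k::int. wmeasure \<omega> (dyadic_ball k) \<le> ennreal C * wmeasure v (dyadic_ball k)"
    and q_gt: "q > max (real m * qs) (qs * \<xi> * r\<omega>')"
    and \<delta>1: "1 < \<delta>1" "\<delta>1 < r\<omega>" and \<delta>2: "1 < \<delta>2" "\<delta>2 < rv"
    and lams: "lams = (\<Sum>i=1..m. lam i)"
    and \<alpha>s: "\<And>i. i \<in> {1..m} \<Longrightarrow> 1 / real m * (\<alpha>s / n + 1 / qs) = \<alpha> i / n + 1 / qq i"
begin

abbreviation "V \<equiv> dyadic_mass v"
abbreviation "W \<equiv> dyadic_mass \<omega>"

definition "\<theta>1 = (\<delta>1 - 1) / \<delta>1"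
definition "\<theta>2 = (\<delta>2 - 1) / \<delta>2"

lemma n_pos: "0 < n" by (simp add: n_def)

lemma \<theta>: "0 < \<theta>1" "0 < \<theta>2"
  using \<delta>1 \<delta>2 by (simp_all add: \<theta>1_def \<theta>2_def)

lemma weights: "weight \<omega>" "weight v"
  using \<omega> v by (auto intro: muckenhoupt_weight)

lemma V_pos: "0 < V k"
  using dyadic_mass_pos[OF v \<eta> rv] .

lemma W_pos: "0 < W k"
  using dyadic_mass_pos[OF \<omega> \<xi> r\<omega>] .

lemma m_pos: "0 < real m" using m by simp

text \<open>Summing the balance conditions over \<open>i\<close> gives \<alpha>s/n + 1/qs = (sum of
  \<alpha>_i/n) + 1/q, where the sum is negative and 1/q < 1/qs. The sign decides in which direction
  the \<open>v\<close>-mass is moved.\<close>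

lemma \<alpha>s_neg: "\<alpha>s < 0"
proof -
  have "(\<Sum>i=1..m. 1 / real m * (\<alpha>s / n + 1 / qs)) = (\<Sum>i=1..m. \<alpha> i / n + 1 / qq i)"
    by (intro sum.cong refl \<alpha>s)
  then have "\<alpha>s / n + 1 / qs = (\<Sum>i=1..m. \<alpha> i / n) + 1 / q"
    using m_pos sum_q by (simp add: sum.distrib)
  moreover have "(\<Sum>i=1..m. \<alpha> i / n) < 0"
    using sum_strict_mono[of "{1..m}" "\<lambda>i. \<alpha> i / n" "\<lambda>_. 0"] \<alpha> m n_pos by (auto simp: divide_neg_pos)
  moreover have "1 / q < 1 / qs"
  proof -
    have "qs \<le> real m * qs" using m qs by simp
    then have "qs < q" using q_gt by simp
    then show ?thesis using qs by (intro divide_strict_left_mono) auto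
  qed
  ultimately have "\<alpha>s / n < 0" by linarith
  then show ?thesis using n_pos by (simp add: divide_less_0_iff)
qed

lemma inverse_qq_le: "i \<in> {1..m} \<Longrightarrow> 1 / qq i \<le> 1 / (real m * qs)"
proof -
  assume i: "i \<in> {1..m}"
  have "1 / qq i \<le> (\<Sum>i=1..m. 1 / qq i)"
    using i by (intro member_le_sum) (auto intro: less_imp_le order_trans[OF _ qq])
  also have "\<dots> \<le> 1 / (real m * qs)"
    unfolding sum_q using q_gt m_pos qs q by (intro divide_left_mono) auto
  finally show ?thesis .
qed

text \<open>
  With \<open>t = \<parallel>A\<^sub>i(y)\<parallel>\<close>, \<open>gain i t\<close> is \<open>\<B>\<^sub>2\<^sub>i(y)\<close>.  Its \<open>m\<close>-th root splits into the price of moving the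
  masses in \<open>v(B\<^sub>k)\<close> and \<open>\<omega>(B\<^sub>k)\<close> to the ball of radius \<open>t 2\<^sup>k\<close> and the price of moving the Morrey factor.
\<close>

definition "mass_gain t = (if t < 1 then t powr (- (\<theta>2 * \<alpha>s / real m)) * t powr (- (n * \<xi> / (real m * qs)))
    else t powr (- (\<eta> * \<alpha>s / real m)) * t powr (- (n * \<theta>1 / (real m * qs))))"

definition "morrey_gain i t = (if t < 1 then t powr (\<theta>2 * lam i) else t powr (\<eta> * lam i))"

definition "gain i t = (if t < 1 then t powr (- (\<xi> * n / qs + (\<alpha>s - real m * lam i) * \<theta>2))
    else t powr (- (n / qs * \<theta>1 + \<eta> * (\<alpha>s - real m * lam i))))"

lemma gain_root: "mass_gain t * morrey_gain i t = gain i t powr (1 / real m)"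
  using m_pos unfolding mass_gain_def morrey_gain_def gain_def
  by (simp add: powr_powr flip: powr_add) (simp add: field_simps)

text \<open>Each of the \<open>m\<close> factors receives the m-th root of the prefactor at
  \<open>k\<close>. Both masses are moved to \<open>k + l\<close> by ratio bounds; what is left of
  the \<open>\<omega>\<close>-mass there has the exponent \<open>s1 - 1 / qq i >= 0\<close> and is
  exchanged for \<open>v\<close>-mass.\<close>

lemma mass_comparison:
  obtains C where "0 < C" "\<And>i k l t. i \<in> {1..m} \<Longrightarrow> 0 < t \<Longrightarrow> t \<le> 2 powr of_int l \<Longrightarrow> 2 powr of_int l \<le> 2 * t \<Longrightarrow>
    V k powr (\<alpha>s / (n * real m)) * W k powr (1 / (real m * qs)) * W (k + l) powr (- 1 / qq i)
      \<le> C * mass_gain t * V (k + l) powr (\<alpha> i / n)"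
proof -
  define s1 where "s1 = 1 / (real m * qs)"
  define s2 where "s2 = - \<alpha>s / (n * real m)"
  have s: "0 \<le> s1" "0 \<le> s2"
    using m_pos qs \<alpha>s_neg n_pos by (simp_all add: s1_def s2_def divide_le_0_iff)
  obtain C1 where C1: "0 < C1" "\<And>k l t. 0 < t \<Longrightarrow> t \<le> 2 powr of_int l \<Longrightarrow> 2 powr of_int l \<le> 2 * t \<Longrightarrow>
      (W k / W (k + l)) powr s1 \<le> C1 * (if t < 1 then t powr (- (n * \<xi> * s1)) else t powr (- (n * \<theta>1 * s1)))"
    using dyadic_mass_ratio_powr[OF \<omega> \<xi> r\<omega> \<delta>1 s(1)] unfolding n_def \<theta>1_def by metis
  obtain C2 where C2: "0 < C2" "\<And>k l t. 0 < t \<Longrightarrow> t \<le> 2 powr of_int l \<Longrightarrow> 2 powr of_int l \<le> 2 * t \<Longrightarrow>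
      (V (k + l) / V k) powr s2 \<le> C2 * (if t < 1 then t powr (n * \<theta>2 * s2) else t powr (n * \<eta> * s2))"
    using dyadic_mass_ratio_powr[OF v \<eta> rv \<delta>2 s(2)] unfolding n_def \<theta>2_def by metis
  obtain C0 where C0: "\<And>k. wmeasure \<omega> (dyadic_ball k) \<le> ennreal C0 * wmeasure v (dyadic_ball k)"
    using \<omega>_le_v by blast
  define C3 where "C3 = max C0 1"
  have C3: "W k \<le> C3 * V k" for k
  proof -
    have "ennreal (W k) \<le> ennreal C3 * ennreal (V k)"
      unfolding wmeasure_dyadic_ball[OF weights(1), symmetric] wmeasure_dyadic_ball[OF weights(2), symmetric]
      by (rule order_trans[OF C0]) (auto simp: C3_def intro!: mult_right_mono ennreal_leI)
    then show ?thesis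
      using V_pos[of k] by (simp add: C3_def less_imp_le flip: ennreal_mult)
  qed
  show ?thesis
  \<comment> \<open>The constant of the bound of \<open>\<omega>\<close> by \<open>v\<close> is
    raised to a power depending on \<open>i\<close>; the maximum over the finitely many indices
    serves all of them.\<close>
  proof (rule that[of "C1 * C2 * Max ((\<lambda>i. C3 powr (s1 - 1 / qq i)) ` {1..m})"])
    have "0 < C3" by (simp add: C3_def)
    then show "0 < C1 * C2 * Max ((\<lambda>i. C3 powr (s1 - 1 / qq i)) ` {1..m})"
      using C1(1) C2(1) m by (intro mult_pos_pos) (auto simp: Max_gr_iff intro!: exI[of _ 1])
  next
    fix i k l and t :: real
    assume i: "i \<in> {1..m}" and t: "0 < t" "t \<le> 2 powr of_int l" "2 powr of_int l \<le> 2 * t"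
    let ?K = "k + l" and ?M = "Max ((\<lambda>i. C3 powr (s1 - 1 / qq i)) ` {1..m})"
    have \<beta>: "0 \<le> s1 - 1 / qq i"
      using inverse_qq_le[OF i] by (simp add: s1_def)
    \<comment> \<open>This is the balance condition of the theorem: it makes the exponents at
      \<open>k + l\<close> add up to that of the i-th source space.\<close>
    have ai: "\<alpha> i / n = - s2 + (s1 - 1 / qq i)"
    proof -
      have "1 / real m * (\<alpha>s / n + 1 / qs) = \<alpha>s / (n * real m) + 1 / (real m * qs)"
        by (simp add: distrib_left add_divide_distrib mult.commute)
      then show ?thesis
        using \<alpha>s[OF i] by (simp add: s1_def s2_def)
    qed
    have "V k powr (\<alpha>s / (n * real m)) * W k powr s1 * W ?K powr (- 1 / qq i)
        = (V ?K / V k) powr s2 * (W k / W ?K) powr s1 * (V ?K powr (- s2) * W ?K powr (s1 - 1 / qq i))"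
    proof -
      have 1: "V k powr (\<alpha>s / (n * real m)) = (V ?K / V k) powr s2 * V ?K powr (- s2)"
        using V_pos[of k] V_pos[of ?K] by (simp add: powr_divide s2_def powr_minus field_simps)
      have 2: "W k powr s1 * W ?K powr (- 1 / qq i) = (W k / W ?K) powr s1 * W ?K powr (s1 - 1 / qq i)"
        using W_pos[of k] W_pos[of ?K] by (simp add: powr_divide powr_diff powr_minus field_simps)
      show ?thesis unfolding 1 mult.assoc 2 by (simp add: mult_ac)
    qed
    also have "\<dots> \<le> (C2 * (if t < 1 then t powr (n * \<theta>2 * s2) else t powr (n * \<eta> * s2)))
        * (C1 * (if t < 1 then t powr (- (n * \<xi> * s1)) else t powr (- (n * \<theta>1 * s1))))
        * (V ?K powr (- s2) * (?M * V ?K powr (s1 - 1 / qq i)))"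
    proof (intro mult_mono C1(2) C2(2) t order_refl)
      have "W ?K powr (s1 - 1 / qq i) \<le> (C3 * V ?K) powr (s1 - 1 / qq i)"
        using \<beta> C3 W_pos[of ?K] by (intro powr_mono2) auto
      also have "\<dots> = C3 powr (s1 - 1 / qq i) * V ?K powr (s1 - 1 / qq i)"
        using V_pos[of ?K] by (intro powr_mult)
      also have "\<dots> \<le> ?M * V ?K powr (s1 - 1 / qq i)"
        using i by (intro mult_right_mono Max_ge) auto
      finally show "W ?K powr (s1 - 1 / qq i) \<le> ?M * V ?K powr (s1 - 1 / qq i)" .
    qed (use C1(1) C2(1) in auto)
    also have "\<dots> = C1 * C2 * ?M * mass_gain t * (V ?K powr (- s2) * V ?K powr (s1 - 1 / qq i))"
    proof -
      have "n * \<theta>2 * s2 = - (\<theta>2 * \<alpha>s / real m)" "n * \<eta> * s2 = - (\<eta> * \<alpha>s / real m)"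
        "n * \<xi> * s1 = n * \<xi> / (real m * qs)" "n * \<theta>1 * s1 = n * \<theta>1 / (real m * qs)"
        using n_pos by (simp_all add: s1_def s2_def)
      then show ?thesis by (simp add: mass_gain_def)
    qed
    also have "V ?K powr (- s2) * V ?K powr (s1 - 1 / qq i) = V ?K powr (\<alpha> i / n)"
      by (simp add: ai flip: powr_add)
    finally show "V k powr (\<alpha>s / (n * real m)) * W k powr (1 / (real m * qs)) * W ?K powr (- 1 / qq i)
      \<le> C1 * C2 * ?M * mass_gain t * V ?K powr (\<alpha> i / n)"
      by (simp add: s1_def)
  qed
qed

text \<open>The target norm is cut off at \<open>k\<close>, the i-th source norm at
  \<open>k + l\<close>; \<open>morrey_gain\<close> pays for the difference of the two
  normalisations.\<close>

lemma morrey_comparison: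
  obtains C where "\<And>i. i \<in> {1..m} \<Longrightarrow> 0 < C i"
    "\<And>i k l t. i \<in> {1..m} \<Longrightarrow> 0 < t \<Longrightarrow> t \<le> 2 powr of_int l \<Longrightarrow> 2 powr of_int l \<le> 2 * t \<Longrightarrow>
    V k powr (- lam i / n) * V (k + l) powr (lam i / n) \<le> C i * morrey_gain i t"
proof -
  have "\<exists>C>0. \<forall>k l t. 0 < t \<longrightarrow> t \<le> 2 powr of_int l \<longrightarrow> 2 powr of_int l \<le> 2 * t \<longrightarrow>
      V k powr (- lam i / n) * V (k + l) powr (lam i / n) \<le> C * morrey_gain i t" if i: "i \<in> {1..m}" for i
  proof -
    have s: "0 \<le> lam i / n" using lam[OF i] n_pos by simp
    obtain C where C: "0 < C" "\<And>k l t. 0 < t \<Longrightarrow> t \<le> 2 powr of_int l \<Longrightarrow> 2 powr of_int l \<le> 2 * t \<Longrightarrow>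
      (V (k + l) / V k) powr (lam i / n)
        \<le> C * (if t < 1 then t powr (n * \<theta>2 * (lam i / n)) else t powr (n * \<eta> * (lam i / n)))"
      using dyadic_mass_ratio_powr[OF v \<eta> rv \<delta>2 s] unfolding n_def \<theta>2_def by metis
    show ?thesis
    proof (intro exI[of _ C] conjI allI impI C(1))
      fix k l and t :: real
      assume t: "0 < t" "t \<le> 2 powr of_int l" "2 powr of_int l \<le> 2 * t"
      have "V k powr (- lam i / n) * V (k + l) powr (lam i / n) = (V (k + l) / V k) powr (lam i / n)"
        using V_pos[of k] V_pos[of "k + l"] by (simp add: powr_divide powr_minus field_simps)
      also have "\<dots> \<le> C * morrey_gain i t"
      proof -
        have "n * c * (lam i / n) = c * lam i" for c
          using n_pos by simp
        then show ?thesis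
          using C(2)[OF t, of k] unfolding morrey_gain_def by metis
      qed
      finally show "V k powr (- lam i / n) * V (k + l) powr (lam i / n) \<le> C * morrey_gain i t" .
    qed
  qed
  then obtain C where "\<forall>i\<in>{1..m}. 0 < C i \<and> (\<forall>k l t. 0 < t \<longrightarrow> t \<le> 2 powr of_int l \<longrightarrow> 2 powr of_int l \<le> 2 * t \<longrightarrow>
      V k powr (- lam i / n) * V (k + l) powr (lam i / n) \<le> C i * morrey_gain i t)"
    by metis
  then show ?thesis by (intro that[of C]) auto
qed

abbreviation "source_norm i f \<equiv> morrey_herz_norm v \<omega> (\<alpha> i) (lam i) (pp i) (qq i) f"

text \<open>Hardy's inequality with a = \<alpha>_i/n and decay rate n \<theta>2, the growth exponent
  of \<open>v\<close>. The Morrey factor at \<open>K\<close> reappears on the right because the norm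
  contains its inverse.\<close>

lemma herz_estimate:
  obtains C where "\<And>i. i \<in> {1..m} \<Longrightarrow> 0 < C i"
    "\<And>i f K. i \<in> {1..m} \<Longrightarrow> f \<in> borel_measurable lebesgue \<Longrightarrow>
      ennpowr (\<integral>\<^sup>+k. ennpowr (ennreal (V k powr (\<alpha> i / n))
        * ennpowr (\<integral>\<^sup>+x\<in>dyadic_ball k. ennpowr (ennreal (norm (f x))) (qq i) * ennreal (\<omega> x) \<partial>lebesgue) (1 / qq i)) (pp i)
        \<partial>count_space {..K}) (1 / pp i)
      \<le> ennreal (C i * V K powr (lam i / n)) * source_norm i f"
proof -
  obtain D where D: "0 < D" "\<And>j k. j \<le> k \<Longrightarrow> V j \<le> D * (2 powr of_int (j - k)) powr (n * \<theta>2) * V k"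
    using dyadic_mass_growth_lower[OF weights(2) \<delta>2(1)] rv \<delta>2(2) unfolding n_def \<theta>2_def by auto
  define C where "C i = D powr (- (\<alpha> i / n)) * (1 / (1 - 2 powr (n * \<theta>2 * (\<alpha> i / n))))" for i
  have an: "\<alpha> i / n < 0" if "i \<in> {1..m}" for i
    using \<alpha>[OF that] n_pos by (simp add: divide_neg_pos)
  have e: "0 < n * \<theta>2" using n_pos \<theta> by simp
  have C: "0 < C i" if "i \<in> {1..m}" for i
  proof -
    have "(2::real) powr (n * \<theta>2 * (\<alpha> i / n)) < 1"
      using powr_less_mono[of "n * \<theta>2 * (\<alpha> i / n)" 0 2] e an[OF that] by (simp only: mult_pos_neg) simp
    then show ?thesis using D(1) by (simp add: C_def)
  qed
  show ?thesis
  proof (rule that[of C])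
    fix i K and f :: "real ^ 'n \<Rightarrow> complex"
    assume i: "i \<in> {1..m}" and [measurable]: "f \<in> borel_measurable lebesgue"
    have [measurable]: "\<omega> \<in> borel_measurable lebesgue"
      using weights(1) by (rule weight_measurable)
    let ?M = "source_norm i f"
    have G: "(\<lambda>x. ennpowr (ennreal (norm (f x))) (qq i) * ennreal (\<omega> x)) \<in> borel_measurable lebesgue"
      by measurable
    have "ennpowr (\<integral>\<^sup>+k. ennpowr (ennreal (V k powr (\<alpha> i / n))
        * ennpowr (\<integral>\<^sup>+x\<in>dyadic_ball k. ennpowr (ennreal (norm (f x))) (qq i) * ennreal (\<omega> x) \<partial>lebesgue) (1 / qq i)) (pp i)
        \<partial>count_space {..K}) (1 / pp i) \<le> ennreal (C i) * herz_sum v \<omega> (\<alpha> i) (pp i) (qq i) f K"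
      using dyadic_hardy[OF G qq[OF i] pp[OF i] V_pos D e an[OF i], of K]
      by (simp add: C_def herz_sum_def n_def)
    also have "\<dots> \<le> ennreal (C i) * (ennreal (V K powr (lam i / n)) * ?M)"
      using pp[OF i] qq[OF i] unfolding n_def
      by (intro mult_left_mono herz_sum_le_morrey_herz_norm weights V_pos) auto
    also have "\<dots> = ennreal (C i * V K powr (lam i / n)) * ?M"
      using C[OF i] by (simp add: ennreal_mult mult.assoc)
    finally show "ennpowr (\<integral>\<^sup>+k. ennpowr (ennreal (V k powr (\<alpha> i / n))
        * ennpowr (\<integral>\<^sup>+x\<in>dyadic_ball k. ennpowr (ennreal (norm (f x))) (qq i) * ennreal (\<omega> x) \<partial>lebesgue) (1 / qq i)) (pp i)
        \<partial>count_space {..K}) (1 / pp i) \<le> ennreal (C i * V K powr (lam i / n)) * ?M" .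
  qed (fact C)
qed

text \<open>For \<tau> = qs \<xi> / q the condition q > qs \<xi> r'_\<omega> reads 1/(1 - \<tau>) <
  r_\<omega>. The critical index being a supremum, some admissible order r lies above 1/(1 -
  \<tau>), that is, \<tau> < 1 - 1/r.\<close>

lemma reverse_hoelder_qs:
  obtains C where "0 < C" "\<And>k g. g \<in> borel_measurable lebesgue \<Longrightarrow>
      dyadic_reverse_hoelder_ineq \<omega> (qs * \<xi> / q) C k g"
proof -
  define \<tau> where "\<tau> = qs * \<xi> / q"
  have \<tau>: "0 < \<tau>" using qs \<xi> q by (simp add: \<tau>_def)
  have r1: "1 < r\<omega>" using \<delta>1 by simp
  have inv: "1 / r\<omega>' = 1 - 1 / r\<omega>" using r\<omega>' by simp
  then have "0 < 1 / r\<omega>'" using r1 by simp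
  then have r': "0 < r\<omega>'" by (simp add: zero_less_divide_iff)
  have "\<tau> < 1 / r\<omega>'"
    using q_gt r' q by (simp add: \<tau>_def field_simps)
  then have lt: "\<tau> < 1 - 1 / r\<omega>" by (simp add: inv)
  then have \<tau>1: "\<tau> < 1" using r1 by (smt (verit) divide_pos_pos)
  have "1 / (1 - \<tau>) < r\<omega>"
    using lt \<tau>1 r1 by (simp add: field_simps)
  moreover have "1 \<le> 1 / (1 - \<tau>)"
    using \<tau> \<tau>1 by simp
  ultimately obtain r where r: "1 / (1 - \<tau>) < r" "1 < r" "\<omega> \<in> reverse_hoelder r"
    using critical_index_reverse_hoelder[of "1 / (1 - \<tau>)" \<omega>] r\<omega> by auto
  have "1 / r < 1 - \<tau>"
    using r(1,2) \<tau>1 by (simp add: divide_less_eq mult.commute)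
  then have "\<tau> \<le> 1 - 1 / r" by simp
  then obtain C where "0 < C" "\<And>k g. g \<in> borel_measurable lebesgue \<Longrightarrow>
      dyadic_reverse_hoelder_ineq \<omega> (qs * \<xi> / q) C k g"
    using reverse_hoelder_dyadic[OF r(3,2) \<tau>] unfolding \<tau>_def by blast
  then show ?thesis by (rule that)
qed

text \<open>The m-th root of the matrix part of the i-th integrand in
  \<open>hausdorff_const\<close>.\<close>

abbreviation "factor i B \<equiv> \<bar>det (matrix_inv B)\<bar> powr (\<xi> / qq i) * norm B powr (\<xi> * n / qq i) * gain i (norm B) powr (1 / real m)"

abbreviation "ball_sum A f k0 \<equiv> ennpowr (\<integral>\<^sup>+k. ennpowr (ennreal (V k powr (\<alpha>s / n))
    * ennpowr (\<integral>\<^sup>+x\<in>dyadic_ball k. (\<Prod>i=1..m. ennpowr (ennreal (norm (f i (A i *v x)))) qs) * ennreal (\<omega> x) \<partial>lebesgue) (1 / qs)) p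
    \<partial>count_space {..k0}) (1 / p)"

abbreviation "annulus_sum G k0 \<equiv> ennpowr (\<integral>\<^sup>+k. ennpowr (ennreal (V k powr (\<alpha>s / n))
    * ennpowr (\<integral>\<^sup>+x\<in>dyadic_annulus k. G x \<partial>lebesgue) (1 / qs)) p \<partial>count_space {..k0}) (1 / p)"

text \<open>The matrices are frozen at one \<open>y\<close>. The constant must not depend on them,
  since the estimate is integrated over \<open>y\<close> afterwards.\<close>

lemma pointwise_estimate:
  obtains C where "0 < C"
    "\<And>A f k0. (\<And>i. i \<in> {1..m} \<Longrightarrow> det (A i) \<noteq> 0) \<Longrightarrow> (\<And>i. i \<in> {1..m} \<Longrightarrow> f i \<in> borel_measurable borel) \<Longrightarrow>
      ennreal (V k0 powr (- lams / n)) * ball_sum A f k0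
      \<le> ennreal C * (\<Prod>i=1..m. ennreal (factor i (A i))
          * source_norm i (f i))"
proof -
  let ?I = "{1..m}"
  obtain CR where CR: "0 < CR" "\<And>k g. g \<in> borel_measurable lebesgue \<Longrightarrow>
      dyadic_reverse_hoelder_ineq \<omega> (qs * \<xi> / q) CR k g"
    using reverse_hoelder_qs by blast
  obtain CA where CA: "0 < CA" "\<And>k h. h \<in> borel_measurable lebesgue \<Longrightarrow>
      dyadic_muckenhoupt_ineq \<omega> \<xi> CA k h"
    using muckenhoupt_dyadic[OF \<omega> \<xi>] unfolding n_def by blast
  obtain C1 where C1: "0 < C1" "\<And>i k l t. i \<in> ?I \<Longrightarrow> 0 < t \<Longrightarrow> t \<le> 2 powr of_int l \<Longrightarrow> 2 powr of_int l \<le> 2 * t \<Longrightarrow>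
    V k powr (\<alpha>s / (n * real m)) * W k powr (1 / (real m * qs)) * W (k + l) powr (- 1 / qq i)
      \<le> C1 * mass_gain t * V (k + l) powr (\<alpha> i / n)"
    using mass_comparison by blast
  obtain Cm where Cm: "\<And>i. i \<in> ?I \<Longrightarrow> 0 < Cm i"
    "\<And>i k l t. i \<in> ?I \<Longrightarrow> 0 < t \<Longrightarrow> t \<le> 2 powr of_int l \<Longrightarrow> 2 powr of_int l \<le> 2 * t \<Longrightarrow>
    V k powr (- lam i / n) * V (k + l) powr (lam i / n) \<le> Cm i * morrey_gain i t"
    using morrey_comparison by blast
  obtain Ch where Ch: "\<And>i. i \<in> ?I \<Longrightarrow> 0 < Ch i"
    "\<And>i f K. i \<in> ?I \<Longrightarrow> f \<in> borel_measurable lebesgue \<Longrightarrow>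
      ennpowr (\<integral>\<^sup>+k. ennpowr (ennreal (V k powr (\<alpha> i / n))
        * ennpowr (\<integral>\<^sup>+x\<in>dyadic_ball k. ennpowr (ennreal (norm (f x))) (qq i) * ennreal (\<omega> x) \<partial>lebesgue) (1 / qq i)) (pp i)
        \<partial>count_space {..K}) (1 / pp i)
      \<le> ennreal (Ch i * V K powr (lam i / n)) * source_norm i f"
    using herz_estimate by blast
  define c where "c i = CA powr (1 / qq i) * 2 powr (n * \<xi> / qq i)" for i
  have c: "0 < c i" for i using CA(1) by (simp add: c_def)
  have nn: "0 \<le> c i" "0 \<le> C1" "i \<in> ?I \<Longrightarrow> 0 \<le> Ch i" "i \<in> ?I \<Longrightarrow> 0 \<le> Cm i" for i
    using c C1(1) Ch(1) Cm(1) by (auto intro: less_imp_le)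
  show ?thesis
  proof (rule that[of "CR powr (1 / qs) * (\<Prod>i\<in>?I. c i * C1 * (Ch i * Cm i))"])
    show "0 < CR powr (1 / qs) * (\<Prod>i\<in>?I. c i * C1 * (Ch i * Cm i))"
      using CR(1) c C1(1) Ch(1) Cm(1) by (intro mult_pos_pos prod_pos) auto
  next
    fix A :: "nat \<Rightarrow> real ^ 'n ^ 'n" and f :: "nat \<Rightarrow> real ^ 'n \<Rightarrow> complex" and k0
    assume A: "\<And>i. i \<in> ?I \<Longrightarrow> det (A i) \<noteq> 0" and f: "\<And>i. i \<in> ?I \<Longrightarrow> f i \<in> borel_measurable borel"
    have nA: "0 < norm (A i)" if "i \<in> ?I" for i
      using A[OF that] by (metis det_0 zero_less_norm_iff mat_0)
    then have "\<forall>i\<in>?I. \<exists>l::int. norm (A i) \<le> 2 powr of_int l \<and> 2 powr of_int l \<le> 2 * norm (A i)"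
      by (metis dyadic_exponent_exists)
    then obtain l :: "nat \<Rightarrow> int" where l: "\<And>i. i \<in> ?I \<Longrightarrow> norm (A i) \<le> 2 powr of_int (l i)"
        "\<And>i. i \<in> ?I \<Longrightarrow> 2 powr of_int (l i) \<le> 2 * norm (A i)"
      by metis
    define M where "M i = source_norm i (f i)" for i
    define d where "d i = \<bar>det (matrix_inv (A i))\<bar> powr (\<xi> / qq i) * norm (A i) powr (\<xi> * n / qq i)" for i
    have d: "0 \<le> d i" for i by (simp add: d_def)
    define F where "F i k = ennpowr (\<integral>\<^sup>+x\<in>dyadic_ball k. ennpowr (ennreal (norm (f i x))) (qq i) * ennreal (\<omega> x) \<partial>lebesgue) (1 / qq i)" for i k
    define X where "X i k = ennreal (V k powr (\<alpha> i / n)) * F i k" for i k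
    define P where "P k = ennpowr (\<integral>\<^sup>+x\<in>dyadic_ball k. (\<Prod>i\<in>?I. ennpowr (ennreal (norm (f i (A i *v x)))) qs) * ennreal (\<omega> x) \<partial>lebesgue) (1 / qs)" for k
    define B where "B = CR powr (1 / qs) * (\<Prod>i\<in>?I. c i * d i * (C1 * mass_gain (norm (A i))))"
    have mg: "0 \<le> mass_gain t" "0 \<le> morrey_gain i t" for i t
      by (simp_all add: mass_gain_def morrey_gain_def)
    have B: "0 \<le> B"
      unfolding B_def using c d C1(1) mg by (intro mult_nonneg_nonneg prod_nonneg) (auto intro: less_imp_le)

    have VP: "ennreal (V k powr (\<alpha>s / n)) * P k \<le> ennreal B * (\<Prod>i\<in>?I. X i (k + l i))" for k
    proof -
      have "P k \<le> ennreal ((CR * W k) powr (1 / qs)) *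
          (\<Prod>i\<in>?I. ennreal (c i * d i * W (k + l i) powr (- 1 / qq i)) * F i (k + l i))"
        unfolding P_def c_def d_def F_def n_def
      proof (rule dyadic_product_estimate[where q = q and I = ?I and w = \<omega> and A = A and l = l and qq = qq
            and g = "\<lambda>i x. ennreal (norm (f i x))" and CR = CR and CA = CA and qs = qs and \<xi> = \<xi> and k = k,
            OF _ _ _ _ sum_q _ \<xi> weights(1) W_pos CR(1) CR(2)[unfolded n_def] CA(1) CA(2)[unfolded n_def]])
        show "0 < qq i" if "i \<in> ?I" for i
          using qq[OF that] by simp
        show "(\<lambda>x. ennreal (norm (f i x))) \<in> borel_measurable borel" if "i \<in> ?I" for i
          using f[OF that] by measurable
      qed (use m q qs A l in auto)
      also have "\<dots> = ennreal ((CR * W k) powr (1 / qs)) *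
          (ennreal (\<Prod>i\<in>?I. c i * d i * W (k + l i) powr (- 1 / qq i)) * (\<Prod>i\<in>?I. F i (k + l i)))"
        using c d by (subst prod_mult_ennreal) (auto intro!: mult_nonneg_nonneg less_imp_le[OF c])
      finally have "ennreal (V k powr (\<alpha>s / n)) * P k \<le> ennreal (V k powr (\<alpha>s / n)) * \<dots>"
        by (intro mult_left_mono) auto
      also have "\<dots> = ennreal (V k powr (\<alpha>s / n) * (CR * W k) powr (1 / qs)
          * (\<Prod>i\<in>?I. c i * d i * W (k + l i) powr (- 1 / qq i))) * (\<Prod>i\<in>?I. F i (k + l i))"
        using c d by (simp add: ennreal_mult prod_nonneg less_imp_le mult.assoc)
      also have "V k powr (\<alpha>s / n) * (CR * W k) powr (1 / qs) * (\<Prod>i\<in>?I. c i * d i * W (k + l i) powr (- 1 / qq i))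
          = CR powr (1 / qs) * (\<Prod>i\<in>?I. c i * d i * (V k powr (\<alpha>s / (n * real m)) * W k powr (1 / (real m * qs)) * W (k + l i) powr (- 1 / qq i)))"
      proof -
        \<comment> \<open>The prefactors are split into \<open>m\<close> equal roots, one for each
          application of \<open>mass_comparison\<close>.\<close>
        have "V k powr (\<alpha>s / n) = (\<Prod>i\<in>?I. V k powr (\<alpha>s / (n * real m)))"
          using V_pos[of k] m_pos by (simp add: powr_powr flip: powr_realpow)
        moreover have "W k powr (1 / qs) = (\<Prod>i\<in>?I. W k powr (1 / (real m * qs)))"
          using W_pos[of k] m_pos by (simp add: powr_powr flip: powr_realpow)
        ultimately show ?thesis
          using CR(1) W_pos[of k] by (simp add: powr_mult prod.distrib mult_ac)
      qed
      also have "ennreal \<dots> * (\<Prod>i\<in>?I. F i (k + l i))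
          \<le> ennreal (CR powr (1 / qs) * (\<Prod>i\<in>?I. c i * d i * (C1 * mass_gain (norm (A i)) * V (k + l i) powr (\<alpha> i / n)))) * (\<Prod>i\<in>?I. F i (k + l i))"
        using nn d
        by (intro mult_right_mono ennreal_leI mult_left_mono prod_mono conjI C1(2) nA l mult_nonneg_nonneg) auto
      also have "\<dots> = ennreal B * (\<Prod>i\<in>?I. X i (k + l i))"
      proof -
        have "CR powr (1 / qs) * (\<Prod>i\<in>?I. c i * d i * (C1 * mass_gain (norm (A i)) * V (k + l i) powr (\<alpha> i / n)))
            = B * (\<Prod>i\<in>?I. V (k + l i) powr (\<alpha> i / n))"
          by (simp add: B_def prod.distrib mult_ac)
        moreover have "(\<Prod>i\<in>?I. X i (k + l i)) = ennreal (\<Prod>i\<in>?I. V (k + l i) powr (\<alpha> i / n)) * (\<Prod>i\<in>?I. F i (k + l i))"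
          unfolding X_def by (rule prod_mult_ennreal) simp
        ultimately show ?thesis
          using B by (simp add: ennreal_mult prod_nonneg mult.assoc)
      qed
      finally show ?thesis .
    qed

    have p0: "0 < p" using p by simp
    have "ennpowr (\<integral>\<^sup>+k. ennpowr (ennreal (V k powr (\<alpha>s / n)) * P k) p \<partial>count_space {..k0}) (1 / p)
        \<le> ennpowr (\<integral>\<^sup>+k. ennpowr (ennreal B * (\<Prod>i\<in>?I. X i (k + l i))) p \<partial>count_space {..k0}) (1 / p)"
      using p0 VP by (intro ennpowr_mono nn_integral_mono) auto
    also have "\<dots> = ennpowr (ennpowr (ennreal B) p * (\<integral>\<^sup>+k. (\<Prod>i\<in>?I. ennpowr (X i (k + l i)) p) \<partial>count_space {..k0})) (1 / p)"
      using p0 by (simp add: ennpowr_mult ennpowr_prod nn_integral_cmult)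
    also have "\<dots> = ennreal B * ennpowr (\<integral>\<^sup>+k. (\<Prod>i\<in>?I. ennpowr (X i (k + l i)) p) \<partial>count_space {..k0}) (1 / p)"
      using p0 by (simp add: ennpowr_mult ennpowr_ennpowr)
    also have "(\<integral>\<^sup>+k. (\<Prod>i\<in>?I. ennpowr (X i (k + l i)) p) \<partial>count_space {..k0})
        = (\<integral>\<^sup>+k. (\<Prod>i\<in>?I. ennpowr (ennpowr (X i (k + l i)) (pp i)) (p / pp i)) \<partial>count_space {..k0})"
    proof (intro nn_integral_cong prod.cong refl)
      fix k i assume "i \<in> ?I"
      then show "ennpowr (X i (k + l i)) p = ennpowr (ennpowr (X i (k + l i)) (pp i)) (p / pp i)"
        using pp[of i] by (simp add: ennpowr_ennpowr)
    qed
    \<comment> \<open>Hoelder over the counting measure in \<open>k\<close> with weights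
      \<open>p / pp i\<close>, which sum to 1.\<close>
    also have "ennpowr \<dots> (1 / p) \<le> ennpowr (\<Prod>i\<in>?I. ennpowr (\<integral>\<^sup>+k. ennpowr (X i (k + l i)) (pp i) \<partial>count_space {..k0}) (p / pp i)) (1 / p)"
    proof (intro ennpowr_mono nn_integral_prod_ennpowr_le)
      show "(\<Sum>i\<in>?I. p / pp i) = 1"
        using p0 sum_p sum_distrib_left[of p "\<lambda>i. 1 / pp i" ?I] by simp
      show "0 \<le> p / pp i" if "i \<in> ?I" for i
        using p0 pp[OF that] by simp
    qed (use p0 in auto)
    also have "\<dots> = (\<Prod>i\<in>?I. ennpowr (\<integral>\<^sup>+k. ennpowr (X i (k + l i)) (pp i) \<partial>count_space {..k0}) (1 / pp i))"
      using p0 by (simp add: ennpowr_prod ennpowr_ennpowr)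
    also have "\<dots> \<le> (\<Prod>i\<in>?I. ennreal (Ch i * V (k0 + l i) powr (lam i / n)) * M i)"
    proof (rule prod_mono_ennreal)
      fix i assume i: "i \<in> ?I"
      \<comment> \<open>Reindexing moves the cutoff to \<open>k0 + l i\<close>; the Morrey factor of
        the i-th source is therefore taken there.\<close>
      have "(\<integral>\<^sup>+k. ennpowr (X i (k + l i)) (pp i) \<partial>count_space {..k0}) = (\<integral>\<^sup>+k. ennpowr (X i k) (pp i) \<partial>count_space {..k0 + l i})"
        by (rule nn_integral_bij_count_space) (auto intro!: bij_betwI[of _ _ _ "\<lambda>k. k - l i"])
      moreover have "f i \<in> borel_measurable lebesgue"
        using f[OF i] by (intro measurable_completion) simp
      ultimately show "ennpowr (\<integral>\<^sup>+k. ennpowr (X i (k + l i)) (pp i) \<partial>count_space {..k0}) (1 / pp i)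
          \<le> ennreal (Ch i * V (k0 + l i) powr (lam i / n)) * M i"
        using Ch(2)[OF i, of "f i" "k0 + l i"] by (simp add: X_def F_def M_def)
    qed
    finally have "ennpowr (\<integral>\<^sup>+k. ennpowr (ennreal (V k powr (\<alpha>s / n)) * P k) p \<partial>count_space {..k0}) (1 / p)
        \<le> ennreal B * (\<Prod>i\<in>?I. ennreal (Ch i * V (k0 + l i) powr (lam i / n)) * M i)"
      by (simp add: mult_left_mono)
    then have "ennreal (V k0 powr (- lams / n)) * ennpowr (\<integral>\<^sup>+k. ennpowr (ennreal (V k powr (\<alpha>s / n)) * P k) p \<partial>count_space {..k0}) (1 / p)
        \<le> ennreal (V k0 powr (- lams / n)) * (ennreal B * (\<Prod>i\<in>?I. ennreal (Ch i * V (k0 + l i) powr (lam i / n)) * M i))"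
      by (intro mult_left_mono) auto
    also have "(\<Prod>i\<in>?I. ennreal (Ch i * V (k0 + l i) powr (lam i / n)) * M i)
        = ennreal (\<Prod>i\<in>?I. Ch i * V (k0 + l i) powr (lam i / n)) * (\<Prod>i\<in>?I. M i)"
      using nn by (intro prod_mult_ennreal mult_nonneg_nonneg) auto
    also have "ennreal (V k0 powr (- lams / n)) * (ennreal B * \<dots>)
        = ennreal (V k0 powr (- lams / n) * (B * (\<Prod>i\<in>?I. Ch i * V (k0 + l i) powr (lam i / n)))) * (\<Prod>i\<in>?I. M i)"
    proof -
      have "0 \<le> (\<Prod>i\<in>?I. Ch i * V (k0 + l i) powr (lam i / n))"
        using nn by (intro prod_nonneg mult_nonneg_nonneg) auto
      then show ?thesis
        using B by (simp add: ennreal_mult mult.assoc)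
    qed
    also have "V k0 powr (- lams / n) * (B * (\<Prod>i\<in>?I. Ch i * V (k0 + l i) powr (lam i / n)))
        = B * (\<Prod>i\<in>?I. Ch i * (V k0 powr (- lam i / n) * V (k0 + l i) powr (lam i / n)))"
    proof -
      \<comment> \<open>As \<open>lams\<close> is the sum of the \<open>lam i\<close>, every factor
        gets its own Morrey power at \<open>k0\<close> to compare with the one at
        \<open>k0 + l i\<close>.\<close>
      have "V k0 powr (- lams / n) = (\<Prod>i\<in>?I. V k0 powr (- lam i / n))"
        using V_pos[of k0] by (simp add: lams sum_divide_distrib powr_sum[symmetric] sum_negf)
      then show ?thesis by (simp add: prod.distrib mult_ac)
    qed
    also have "ennreal \<dots> * (\<Prod>i\<in>?I. M i) \<le> ennreal (B * (\<Prod>i\<in>?I. Ch i * (Cm i * morrey_gain i (norm (A i))))) * (\<Prod>i\<in>?I. M i)"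
      using B nn
      by (intro mult_right_mono ennreal_leI mult_left_mono prod_mono conjI Cm(2) nA l mult_nonneg_nonneg) auto
    also have "B * (\<Prod>i\<in>?I. Ch i * (Cm i * morrey_gain i (norm (A i))))
        = CR powr (1 / qs) * (\<Prod>i\<in>?I. c i * C1 * (Ch i * Cm i)) * (\<Prod>i\<in>?I. d i * gain i (norm (A i)) powr (1 / real m))"
      by (simp add: B_def prod.distrib mult_ac flip: gain_root)
    also have "ennreal \<dots> * (\<Prod>i\<in>?I. M i) = ennreal (CR powr (1 / qs) * (\<Prod>i\<in>?I. c i * C1 * (Ch i * Cm i)))
        * (\<Prod>i\<in>?I. ennreal (d i * gain i (norm (A i)) powr (1 / real m)) * M i)"
    proof -
      have "0 \<le> (\<Prod>i\<in>?I. c i * C1 * (Ch i * Cm i))"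
        using nn by (intro prod_nonneg mult_nonneg_nonneg) auto
      moreover have "(\<Prod>i\<in>?I. ennreal (d i * gain i (norm (A i)) powr (1 / real m)) * M i)
          = ennreal (\<Prod>i\<in>?I. d i * gain i (norm (A i)) powr (1 / real m)) * (\<Prod>i\<in>?I. M i)"
        using d by (intro prod_mult_ennreal) auto
      ultimately show ?thesis
        using d by (simp add: ennreal_mult prod_nonneg mult.assoc)
    qed
    finally show "ennreal (V k0 powr (- lams / n)) * ball_sum A f k0
      \<le> ennreal (CR powr (1 / qs) * (\<Prod>i\<in>?I. c i * C1 * (Ch i * Cm i)))
        * (\<Prod>i=1..m. ennreal (factor i (A i))
          * source_norm i (f i))"
      by (simp add: P_def d_def M_def)
  qed
qed

end

subsection \<open>The Hausdorff operator\<close>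

text \<open>\<Phi> and the matrices are only Lebesgue measurable, so the product arguments run over
  \<open>lebesgue\<close> instead of \<open>lborel\<close>.\<close>

lemma sigma_finite_lebesgue: "sigma_finite_measure (lebesgue :: (real ^ 'n) measure)"
proof (rule sigma_finite_measure.intro)
  show "\<exists>S. countable S \<and> S \<subseteq> sets lebesgue \<and> \<Union> S = space lebesgue
      \<and> (\<forall>a\<in>S. emeasure lebesgue (a :: (real ^ 'n) set) \<noteq> \<infinity>)"
  proof (intro exI[of _ "range (\<lambda>i::nat. cball 0 (real i))"] conjI)
    show "\<Union> (range (\<lambda>i::nat. cball 0 (real i))) = space (lebesgue :: (real ^ 'n) measure)"
      using real_arch_simple by (auto simp: dist_norm)
  qed (auto simp: emeasure_cball)
qed

interpretation lebesgue_pair: pair_sigma_finite "lebesgue :: (real ^ 'n) measure" "lebesgue :: (real ^ 'm) measure"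
  by (intro pair_sigma_finite.intro sigma_finite_lebesgue)

text \<open>On singular matrices \<open>matrix_inv\<close> is a choice from an unsatisfiable
  predicate, hence one fixed matrix. The determinant is thus constant there, which gives
  measurability in the argument.\<close>

lemma det_matrix_inv:
  fixes A :: "real ^ 'n ^ 'n"
  shows "det (matrix_inv A) = (if det A = 0 then det (SOME B :: real ^ 'n ^ 'n. False) else inverse (det A))"
proof (cases "det A = 0")
  case True
  then have "\<not> invertible A" by (simp add: invertible_det_nz)
  then have eq: "(A ** B = mat 1 \<and> B ** A = mat 1) = False" for B
    by (auto simp: invertible_def)
  show ?thesis
    unfolding matrix_inv_def eq using True by simp
next
  case False
  then have "invertible A" by (simp add: invertible_det_nz)
  then have "matrix_inv A ** A = mat 1"
    unfolding matrix_inv_def invertible_def using someI_ex[of "\<lambda>B. A ** B = mat 1 \<and> B ** A = mat 1"] by blast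
  then have "det (matrix_inv A) * det A = 1"
    by (metis det_I det_mul)
  with False show ?thesis by (simp add: field_simps)
qed

lemma borel_measurable_det_matrix_inv [measurable (raw)]:
  fixes A :: "'a \<Rightarrow> real ^ 'n ^ 'n"
  assumes [measurable]: "A \<in> borel_measurable M"
  shows "(\<lambda>y. det (matrix_inv (A y))) \<in> borel_measurable M"
proof -
  have "continuous_on UNIV (\<lambda>B :: real ^ 'n ^ 'n. det B)"
    unfolding det_def by (intro continuous_intros)
  then have [measurable]: "(\<lambda>y. det (A y)) \<in> borel_measurable M"
    by (rule borel_measurable_continuous_on) measurable
  show ?thesis
    unfolding det_matrix_inv by measurable
qed

lemma norm_hausdorff_integrand:
  "ennreal (norm (hausdorff_integrand m \<Phi> A f x y))
    = ennreal (norm (\<Phi> y) / norm y ^ CARD('n)) * (\<Prod>i=1..m. ennreal (norm (f i (A i y *v x))))"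
  for y :: "real ^ 'n"
proof -
  have "norm (hausdorff_integrand m \<Phi> A f x y)
      = norm (\<Phi> y) / norm y ^ CARD('n) * (\<Prod>i=1..m. norm (f i (A i y *v x)))"
    by (simp add: hausdorff_integrand_def norm_mult norm_divide norm_power prod_norm)
  then show ?thesis
    by (simp only: ennreal_mult divide_nonneg_nonneg norm_ge_zero zero_le_power prod_nonneg prod_ennreal)
qed

lemma id_measurable_lebesgue_borel [measurable]: "(\<lambda>x. x) \<in> borel_measurable (lebesgue :: (real ^ 'n) measure)"
  by (intro measurable_completion) simp

lemma lebesgue_pair_matrix_vector_measurable:
  fixes A :: "real ^ 'n \<Rightarrow> real ^ 'n ^ 'n"
  assumes "A \<in> borel_measurable lebesgue"
  shows "(\<lambda>z. A (snd z) *v fst z) \<in> borel_measurable (lebesgue \<Otimes>\<^sub>M lebesgue)"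
  by (intro borel_measurable_matrix_vector_mult measurable_compose[OF measurable_snd assms]
      measurable_compose[OF measurable_fst id_measurable_lebesgue_borel])

abbreviation "hausdorff_majorant m \<Phi> A f x \<equiv> \<integral>\<^sup>+y. ennreal (norm (hausdorff_integrand m \<Phi> A f x y)) \<partial>lebesgue"

text \<open>The \<open>f i\<close> are taken Borel: composing a merely Lebesgue measurable function
  with the joint map \<open>A y *v x\<close> need not be measurable for the product
  sigma-algebra.\<close>

lemma hausdorff_integrand_measurable:
  fixes \<Phi> :: "real ^ 'n \<Rightarrow> complex"
  assumes [measurable]: "\<Phi> \<in> borel_measurable lebesgue"
    and A [measurable]: "\<And>i. i \<in> {1..m} \<Longrightarrow> A i \<in> borel_measurable lebesgue"
    and f [measurable]: "\<And>i. i \<in> {1..m} \<Longrightarrow> f i \<in> borel_measurable borel"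
  shows "(\<lambda>(x, y). hausdorff_integrand m \<Phi> A f x y) \<in> borel_measurable (lebesgue \<Otimes>\<^sub>M lebesgue)"
proof -
  have [measurable]: "snd \<in> borel_measurable ((lebesgue :: (real ^ 'n) measure) \<Otimes>\<^sub>M (lebesgue :: (real ^ 'n) measure))"
    by (rule measurable_compose[OF measurable_snd id_measurable_lebesgue_borel])
  have "(\<lambda>z. f i (A i (snd z) *v fst z)) \<in> borel_measurable (lebesgue \<Otimes>\<^sub>M lebesgue)" if i: "i \<in> {1..m}" for i
    using measurable_compose[OF lebesgue_pair_matrix_vector_measurable[OF A[OF i]] f[OF i]] .
  then show ?thesis
    unfolding hausdorff_integrand_def case_prod_beta by measurable
qed

context two_weighted_exponents
begin

abbreviation "hausdorff_const_B2 \<Phi> A \<equiv> hausdorff_const m \<Phi> A \<xi> qq (\<lambda>i. B2_factor m qs \<alpha>s \<xi> \<eta> \<delta>1 \<delta>2 (lam i) (A i))"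

lemma gain_eq_B2_factor: "B2_factor m qs \<alpha>s \<xi> \<eta> \<delta>1 \<delta>2 (lam i) A y = gain i (norm (A y))"
  for A :: "real ^ 'n \<Rightarrow> real ^ 'n ^ 'n"
  unfolding B2_factor_def gain_def \<theta>1_def \<theta>2_def n_def[symmetric] by (simp add: mult.assoc)

text \<open>Hoelder in \<open>y\<close> with \<open>m\<close> equal weights 1/m, after the kernel
  has been written as the product of its \<open>m\<close> equal roots.\<close>

lemma nn_integral_gain_le_hausdorff_const:
  fixes \<Phi> :: "real ^ 'n \<Rightarrow> complex"
  assumes [measurable]: "\<Phi> \<in> borel_measurable lebesgue"
    and A: "\<And>i. i \<in> {1..m} \<Longrightarrow> A i \<in> borel_measurable lebesgue"
  shows "(\<integral>\<^sup>+y. ennreal (norm (\<Phi> y) / norm y ^ CARD('n)) * (\<Prod>i=1..m. ennreal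
      (factor i (A i y))) \<partial>lebesgue)
    \<le> hausdorff_const_B2 \<Phi> A"
proof -
  define \<phi> where "\<phi> y = norm (\<Phi> y) / norm y ^ CARD('n)" for y
  have \<phi>: "0 \<le> \<phi> y" for y by (simp add: \<phi>_def)
  define h where "h i y = \<bar>det (matrix_inv (A i y))\<bar> powr (real m * \<xi> / qq i)
            * norm (A i y) powr (real m * \<xi> * n / qq i) * gain i (norm (A i y))" for i y
  have g0: "0 \<le> gain i t" for i t by (simp add: gain_def)
  then have h0: "0 \<le> h i y" for i y by (simp add: h_def)
  have [measurable]: "\<phi> \<in> borel_measurable lebesgue"
    unfolding \<phi>_def by measurable
  have hm: "h i \<in> borel_measurable lebesgue" if "i \<in> {1..m}" for i
  proof -
    note [measurable] = A[OF that]
    show ?thesis unfolding h_def gain_def by measurable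
  qed
  have "(\<integral>\<^sup>+y. ennreal (\<phi> y) * (\<Prod>i=1..m. ennreal
      (factor i (A i y))) \<partial>lebesgue)
      = (\<integral>\<^sup>+y. (\<Prod>i=1..m. ennpowr (ennreal (\<phi> y * h i y)) (1 / real m)) \<partial>lebesgue)"
  proof (rule nn_integral_cong)
    fix y
    have "ennpowr (ennreal (\<phi> y * h i y)) (1 / real m) = ennreal (\<phi> y powr (1 / real m)) *
        ennreal (factor i (A i y))" for i
      using \<phi>[of y] h0[of i y] g0[of i "norm (A i y)"] m_pos
      by (simp add: ennpowr_ennreal_nonneg h_def powr_mult powr_powr flip: ennreal_mult)
    then have "(\<Prod>i=1..m. ennpowr (ennreal (\<phi> y * h i y)) (1 / real m)) = (\<Prod>i=1..m. ennreal (\<phi> y powr (1 / real m))) *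
        (\<Prod>i=1..m. ennreal (factor i (A i y)))"
      by (simp add: prod.distrib)
    moreover have "(\<Prod>i=1..m. ennreal (\<phi> y powr (1 / real m))) = ennreal (\<phi> y)"
    proof (cases "\<phi> y = 0")
      case False
      then have "0 < \<phi> y" using \<phi>[of y] by simp
      then show ?thesis
        using m_pos by (simp add: ennreal_power powr_powr flip: powr_realpow)
    qed (use m in simp)
    ultimately show "ennreal (\<phi> y) * (\<Prod>i=1..m. ennreal
      (factor i (A i y))) = (\<Prod>i=1..m. ennpowr (ennreal (\<phi> y * h i y)) (1 / real m))"
      by simp
  qed
  also have "\<dots> \<le> (\<Prod>i=1..m. ennpowr (\<integral>\<^sup>+y. ennreal (\<phi> y * h i y) \<partial>lebesgue) (1 / real m))"
    using m_pos hm by (intro nn_integral_prod_ennpowr_le) auto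
  also have "\<dots> = hausdorff_const_B2 \<Phi> A"
    unfolding hausdorff_const_def gain_eq_B2_factor \<phi>_def h_def n_def by (simp add: mult.assoc)
  finally show ?thesis by (simp add: \<phi>_def)
qed

text \<open>Minkowski is used twice, in the weighted space of order \<open>qs\<close> on each
  annulus and then in the sum over \<open>k\<close>. Between the two, annuli are enlarged to balls,
  as the estimate for fixed \<open>y\<close> requires.\<close>

lemma minkowski_herz_sum:
  fixes \<Phi> :: "real ^ 'n \<Rightarrow> complex"
  assumes \<Phi>: "\<Phi> \<in> borel_measurable lebesgue"
    and A: "\<And>i. i \<in> {1..m} \<Longrightarrow> A i \<in> borel_measurable lebesgue"
    and f: "\<And>i. i \<in> {1..m} \<Longrightarrow> f i \<in> borel_measurable borel"
  shows "annulus_sum (\<lambda>x. ennpowr (hausdorff_majorant m \<Phi> A f x) qs * ennreal (\<omega> x)) k0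
    \<le> (\<integral>\<^sup>+y. ennreal (norm (\<Phi> y) / norm y ^ CARD('n)) * ball_sum (\<lambda>i. A i y) f k0 \<partial>lebesgue)"
proof -
  define \<phi> where "\<phi> y = ennreal (norm (\<Phi> y) / norm y ^ CARD('n))" for y
  have [measurable]: "\<phi> \<in> borel_measurable lebesgue"
    using \<Phi> unfolding \<phi>_def by measurable
  have [measurable]: "\<omega> \<in> borel_measurable lebesgue"
    using weights(1) by (rule weight_measurable)
  define F where "F x y = ennreal (norm (hausdorff_integrand m \<Phi> A f x y))" for x y
  have Fm [measurable]: "(\<lambda>(x, y). F x y) \<in> borel_measurable (lebesgue \<Otimes>\<^sub>M lebesgue)"
    using hausdorff_integrand_measurable[OF \<Phi> A f] unfolding F_def case_prod_beta by measurable
  define G where "G x y = (\<Prod>i=1..m. ennpowr (ennreal (norm (f i (A i y *v x)))) qs)" for x y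
  have FG: "ennpowr (F x y) qs = ennpowr (\<phi> y) qs * G x y" for x y
    using qs by (simp add: F_def norm_hausdorff_integrand \<phi>_def G_def ennpowr_mult ennpowr_prod)
  have Gm [measurable]: "(\<lambda>(x, y). G x y) \<in> borel_measurable (lebesgue \<Otimes>\<^sub>M lebesgue)"
  proof -
    have "(\<lambda>z. f i (A i (snd z) *v fst z)) \<in> borel_measurable (lebesgue \<Otimes>\<^sub>M lebesgue)" if i: "i \<in> {1..m}" for i
      using measurable_compose[OF lebesgue_pair_matrix_vector_measurable[OF A[OF i]] f[OF i]] .
    then show ?thesis
      unfolding G_def case_prod_beta by measurable
  qed
  define P where "P k y = ennpowr (\<integral>\<^sup>+x\<in>dyadic_ball k. G x y * ennreal (\<omega> x) \<partial>lebesgue) (1 / qs)" for k y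
  have Pm [measurable]: "P k \<in> borel_measurable lebesgue" for k
  proof -
    have "(\<lambda>(y, x). G x y) \<in> borel_measurable (lebesgue \<Otimes>\<^sub>M lebesgue)"
      using Gm by (subst (asm) measurable_pair_swap_iff) (simp add: case_prod_unfold)
    then have "(\<lambda>(y, x). G x y * ennreal (\<omega> x) * indicator (dyadic_ball k) x) \<in> borel_measurable (lebesgue \<Otimes>\<^sub>M lebesgue)"
      by measurable
    then show ?thesis
      unfolding P_def
      by (intro borel_measurable_ennpowr sigma_finite_measure.borel_measurable_nn_integral[OF sigma_finite_lebesgue])
  qed

  have step1: "ennpowr (\<integral>\<^sup>+x\<in>dyadic_annulus k. ennpowr (\<integral>\<^sup>+y. F x y \<partial>lebesgue) qs * ennreal (\<omega> x) \<partial>lebesgue) (1 / qs)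
      \<le> (\<integral>\<^sup>+y. \<phi> y * P k y \<partial>lebesgue)" for k
  proof -
    \<comment> \<open>The weight and the annulus enter as a factor independent of \<open>y\<close>,
      which reduces weighted Minkowski to the unweighted one.\<close>
    define w1 where "w1 x = ennpowr (ennreal (\<omega> x)) (1 / qs) * indicator (dyadic_annulus k) x" for x
    have [measurable]: "w1 \<in> borel_measurable lebesgue"
      unfolding w1_def by measurable
    have w1: "ennpowr (w1 x) qs = ennreal (\<omega> x) * indicator (dyadic_annulus k) x" for x
      using qs by (cases "x \<in> dyadic_annulus k") (simp_all add: w1_def ennpowr_ennpowr)
    have [measurable]: "F x \<in> borel_measurable lebesgue" for x
      using measurable_Pair2[OF Fm, of x] by simp
    have "(\<integral>\<^sup>+x\<in>dyadic_annulus k. ennpowr (\<integral>\<^sup>+y. F x y \<partial>lebesgue) qs * ennreal (\<omega> x) \<partial>lebesgue)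
        = (\<integral>\<^sup>+x. ennpowr (\<integral>\<^sup>+y. F x y * w1 x \<partial>lebesgue) qs \<partial>lebesgue)"
      using qs by (simp add: nn_integral_multc ennpowr_mult w1 mult.assoc)
    also have "\<dots> \<le> ennpowr (\<integral>\<^sup>+y. ennpowr (\<integral>\<^sup>+x. ennpowr (F x y * w1 x) qs \<partial>lebesgue) (1 / qs) \<partial>lebesgue) qs"
      using qs by (intro lebesgue_pair.nn_integral_minkowski) measurable
    finally have "ennpowr (\<integral>\<^sup>+x\<in>dyadic_annulus k. ennpowr (\<integral>\<^sup>+y. F x y \<partial>lebesgue) qs * ennreal (\<omega> x) \<partial>lebesgue) (1 / qs)
        \<le> ennpowr \<dots> (1 / qs)"
      using qs by (intro ennpowr_mono) auto
    also have "\<dots> = (\<integral>\<^sup>+y. ennpowr (\<integral>\<^sup>+x. ennpowr (F x y * w1 x) qs \<partial>lebesgue) (1 / qs) \<partial>lebesgue)"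
      using qs by (simp add: ennpowr_ennpowr)
    also have "\<dots> \<le> (\<integral>\<^sup>+y. \<phi> y * P k y \<partial>lebesgue)"
    proof (rule nn_integral_mono)
      fix y
      have [measurable]: "(\<lambda>x. G x y) \<in> borel_measurable lebesgue"
        using measurable_Pair1[OF Gm, of y] by simp
      \<comment> \<open>Here the annulus is replaced by the ball.\<close>
      have "(\<integral>\<^sup>+x. ennpowr (F x y * w1 x) qs \<partial>lebesgue)
          \<le> (\<integral>\<^sup>+x. ennpowr (\<phi> y) qs * (G x y * ennreal (\<omega> x) * indicator (dyadic_ball k) x) \<partial>lebesgue)"
        using qs by (intro nn_integral_mono)
          (auto simp: ennpowr_mult FG w1 mult.assoc dyadic_annulus_def indicator_def intro!: mult_left_mono)
      also have "\<dots> = ennpowr (\<phi> y) qs * (\<integral>\<^sup>+x\<in>dyadic_ball k. G x y * ennreal (\<omega> x) \<partial>lebesgue)"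
        by (rule nn_integral_cmult) measurable
      finally have "ennpowr (\<integral>\<^sup>+x. ennpowr (F x y * w1 x) qs \<partial>lebesgue) (1 / qs) \<le> ennpowr \<dots> (1 / qs)"
        using qs by (intro ennpowr_mono) auto
      also have "\<dots> = \<phi> y * P k y"
        using qs by (simp add: ennpowr_mult ennpowr_ennpowr P_def)
      finally show "ennpowr (\<integral>\<^sup>+x. ennpowr (F x y * w1 x) qs \<partial>lebesgue) (1 / qs) \<le> \<phi> y * P k y" .
    qed
    finally show ?thesis .
  qed

  interpret KL: pair_sigma_finite "count_space {..k0}" "lebesgue :: (real ^ 'n) measure"
    by (intro count_space_pair_sigma_finite sigma_finite_lebesgue) auto
  let ?a = "\<lambda>k. ennreal (V k powr (\<alpha>s / n))"
  have "ennpowr (\<integral>\<^sup>+k. ennpowr (?a k * ennpowr (\<integral>\<^sup>+x\<in>dyadic_annulus k. ennpowr (\<integral>\<^sup>+y. F x y \<partial>lebesgue) qs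
            * ennreal (\<omega> x) \<partial>lebesgue) (1 / qs)) p \<partial>count_space {..k0}) (1 / p)
      \<le> ennpowr (\<integral>\<^sup>+k. ennpowr (?a k * (\<integral>\<^sup>+y. \<phi> y * P k y \<partial>lebesgue)) p \<partial>count_space {..k0}) (1 / p)"
    using p step1 by (intro ennpowr_mono nn_integral_mono mult_left_mono) auto
  also have "\<dots> = ennpowr (\<integral>\<^sup>+k. ennpowr (\<integral>\<^sup>+y. ?a k * (\<phi> y * P k y) \<partial>lebesgue) p \<partial>count_space {..k0}) (1 / p)"
    by (simp add: nn_integral_cmult)
  also have "\<dots> \<le> ennpowr (ennpowr (\<integral>\<^sup>+y. ennpowr (\<integral>\<^sup>+k. ennpowr (?a k * (\<phi> y * P k y)) p \<partial>count_space {..k0}) (1 / p) \<partial>lebesgue) p) (1 / p)"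
    using p by (intro ennpowr_mono KL.nn_integral_minkowski measurable_pair_measure_countable1) auto
  also have "\<dots> = (\<integral>\<^sup>+y. ennpowr (\<integral>\<^sup>+k. ennpowr (?a k * (\<phi> y * P k y)) p \<partial>count_space {..k0}) (1 / p) \<partial>lebesgue)"
    using p by (simp add: ennpowr_ennpowr)
  also have "\<dots> = (\<integral>\<^sup>+y. \<phi> y * ennpowr (\<integral>\<^sup>+k. ennpowr (?a k * P k y) p \<partial>count_space {..k0}) (1 / p) \<partial>lebesgue)"
  proof (rule nn_integral_cong)
    fix y
    have "(\<integral>\<^sup>+k. ennpowr (?a k * (\<phi> y * P k y)) p \<partial>count_space {..k0})
        = (\<integral>\<^sup>+k. ennpowr (\<phi> y) p * ennpowr (?a k * P k y) p \<partial>count_space {..k0})"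
      using p by (simp add: ennpowr_mult mult_ac)
    also have "\<dots> = ennpowr (\<phi> y) p * (\<integral>\<^sup>+k. ennpowr (?a k * P k y) p \<partial>count_space {..k0})"
      by (rule nn_integral_cmult) simp
    finally show "ennpowr (\<integral>\<^sup>+k. ennpowr (?a k * (\<phi> y * P k y)) p \<partial>count_space {..k0}) (1 / p)
        = \<phi> y * ennpowr (\<integral>\<^sup>+k. ennpowr (?a k * P k y) p \<partial>count_space {..k0}) (1 / p)"
      using p by (simp add: ennpowr_mult ennpowr_ennpowr)
  qed
  finally show ?thesis
    unfolding F_def \<phi>_def P_def G_def .
qed

lemma hausdorff_borel_estimate:
  fixes \<Phi> :: "real ^ 'n \<Rightarrow> complex"
  assumes \<Phi>: "\<Phi> \<in> borel_measurable lebesgue"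
    and A: "\<And>i. i \<in> {1..m} \<Longrightarrow> A i \<in> borel_measurable lebesgue"
    and A_det: "\<And>i. i \<in> {1..m} \<Longrightarrow> AE y in lebesgue. \<Phi> y \<noteq> 0 \<longrightarrow> det (A i y) \<noteq> 0"
    and fin: "hausdorff_const_B2 \<Phi> A < \<infinity>"
  obtains C :: real where "\<And>f k0. (\<And>i. i \<in> {1..m} \<Longrightarrow> f i \<in> borel_measurable borel) \<Longrightarrow>
    ennreal (V k0 powr (- lams / n)) * annulus_sum (\<lambda>x. ennpowr (hausdorff_majorant m \<Phi> A f x) qs * ennreal (\<omega> x)) k0
      \<le> ennreal C * (\<Prod>i=1..m. source_norm i (f i))"
proof -
  let ?K = "hausdorff_const_B2 \<Phi> A"
  obtain D where D: "0 < D"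
    "\<And>A f k0. (\<And>i. i \<in> {1..m} \<Longrightarrow> det (A i) \<noteq> 0) \<Longrightarrow> (\<And>i. i \<in> {1..m} \<Longrightarrow> f i \<in> borel_measurable borel) \<Longrightarrow>
      ennreal (V k0 powr (- lams / n)) * ball_sum A f k0
      \<le> ennreal D * (\<Prod>i=1..m. ennreal (factor i (A i))
          * source_norm i (f i))"
    using pointwise_estimate by blast
  show ?thesis
  \<comment> \<open>Finiteness of \<open>?K\<close> makes the passage to a real constant
    lossless.\<close>
  proof (rule that[of "D * enn2real ?K"])
    fix f :: "nat \<Rightarrow> real ^ 'n \<Rightarrow> complex" and k0
    assume f: "\<And>i. i \<in> {1..m} \<Longrightarrow> f i \<in> borel_measurable borel"
    define M where "M = (\<Prod>i=1..m. source_norm i (f i))"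
    define \<phi> where "\<phi> y = ennreal (norm (\<Phi> y) / norm y ^ CARD('n))" for y
    define H where "H y = (\<Prod>i=1..m. ennreal (factor i (A i y)))" for y
    define Q where "Q y = ball_sum (\<lambda>i. A i y) f k0" for y
    have [measurable]: "\<phi> \<in> borel_measurable lebesgue"
      using \<Phi> unfolding \<phi>_def by measurable
    have [measurable]: "H \<in> borel_measurable lebesgue"
    proof -
      have "(\<lambda>y. ennreal (factor i (A i y))) \<in> borel_measurable lebesgue" if "i \<in> {1..m}" for i
      proof -
        note [measurable] = A[OF that]
        show ?thesis unfolding gain_def by measurable
      qed
      then show ?thesis
        unfolding H_def by (intro borel_measurable_prod_ennreal)
    qed
    \<comment> \<open>The Morrey factor is moved to the right before integrating and restored
      afterwards. In this way constants are pulled only out of the integral of the measurable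
      function \<open>\<phi> y * H y\<close>, and \<open>Q\<close> is compared by monotonicity
      alone.\<close>
    let ?c = "ennreal (V k0 powr (- lams / n))" and ?d = "ennreal (1 / V k0 powr (- lams / n))"
    have cd: "?c * ?d = 1"
      using V_pos[of k0] by (simp flip: ennreal_mult)
    have "AE y in lebesgue. \<forall>i\<in>{1..m}. \<Phi> y \<noteq> 0 \<longrightarrow> det (A i y) \<noteq> 0"
      using A_det by (subst AE_finite_all) auto
    then have ae: "AE y in lebesgue. \<phi> y * Q y \<le> ?d * (ennreal D * M) * (\<phi> y * H y)"
    proof eventually_elim
      case (elim y)
      show ?case
      proof (cases "\<Phi> y = 0")
        case True
        then show ?thesis by (simp add: \<phi>_def)
      next
        case False
        then have "?c * Q y \<le> ennreal D * (H y * M)"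
          using D(2)[of "\<lambda>i. A i y" f k0] elim f unfolding Q_def H_def M_def prod.distrib by blast
        then have "Q y \<le> ?d * (ennreal D * (H y * M))"
          using V_pos[of k0] by (intro ennreal_mult_le_imp_le_divide) simp
        then have "\<phi> y * Q y \<le> \<phi> y * (?d * (ennreal D * (H y * M)))"
          by (rule mult_left_mono) simp
        then show ?thesis by (simp only: mult_ac)
      qed
    qed
    have "(\<integral>\<^sup>+y. \<phi> y * Q y \<partial>lebesgue) \<le> (\<integral>\<^sup>+y. ?d * (ennreal D * M) * (\<phi> y * H y) \<partial>lebesgue)"
      using ae by (rule nn_integral_mono_AE)
    also have "\<dots> = ?d * (ennreal D * M) * (\<integral>\<^sup>+y. \<phi> y * H y \<partial>lebesgue)"
      by (rule nn_integral_cmult) measurable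
    also have "\<dots> \<le> ?d * (ennreal D * M) * ?K"
      using nn_integral_gain_le_hausdorff_const[OF \<Phi> A] unfolding \<phi>_def H_def
      by (intro mult_left_mono) auto
    also have "\<dots> = ?d * (ennreal (D * enn2real ?K) * M)"
      using D(1) fin by (simp add: ennreal_mult mult_ac)
    finally have "?c * (\<integral>\<^sup>+y. \<phi> y * Q y \<partial>lebesgue) \<le> ?c * (?d * (ennreal (D * enn2real ?K) * M))"
      by (rule mult_left_mono) simp
    then have "?c * (\<integral>\<^sup>+y. \<phi> y * Q y \<partial>lebesgue) \<le> ennreal (D * enn2real ?K) * M"
      by (simp only: mult.assoc[symmetric] cd mult_1)
    then show "?c * annulus_sum (\<lambda>x. ennpowr (hausdorff_majorant m \<Phi> A f x) qs * ennreal (\<omega> x)) k0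
      \<le> ennreal (D * enn2real ?K) * (\<Prod>i=1..m. source_norm i (f i))"
      unfolding M_def
    proof (rule order_trans[rotated])
      show "?c * annulus_sum (\<lambda>x. ennpowr (hausdorff_majorant m \<Phi> A f x) qs * ennreal (\<omega> x)) k0 \<le> ?c * (\<integral>\<^sup>+y. \<phi> y * Q y \<partial>lebesgue)"
        unfolding \<phi>_def Q_def using \<Phi> A f by (intro mult_left_mono minkowski_herz_sum) auto
    qed
  qed
qed

end

section \<open>Null sets, Borel representatives and compact sets off the origin\<close>

lemma borel_measurable_lebesgue_cong_AE:
  fixes f g :: "real ^ 'n \<Rightarrow> 'b :: topological_space"
  assumes f: "f \<in> borel_measurable lebesgue" and ae: "AE x in lebesgue. f x = g x"
  shows "g \<in> borel_measurable lebesgue"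
proof (rule measurableI)
  fix B :: "'b set" assume B: "B \<in> sets borel"
  have 1: "f -` B \<inter> space lebesgue \<in> sets lebesgue"
    using f B by (rule measurable_sets)
  have 2: "AE x in lebesgue. x \<in> f -` B \<inter> space lebesgue \<longleftrightarrow> x \<in> g -` B \<inter> space lebesgue"
    using ae by eventually_elim auto
  show "g -` B \<inter> space lebesgue \<in> sets lebesgue"
    by (rule completion.in_sets_AE[OF 2 1]) auto
qed auto

lemma lebesgue_measurable_complex_borel:
  fixes f :: "real ^ 'n \<Rightarrow> complex"
  assumes "f \<in> borel_measurable lebesgue"
  obtains g where "g \<in> borel_measurable borel" "AE x in lebesgue. f x = g x"
proof -
  have "(\<lambda>x. Re (f x)) \<in> borel_measurable lebesgue"
    using assms by measurable
  from completion_ex_borel_measurable_real[OF this]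
  obtain u where u: "u \<in> borel_measurable lborel" "AE x in lborel. Re (f x) = u x" ..
  have "(\<lambda>x. Im (f x)) \<in> borel_measurable lebesgue"
    using assms by measurable
  from completion_ex_borel_measurable_real[OF this]
  obtain v where v: "v \<in> borel_measurable lborel" "AE x in lborel. Im (f x) = v x" ..
  have "AE x in lborel. f x = Complex (u x) (v x)"
    using u(2) v(2) by eventually_elim (simp add: complex_eq_iff)
  then have "AE x in lebesgue. f x = Complex (u x) (v x)"
    by (rule AE_completion)
  moreover have "(\<lambda>x. Complex (u x) (v x)) \<in> borel_measurable borel"
  proof -
    have "(\<lambda>x. complex_of_real (u x) + \<i> * complex_of_real (v x)) \<in> borel_measurable borel"
      using u(1) v(1) by measurable
    then show ?thesis by (simp add: Complex_eq)
  qed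
  ultimately show ?thesis using that by blast
qed

lemma AE_matrix_vector_not_in_null:
  fixes A :: "real ^ 'n ^ 'n" and N :: "(real ^ 'n) set"
  assumes A: "det A \<noteq> 0" and N: "N \<in> null_sets lborel"
  shows "AE x in lebesgue. A *v x \<notin> N"
proof -
  have [measurable]: "N \<in> sets borel" using N by auto
  have "(\<integral>\<^sup>+x. indicator N (A *v x) \<partial>lborel) = ennreal \<bar>det (matrix_inv A)\<bar> * (\<integral>\<^sup>+x. indicator N x \<partial>lborel)"
    by (rule nn_integral_lborel_matrix[OF A]) measurable
  also have "\<dots> = 0"
    using N by (simp add: null_setsD1)
  finally have "AE x in lborel. (indicator N (A *v x) :: ennreal) = 0"
    by (subst (asm) nn_integral_0_iff_AE) measurable
  then have "AE x in lborel. A *v x \<notin> N"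
    by eventually_elim (auto simp: indicator_def split: if_splits)
  then show ?thesis by (rule AE_completion)
qed

text \<open>For fixed \<open>y\<close> with invertible matrix the exceptional \<open>x\<close> form
  the preimage of a null set under a linear bijection, hence a null set. Fubini exchanges the two
  quantifiers.\<close>

lemma AE_matrix_vector_eq:
  fixes A :: "real ^ 'n \<Rightarrow> real ^ 'n ^ 'n" and f g :: "real ^ 'n \<Rightarrow> complex"
  assumes A [measurable]: "A \<in> borel_measurable lebesgue" and \<Phi> [measurable]: "\<Phi> \<in> borel_measurable lebesgue"
    and det: "AE y in lebesgue. \<Phi> y \<noteq> (0::complex) \<longrightarrow> det (A y) \<noteq> 0"
    and fg: "AE x in lebesgue. f x = g x"
  shows "AE x in lebesgue. AE y in lebesgue. \<Phi> y \<noteq> 0 \<longrightarrow> f (A y *v x) = g (A y *v x)"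
proof -
  have "AE x in lborel. f x = g x"
    using fg by (simp only: AE_completion_iff)
  \<comment> \<open>\<open>N\<close> is a Borel set containing the exceptional set, so its preimage
    on the product space is measurable and \<open>AE_commute\<close> applies.\<close>
  then obtain N where N: "{x \<in> space lborel. \<not> f x = g x} \<subseteq> N" "emeasure lborel N = 0" "N \<in> sets lborel"
    by (rule AE_E)
  then have N0: "N \<in> null_sets lborel" by auto
  have [measurable]: "N \<in> sets borel" using N by simp
  have "(\<lambda>z. A (snd z) *v fst z) \<in> borel_measurable ((lebesgue :: (real ^ 'n) measure) \<Otimes>\<^sub>M lebesgue)"
    using A by (rule lebesgue_pair_matrix_vector_measurable)
  then have meas: "{z \<in> space (lebesgue \<Otimes>\<^sub>M lebesgue). \<Phi> (snd z) \<noteq> 0 \<longrightarrow> A (snd z) *v fst z \<notin> N}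
      \<in> sets ((lebesgue :: (real ^ 'n) measure) \<Otimes>\<^sub>M lebesgue)"
    by measurable
  have "AE y in lebesgue. AE x in lebesgue. \<Phi> y \<noteq> 0 \<longrightarrow> A y *v x \<notin> N"
    using det
  proof eventually_elim
    case (elim y)
    then show ?case
      using AE_matrix_vector_not_in_null[OF _ N0, of "A y"] by (cases "\<Phi> y = 0") auto
  qed
  then have "AE x in lebesgue. AE y in lebesgue. \<Phi> y \<noteq> 0 \<longrightarrow> A y *v x \<notin> N"
    using lebesgue_pair.AE_commute[OF meas] by simp
  then show ?thesis
  proof eventually_elim
    case (elim x)
    then show ?case
      by eventually_elim (use N(1) in auto)
  qed
qed

lemma morrey_herz_norm_cong_AE:
  assumes "AE x in lebesgue. f x = g x"
  shows "morrey_herz_norm v w \<alpha> lam p q f = morrey_herz_norm v w \<alpha> lam p q g"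
proof -
  have "wLq_norm w q (\<lambda>x. f x * indicator (dyadic_annulus k) x) = wLq_norm w q (\<lambda>x. g x * indicator (dyadic_annulus k) x)" for k
    unfolding wLq_norm_def using assms
    by (intro arg_cong[of _ _ "\<lambda>t. ennpowr t (1 / q)"] nn_integral_cong_AE) (auto elim!: eventually_mono)
  then show ?thesis
    by (simp add: morrey_herz_norm_def)
qed

text \<open>Reduces the local integrability demanded in \<open>morrey_herz\<close> to finitely many
  annuli.\<close>

lemma compact_subset_annuli:
  fixes K :: "(real ^ 'n) set"
  assumes "compact K" "0 \<notin> K"
  obtains a b :: int where "K \<subseteq> (\<Union>j\<in>{a..b}. dyadic_annulus j)"
proof -
  obtain R where R: "0 < R" "\<And>x. x \<in> K \<Longrightarrow> norm x \<le> R"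
    using compact_imp_bounded[OF assms(1)] by (auto simp: bounded_pos)
  have "open (- K)" using assms(1) by (simp add: compact_imp_closed open_Compl)
  then obtain \<epsilon> where \<epsilon>: "0 < \<epsilon>" "ball 0 \<epsilon> \<subseteq> - K"
    using assms(2) by (meson ComplI openE)
  have ge: "\<epsilon> \<le> norm x" if "x \<in> K" for x
    using \<epsilon>(2) that by (force simp: subset_iff not_le)
  obtain b :: int where b: "R \<le> 2 powr of_int b"
    using dyadic_exponent_exists[OF R(1)] by metis
  obtain a :: int where a: "2 powr of_int (a - 1) < \<epsilon>"
    using dyadic_exponent_exists[OF \<epsilon>(1)] by metis
  show ?thesis
  proof (rule that[of "a" "b"], rule subsetI)
    fix x assume x: "x \<in> K"
    then have "0 < norm x" using assms(2) by auto
    then obtain l :: int where l: "norm x \<le> 2 powr of_int l" "2 powr of_int (l - 1) < norm x"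
      using dyadic_exponent_exists by metis
    have "2 powr of_int (l - 1) < (2::real) powr of_int b"
      using l(2) R(2)[OF x] b by linarith
    then have 1: "real_of_int (l - 1) < real_of_int b"
      by (subst (asm) powr_less_cancel_iff) auto
    have "2 powr of_int (a - 1) < (2::real) powr of_int l"
      using l(1) ge[OF x] a by linarith
    then have 2: "real_of_int (a - 1) < real_of_int l"
      by (subst (asm) powr_less_cancel_iff) auto
    have "l \<in> {a..b}" using 1 2 by auto
    moreover have "x \<in> dyadic_annulus l"
      using l by (simp add: dyadic_annulus_def dyadic_ball_def two_powi_eq_powr)
    ultimately show "x \<in> (\<Union>j\<in>{a..b}. dyadic_annulus j)" by blast
  qed
qed

lemma prod_less_top_ennreal:
  fixes a :: "'a \<Rightarrow> ennreal"
  assumes "\<And>i. i \<in> I \<Longrightarrow> a i < top"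
  shows "(\<Prod>i\<in>I. a i) < top"
  using assms by (induction I rule: infinite_finite_induct) (auto simp: ennreal_mult_less_top)

section \<open>Convergence and boundedness of the operator\<close>

context two_weighted_exponents
begin

text \<open>The annulus contributes one term to the sum with cutoff \<open>k\<close>. All its
  coefficients are positive reals, so finiteness is inherited by the integral.\<close>

lemma herz_sum_annulus_finite:
  fixes G :: "real ^ 'n \<Rightarrow> ennreal"
  assumes "ennreal (V k powr (- lams / n)) * annulus_sum G k < top"
  shows "(\<integral>\<^sup>+x\<in>dyadic_annulus k. G x \<partial>lebesgue) < top"
proof -
  let ?S = "\<integral>\<^sup>+j. ennpowr (ennreal (V j powr (\<alpha>s / n))
        * ennpowr (\<integral>\<^sup>+x\<in>dyadic_annulus j. G x \<partial>lebesgue) (1 / qs)) p \<partial>count_space {..k}"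
  have "ennpowr ?S (1 / p) \<noteq> top"
    using assms V_pos[of k] by (auto simp: ennreal_mult_top ennreal_eq_0_iff not_le)
  then have S: "?S < top"
    using p by (simp add: ennpowr_eq_top_iff less_top)
  have "ennpowr (ennreal (V k powr (\<alpha>s / n))
        * ennpowr (\<integral>\<^sup>+x\<in>dyadic_annulus k. G x \<partial>lebesgue) (1 / qs)) p \<le> ?S"
    by (rule nn_integral_ge_point) simp
  then have "ennpowr (ennreal (V k powr (\<alpha>s / n))
        * ennpowr (\<integral>\<^sup>+x\<in>dyadic_annulus k. G x \<partial>lebesgue) (1 / qs)) p < top"
    using S by (rule le_less_trans)
  then have "ennreal (V k powr (\<alpha>s / n)) * ennpowr (\<integral>\<^sup>+x\<in>dyadic_annulus k. G x \<partial>lebesgue) (1 / qs) \<noteq> top"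
    using p by (simp add: ennpowr_eq_top_iff less_top[symmetric])
  then have "ennpowr (\<integral>\<^sup>+x\<in>dyadic_annulus k. G x \<partial>lebesgue) (1 / qs) \<noteq> top"
    using V_pos[of k] by (auto simp: ennreal_mult_top ennreal_eq_0_iff not_le)
  then show ?thesis
    using qs by (simp add: ennpowr_eq_top_iff less_top)
qed

lemma \<omega>_AE_pos: "AE x in lebesgue. 0 < \<omega> x"
  using muckenhoupt_AE_pos[OF \<omega> \<xi> r\<omega>] .

text \<open>Positivity of \<omega> almost everywhere turns finite weighted integrals into finite
  values of \<open>U\<close>. With the majorant as \<open>U\<close> this is absolute convergence of
  the operator.\<close>

lemma AE_finite_of_annuli:
  assumes [measurable]: "U \<in> borel_measurable lebesgue"
    and fin: "\<And>k. (\<integral>\<^sup>+x\<in>dyadic_annulus k. ennpowr (U x) qs * ennreal (\<omega> x) \<partial>lebesgue) < top"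
  shows "AE x in lebesgue. U x < top"
proof -
  have [measurable]: "\<omega> \<in> borel_measurable lebesgue"
    using weights(1) by (rule weight_measurable)
  have "AE x in lebesgue. ennpowr (U x) qs * ennreal (\<omega> x) * indicator (dyadic_annulus k) x \<noteq> \<infinity>" for k
    using fin[of k] by (intro nn_integral_PInf_AE) auto
  then have "AE x in lebesgue. \<forall>k::int. ennpowr (U x) qs * ennreal (\<omega> x) * indicator (dyadic_annulus k) x \<noteq> \<infinity>"
    by (subst AE_all_countable) blast
  moreover have "AE x in lebesgue. x \<noteq> (0 :: real ^ 'n)"
    using AE_not_in[of "{0}" "lebesgue :: (real ^ 'n) measure"] by simp
  ultimately show ?thesis
    using \<omega>_AE_pos
  proof eventually_elim
    case (elim x)
    have "0 < norm x" using elim by simp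
    then obtain l :: int where l: "norm x \<le> 2 powr of_int l" "2 powr of_int (l - 1) < norm x"
      using dyadic_exponent_exists by metis
    then have "x \<in> dyadic_annulus l"
      by (simp add: dyadic_annulus_def dyadic_ball_def two_powi_eq_powr)
    then have "ennpowr (U x) qs * ennreal (\<omega> x) \<noteq> top"
      using elim(1)[rule_format, of l] by simp
    then have "ennpowr (U x) qs \<noteq> top"
      using elim by (auto simp: ennreal_top_mult ennreal_eq_0_iff)
    then show ?case
      using qs by (simp add: ennpowr_eq_top_iff less_top)
  qed
qed

lemma hausdorff_bounded:
  fixes \<Phi> :: "real ^ 'n \<Rightarrow> complex"
  assumes \<Phi> [measurable]: "\<Phi> \<in> borel_measurable lebesgue"
    and A: "\<And>i. i \<in> {1..m} \<Longrightarrow> A i \<in> borel_measurable lebesgue"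
    and A_det: "\<And>i. i \<in> {1..m} \<Longrightarrow> AE y in lebesgue. \<Phi> y \<noteq> 0 \<longrightarrow> det (A i y) \<noteq> 0"
    and fin: "hausdorff_const_B2 \<Phi> A < \<infinity>"
  shows "\<exists>C::real. \<forall>f :: nat \<Rightarrow> real ^ 'n \<Rightarrow> complex.
           (\<forall>i\<in>{1..m}. f i \<in> morrey_herz v \<omega> (\<alpha> i) (lam i) (pp i) (qq i)) \<longrightarrow>
             (AE x in lebesgue. integrable lebesgue (hausdorff_integrand m \<Phi> A f x)) \<and>
             hausdorff_op m \<Phi> A f \<in> morrey_herz v \<omega> \<alpha>s lams p qs \<and>
             morrey_herz_norm v \<omega> \<alpha>s lams p qs (hausdorff_op m \<Phi> A f)
               \<le> ennreal C *
                  (\<Prod>i=1..m. source_norm i (f i))"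
proof -
  have [measurable]: "\<omega> \<in> borel_measurable lebesgue"
    using weights(1) by (rule weight_measurable)
  have \<omega>0: "0 \<le> \<omega> x" for x using weights(1) by (rule weight_nonneg)
  obtain C :: real where C: "\<And>f k0. (\<And>i. i \<in> {1..m} \<Longrightarrow> f i \<in> borel_measurable borel) \<Longrightarrow>
    ennreal (V k0 powr (- lams / n)) * annulus_sum (\<lambda>x. ennpowr (hausdorff_majorant m \<Phi> A f x) qs * ennreal (\<omega> x)) k0
      \<le> ennreal C * (\<Prod>i=1..m. source_norm i (f i))"
    using hausdorff_borel_estimate[OF \<Phi> A A_det fin] by blast
  show ?thesis
  proof (intro exI[of _ C] allI impI)
    fix f :: "nat \<Rightarrow> real ^ 'n \<Rightarrow> complex"
    assume f: "\<forall>i\<in>{1..m}. f i \<in> morrey_herz v \<omega> (\<alpha> i) (lam i) (pp i) (qq i)"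
    define M where "M = (\<Prod>i=1..m. source_norm i (f i))"
    have "M < top"
      unfolding M_def using f by (intro prod_less_top_ennreal) (auto simp: morrey_herz_def)
    then have CM: "ennreal C * M < top"
      by (simp add: ennreal_mult_less_top)
    have "\<forall>i\<in>{1..m}. \<exists>g. g \<in> borel_measurable borel \<and> (AE x in lebesgue. f i x = g x)"
      using f lebesgue_measurable_complex_borel unfolding morrey_herz_def by blast
    \<comment> \<open>The estimate is available for Borel functions; the representatives leave the
      source norms unchanged.\<close>
    then obtain g where g: "\<And>i. i \<in> {1..m} \<Longrightarrow> g i \<in> borel_measurable borel"
        "\<And>i. i \<in> {1..m} \<Longrightarrow> AE x in lebesgue. f i x = g i x"
      by metis
    have Mg: "M = (\<Prod>i=1..m. source_norm i (g i))"
      unfolding M_def by (intro prod.cong refl morrey_herz_norm_cong_AE g(2))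
    \<comment> \<open>One majorant serves both purposes: its finiteness gives integrability, and it
      dominates the modulus of the operator.\<close>
    define U where "U x = (\<integral>\<^sup>+y. ennreal (norm (hausdorff_integrand m \<Phi> A g x y)) \<partial>lebesgue)" for x
    have Hm [measurable]: "(\<lambda>(x, y). hausdorff_integrand m \<Phi> A g x y) \<in> borel_measurable (lebesgue \<Otimes>\<^sub>M lebesgue)"
      by (rule hausdorff_integrand_measurable[OF \<Phi> A g(1)])
    have [measurable]: "U \<in> borel_measurable lebesgue"
      unfolding U_def
      by (intro sigma_finite_measure.borel_measurable_nn_integral[OF sigma_finite_lebesgue]) measurable
    have CU: "ennreal (V k0 powr (- lams / n)) * annulus_sum (\<lambda>x. ennpowr (U x) qs * ennreal (\<omega> x)) k0
      \<le> ennreal C * M" for k0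
      unfolding Mg U_def by (rule C[OF g(1)])
    have Ufin: "(\<integral>\<^sup>+x\<in>dyadic_annulus k. ennpowr (U x) qs * ennreal (\<omega> x) \<partial>lebesgue) < top" for k
      using CU[of k] CM by (intro herz_sum_annulus_finite[of k]) (rule le_less_trans)

    have "AE x in lebesgue. \<forall>i\<in>{1..m}. AE y in lebesgue. \<Phi> y \<noteq> 0 \<longrightarrow> f i (A i y *v x) = g i (A i y *v x)"
      using AE_matrix_vector_eq[OF A \<Phi> A_det g(2)] by (subst AE_finite_all) auto
    then have fg: "AE x in lebesgue. AE y in lebesgue. hausdorff_integrand m \<Phi> A g x y = hausdorff_integrand m \<Phi> A f x y"
    proof eventually_elim
      case (elim x)
      then have "AE y in lebesgue. \<forall>i\<in>{1..m}. \<Phi> y \<noteq> 0 \<longrightarrow> f i (A i y *v x) = g i (A i y *v x)"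
        by (subst AE_finite_all) auto
      then show ?case
        by eventually_elim (auto simp: hausdorff_integrand_def intro!: prod.cong)
    qed
    have gm: "hausdorff_integrand m \<Phi> A g x \<in> borel_measurable lebesgue" for x
      using measurable_Pair2[OF Hm, of x] by simp
    \<comment> \<open>Both conclusions return from \<open>g\<close> to \<open>f\<close> at almost
      every \<open>x\<close>, because there the two integrands agree for almost every
      \<open>y\<close>.\<close>
    have op_eq: "AE x in lebesgue. integrable lebesgue (hausdorff_integrand m \<Phi> A f x)
        \<and> hausdorff_op m \<Phi> A g x = hausdorff_op m \<Phi> A f x
        \<and> ennreal (norm (hausdorff_op m \<Phi> A f x)) \<le> U x"
      using fg AE_finite_of_annuli[OF \<open>U \<in> borel_measurable lebesgue\<close> Ufin]
    proof eventually_elim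
      case (elim x)
      have fm: "hausdorff_integrand m \<Phi> A f x \<in> borel_measurable lebesgue"
        using gm elim(1) by (rule borel_measurable_lebesgue_cong_AE)
      have int: "integrable lebesgue (hausdorff_integrand m \<Phi> A g x)"
        using elim(2) gm by (simp add: integrable_iff_bounded U_def)
      have op: "hausdorff_op m \<Phi> A g x = hausdorff_op m \<Phi> A f x"
        unfolding hausdorff_op_def using elim(1) gm fm by (intro integral_cong_AE)
      have "integrable lebesgue (hausdorff_integrand m \<Phi> A f x)"
        using integrable_cong_AE[OF gm fm elim(1)] int by simp
      moreover have "ennreal (norm (hausdorff_op m \<Phi> A g x)) \<le> U x"
        unfolding hausdorff_op_def U_def using int by (rule integral_norm_bound_ennreal)
      ultimately show ?case using op by simp
    qed
    have opm: "hausdorff_op m \<Phi> A f \<in> borel_measurable lebesgue"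
    proof (rule borel_measurable_lebesgue_cong_AE)
      show "hausdorff_op m \<Phi> A g \<in> borel_measurable lebesgue"
        unfolding hausdorff_op_def[abs_def]
        by (intro sigma_finite_measure.borel_measurable_lebesgue_integral[OF sigma_finite_lebesgue] Hm)
      show "AE x in lebesgue. hausdorff_op m \<Phi> A g x = hausdorff_op m \<Phi> A f x"
        using op_eq by eventually_elim auto
    qed
    let ?h = "hausdorff_op m \<Phi> A f"
    have hU: "(\<integral>\<^sup>+x\<in>dyadic_annulus k. ennpowr (ennreal (norm (?h x))) qs * ennreal (\<omega> x) \<partial>lebesgue)
        \<le> (\<integral>\<^sup>+x\<in>dyadic_annulus k. ennpowr (U x) qs * ennreal (\<omega> x) \<partial>lebesgue)" for k
    proof (rule nn_integral_mono_AE)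
      show "AE x in lebesgue. ennpowr (ennreal (norm (?h x))) qs * ennreal (\<omega> x) * indicator (dyadic_annulus k) x
          \<le> ennpowr (U x) qs * ennreal (\<omega> x) * indicator (dyadic_annulus k) x"
        using op_eq by eventually_elim (use qs in \<open>auto intro!: mult_right_mono ennpowr_mono\<close>)
    qed
    have bound: "morrey_herz_norm v \<omega> \<alpha>s lams p qs ?h \<le> ennreal C * M"
    proof -
      have "morrey_herz_norm v \<omega> \<alpha>s lams p qs ?h
          = (SUP k0. ennreal (V k0 powr (- lams / n)) * herz_sum v \<omega> \<alpha>s p qs ?h k0)"
        unfolding n_def using p qs by (intro morrey_herz_norm_eq weights V_pos) auto
      also have "\<dots> \<le> ennreal C * M"
      proof (rule SUP_least)
        fix k0
        have "herz_sum v \<omega> \<alpha>s p qs ?h k0 \<le> annulus_sum (\<lambda>x. ennpowr (U x) qs * ennreal (\<omega> x)) k0"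
          unfolding herz_sum_def n_def[symmetric]
        proof (rule ennpowr_mono[OF _ nn_integral_mono])
          show "ennpowr (ennreal (V k powr (\<alpha>s / n))
              * ennpowr (\<integral>\<^sup>+x\<in>dyadic_annulus k. ennpowr (ennreal (norm (?h x))) qs * ennreal (\<omega> x) \<partial>lebesgue) (1 / qs)) p
            \<le> ennpowr (ennreal (V k powr (\<alpha>s / n))
              * ennpowr (\<integral>\<^sup>+x\<in>dyadic_annulus k. ennpowr (U x) qs * ennreal (\<omega> x) \<partial>lebesgue) (1 / qs)) p" for k
            using p qs hU[of k] by (intro ennpowr_mono mult_left_mono) auto
        qed (use p in auto)
        then have "ennreal (V k0 powr (- lams / n)) * herz_sum v \<omega> \<alpha>s p qs ?h k0
            \<le> ennreal (V k0 powr (- lams / n)) * \<dots>"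
          by (rule mult_left_mono) simp
        also have "\<dots> \<le> ennreal C * M" by (rule CU)
        finally show "ennreal (V k0 powr (- lams / n)) * herz_sum v \<omega> \<alpha>s p qs ?h k0 \<le> ennreal C * M" .
      qed
      finally show ?thesis .
    qed
    \<comment> \<open>Membership in the target space includes this condition besides the norm bound;
      it follows from the finiteness of the majorant on each annulus.\<close>
    have loc: "(\<integral>\<^sup>+x\<in>K. ennreal (norm (?h x) powr qs * \<omega> x) \<partial>lebesgue) < \<infinity>" if K: "compact K" "0 \<notin> K" for K
    proof -
      obtain a b :: int where ab: "K \<subseteq> (\<Union>j\<in>{a..b}. dyadic_annulus j)"
        using compact_subset_annuli[OF K] .
      have eq: "ennreal (norm (?h x) powr qs * \<omega> x) = ennpowr (ennreal (norm (?h x))) qs * ennreal (\<omega> x)" for x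
        using qs \<omega>0[of x] by (simp add: ennpowr_ennreal_nonneg ennreal_mult)
      have "(\<integral>\<^sup>+x\<in>K. ennreal (norm (?h x) powr qs * \<omega> x) \<partial>lebesgue)
          \<le> (\<integral>\<^sup>+x. (\<Sum>j\<in>{a..b}. ennpowr (ennreal (norm (?h x))) qs * ennreal (\<omega> x) * indicator (dyadic_annulus j) x) \<partial>lebesgue)"
      proof (rule nn_integral_mono)
        fix x
        show "ennreal (norm (?h x) powr qs * \<omega> x) * indicator K x
            \<le> (\<Sum>j\<in>{a..b}. ennpowr (ennreal (norm (?h x))) qs * ennreal (\<omega> x) * indicator (dyadic_annulus j) x)"
        proof (cases "x \<in> K")
          case True
          then obtain j where j: "j \<in> {a..b}" "x \<in> dyadic_annulus j"
            using ab by blast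
          have "ennreal (norm (?h x) powr qs * \<omega> x) * indicator K x
              = ennpowr (ennreal (norm (?h x))) qs * ennreal (\<omega> x) * indicator (dyadic_annulus j) x"
            using True j(2) by (simp add: eq)
          also have "\<dots> \<le> (\<Sum>j\<in>{a..b}. ennpowr (ennreal (norm (?h x))) qs * ennreal (\<omega> x) * indicator (dyadic_annulus j) x)"
            using j(1) by (intro member_le_sum) auto
          finally show ?thesis .
        qed simp
      qed
      also have "\<dots> = (\<Sum>j\<in>{a..b}. (\<integral>\<^sup>+x\<in>dyadic_annulus j. ennpowr (ennreal (norm (?h x))) qs * ennreal (\<omega> x) \<partial>lebesgue))"
      proof (rule nn_integral_sum)
        note [measurable] = opm
        show "(\<lambda>x. ennpowr (ennreal (norm (?h x))) qs * ennreal (\<omega> x) * indicator (dyadic_annulus j) x)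
            \<in> borel_measurable lebesgue" for j
          by measurable
      qed
      also have "\<dots> < \<infinity>"
        using le_less_trans[OF hU Ufin] by simp
      finally show ?thesis .
    qed
    show "(AE x in lebesgue. integrable lebesgue (hausdorff_integrand m \<Phi> A f x)) \<and>
             ?h \<in> morrey_herz v \<omega> \<alpha>s lams p qs \<and>
             morrey_herz_norm v \<omega> \<alpha>s lams p qs ?h
               \<le> ennreal C * (\<Prod>i=1..m. source_norm i (f i))"
      using op_eq opm loc bound CM unfolding morrey_herz_def M_def
      by (auto elim: eventually_mono intro: le_less_trans)
  qed
qed

end

text \<open>In both ranges of \<open>norm (A y)\<close> the two exponents differ by the same number
  (n/qs + \<alpha>s)(\<theta> - \<xi>), a product of two nonpositive factors. The larger exponent
  stands in \<open>B2_factor\<close> below norm 1 and in \<open>B1_factor\<close> from norm 1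
  on.\<close>

lemma B2_factor_le_B1_factor:
  fixes A :: "real ^ 'n \<Rightarrow> real ^ 'n ^ 'n"
  assumes s: "\<alpha>s / real CARD('n) + 1 / qs \<le> 0" and \<xi>: "1 \<le> \<xi>" and \<delta>1: "1 < \<delta>1"
  shows "B2_factor m qs \<alpha>s \<xi> \<eta> \<delta>1 \<delta>2 lam A y \<le> B1_factor m qs \<alpha>s \<xi> \<eta> \<delta>1 \<delta>2 lam A y"
proof -
  let ?n = "real CARD('n)" and ?t = "norm (A y)"
  define \<theta> where "\<theta> = (\<delta>1 - 1) / \<delta>1"
  have "\<theta> \<le> \<xi>" using \<delta>1 \<xi> by (simp add: \<theta>_def divide_le_eq) (smt (verit) mult_le_cancel_right1)
  moreover have "?n / qs + \<alpha>s \<le> 0"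
  proof -
    have "?n * (\<alpha>s / ?n + 1 / qs) \<le> 0"
      using s by (intro mult_nonneg_nonpos) auto
    then show ?thesis by (simp add: distrib_left)
  qed
  ultimately have key: "0 \<le> (?n / qs + \<alpha>s) * (\<theta> - \<xi>)"
    by (intro mult_nonpos_nonpos) auto
  define z where "z = ?n / qs"
  have z: "\<xi> * ?n / qs = \<xi> * z" "?n / qs = z" by (simp_all add: z_def)
  show ?thesis
  proof (cases "?t < 1")
    case True
    have "?t powr (- (\<xi> * ?n / qs + (\<alpha>s - real m * lam) * ((\<delta>2 - 1) / \<delta>2)))
        \<le> ?t powr (- ((?n / qs + \<alpha>s) * \<theta> + (\<alpha>s - real m * lam) * ((\<delta>2 - 1) / \<delta>2) - \<xi> * \<alpha>s))"
      using True key unfolding z by (intro powr_mono') (auto simp: algebra_simps)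
    then show ?thesis
      using True by (simp add: B1_factor_def B2_factor_def \<theta>_def)
  next
    case False
    have "?t powr (- (?n / qs * \<theta> + \<eta> * (\<alpha>s - real m * lam)))
        \<le> ?t powr (- ((?n / qs + \<alpha>s) * \<xi> + \<eta> * (\<alpha>s - real m * lam) - \<alpha>s * \<theta>))"
      using False key unfolding z by (intro powr_mono) (auto simp: algebra_simps)
    then show ?thesis
      using False by (simp add: B1_factor_def B2_factor_def \<theta>_def)
  qed
qed

lemma hausdorff_const_mono:
  assumes "\<And>i y. i \<in> {1..m} \<Longrightarrow> B i y \<le> B' i y"
  shows "hausdorff_const m \<Phi> A \<xi> q B \<le> hausdorff_const m \<Phi> A \<xi> q B'"
  unfolding hausdorff_const_def
  using assms by (intro prod_mono_ennreal ennpowr_mono nn_integral_mono ennreal_leI mult_left_mono) auto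

theorem theorem3p8:
  fixes m :: nat
    and \<Phi> :: "real ^ 'n \<Rightarrow> complex"
    and A :: "nat \<Rightarrow> real ^ 'n \<Rightarrow> real ^ 'n ^ 'n"
    and p q qs \<xi> \<eta> \<delta>1 \<delta>2 \<alpha>s lams r\<omega> r\<omega>' rv :: real
    and pp qq \<alpha> lam :: "nat \<Rightarrow> real"
    and v \<omega> :: "real ^ 'n \<Rightarrow> real"
  assumes m: "1 \<le> m"
    and \<Phi>: "locally_integrable \<Phi>"
    and A_meas: "\<And>i. i \<in> {1..m} \<Longrightarrow> A i \<in> borel_measurable lebesgue"
    and A_det: "\<And>i. i \<in> {1..m} \<Longrightarrow> AE y in lebesgue. \<Phi> y \<noteq> 0 \<longrightarrow> det (A i y) \<noteq> 0"
    and p: "1 \<le> p" and q: "1 \<le> q"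
    and pp: "\<And>i. i \<in> {1..m} \<Longrightarrow> 1 \<le> pp i"
    and qq: "\<And>i. i \<in> {1..m} \<Longrightarrow> 1 \<le> qq i"
    and sum_p: "(\<Sum>i=1..m. 1 / pp i) = 1 / p"
    and sum_q: "(\<Sum>i=1..m. 1 / qq i) = 1 / q"
    and qs: "1 \<le> qs" and \<xi>: "1 \<le> \<xi>" and \<eta>: "1 \<le> \<eta>"
    and \<alpha>: "\<And>i. i \<in> {1..m} \<Longrightarrow> \<alpha> i < 0"
    and lam: "\<And>i. i \<in> {1..m} \<Longrightarrow> 0 \<le> lam i"
    and \<omega>: "\<omega> \<in> muckenhoupt \<xi>" and v: "v \<in> muckenhoupt \<eta>"
    and r\<omega>: "critical_index \<omega> = ereal r\<omega>"
    and rv: "critical_index v = ereal rv"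
    and r\<omega>': "1 / r\<omega> + 1 / r\<omega>' = 1"
    and \<omega>_le_v: "\<exists>C::real. \<forall>k::int.
          wmeasure \<omega> (dyadic_ball k) \<le> ennreal C * wmeasure v (dyadic_ball k)"
    and q_gt: "q > max (real m * qs) (qs * \<xi> * r\<omega>')"
    and \<delta>1: "1 < \<delta>1" "\<delta>1 < r\<omega>"
    and \<delta>2: "1 < \<delta>2" "\<delta>2 < rv"
    and lams: "lams = (\<Sum>i=1..m. lam i)"
    and \<alpha>s: "\<And>i. i \<in> {1..m} \<Longrightarrow>
          1 / real m * (\<alpha>s / real CARD('n) + 1 / qs) = \<alpha> i / real CARD('n) + 1 / qq i"
    and cond: "(\<alpha>s / real CARD('n) + 1 / qs \<le> 0 \<and>
           hausdorff_const m \<Phi> A \<xi> qq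
             (\<lambda>i. B1_factor m qs \<alpha>s \<xi> \<eta> \<delta>1 \<delta>2 (lam i) (A i)) < \<infinity>)
        \<or> (\<alpha>s / real CARD('n) + 1 / qs > 0 \<and>
           hausdorff_const m \<Phi> A \<xi> qq
             (\<lambda>i. B2_factor m qs \<alpha>s \<xi> \<eta> \<delta>1 \<delta>2 (lam i) (A i)) < \<infinity>)"
  shows "\<exists>C::real. \<forall>f :: nat \<Rightarrow> real ^ 'n \<Rightarrow> complex.
           (\<forall>i\<in>{1..m}. f i \<in> morrey_herz v \<omega> (\<alpha> i) (lam i) (pp i) (qq i)) \<longrightarrow>
             (AE x in lebesgue. integrable lebesgue (hausdorff_integrand m \<Phi> A f x)) \<and>
             hausdorff_op m \<Phi> A f \<in> morrey_herz v \<omega> \<alpha>s lams p qs \<and>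
             morrey_herz_norm v \<omega> \<alpha>s lams p qs (hausdorff_op m \<Phi> A f)
               \<le> ennreal C *
                  (\<Prod>i=1..m. morrey_herz_norm v \<omega> (\<alpha> i) (lam i) (pp i) (qq i) (f i))"
proof -
  have fin: "hausdorff_const m \<Phi> A \<xi> qq (\<lambda>i. B2_factor m qs \<alpha>s \<xi> \<eta> \<delta>1 \<delta>2 (lam i) (A i)) < \<infinity>"
    using cond
  proof (elim disjE conjE)
    assume s: "\<alpha>s / real CARD('n) + 1 / qs \<le> 0"
      and 1: "hausdorff_const m \<Phi> A \<xi> qq (\<lambda>i. B1_factor m qs \<alpha>s \<xi> \<eta> \<delta>1 \<delta>2 (lam i) (A i)) < \<infinity>"
    have "hausdorff_const m \<Phi> A \<xi> qq (\<lambda>i. B2_factor m qs \<alpha>s \<xi> \<eta> \<delta>1 \<delta>2 (lam i) (A i))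
        \<le> hausdorff_const m \<Phi> A \<xi> qq (\<lambda>i. B1_factor m qs \<alpha>s \<xi> \<eta> \<delta>1 \<delta>2 (lam i) (A i))"
      by (intro hausdorff_const_mono B2_factor_le_B1_factor s \<xi> \<delta>1)
    then show ?thesis using 1 by (rule le_less_trans)
  qed
  interpret two_weighted_exponents m p q qs \<xi> \<eta> \<delta>1 \<delta>2 \<alpha>s lams r\<omega> r\<omega>' rv pp qq \<alpha> lam v \<omega> "real CARD('n)"
    by unfold_locales (fact refl m p q pp qq sum_p sum_q qs \<xi> \<eta> \<alpha> lam \<omega> v r\<omega> rv r\<omega>' \<omega>_le_v q_gt \<delta>1 \<delta>2 lams \<alpha>s)+
  show ?thesis
    by (rule hausdorff_bounded[OF locally_integrable_measurable[OF \<Phi>] A_meas A_det fin])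
qed

end
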